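(* Let $\sigma=\{\sigma_i\mid i\in I\}$ be a partition of the set $\mathbb{P}$ of all primes and let $G$ be a finite $\sigma$-full group. Then any two of the following conditions are equivalent: (i) Every subgroup of $G$ is $H_\sigma$-permutably embedded in $G$. (ii) $G=D\rtimes M$ is an $H\sigma E$-group, where $D=G^{\mathfrak N_\sigma}$ is a cyclic group of square-free order. (iii) $G=D\rtimes M$, where $D$ is a cyclic $\sigma$-Hall subgroup of $G$ of square-free order with $|\sigma(D)|=|\pi(D)|$ and $M$ is $\sigma$-nilpotent.
   Context: All groups are finite. $\pi(n)$ is the set of primes dividing $n$, $\pi(G)=\pi(|G|)$. $\sigma=\{\sigma_i\mid i\in I\}$ is a partition of $\mathbb P$; $\sigma(n)=\{\sigma_i\mid \sigma_i\cap\pi(n)\neq\emptyset\}$ and $\sigma(G)=\sigma(|G|)$. A group is $\sigma$-primary if it is a $\sigma_i$-group for some $i$. A set $\mathcal H$ of subgroups of $G$ is a complete Hall $\sigma$-set of $G$ if every member of $\mathcal H\setminus\{1\}$ is a Hall $\sigma_i$-subgroup of $G$ for some $i$ and $\mathcal H$ contains exactly one Hall $\sigma_i$-subgroup of $G$ for every $\sigma_i\in\sigma(G)$. $G$ is $\sigma$-full if it possesses a complete Hall $\sigma$-set. A subgroup $A$ of $G$ is a $\sigma$-Hall subgroup of $G$ if $\sigma(|A|)\cap\sigma(|G:A|)=\emptyset$. $A$ is $\sigma$-permutable in $G$ if $G$ possesses a complete Hall $\sigma$-set $\mathcal H$ such that $AH^x=H^xA$ for all $H\in\mathcal H$ and all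 $x\in G$. $A$ is $H_\sigma$-permutably embedded in $G$ if $A$ is a $\sigma$-Hall subgroup of some $\sigma$-permutable subgroup of $G$. A group is $\sigma$-nilpotent if it is a direct product of $\sigma$-primary groups. $G^{\mathfrak N_\sigma}$ is the intersection of all normal subgroups $N$ of $G$ with $G/N$ $\sigma$-nilpotent. A group has a Sylow tower if it has a normal series $1=G_0<G_1<\cdots<G_t=G$ such that each $|G_i/G_{i-1}|$ is the order of some Sylow subgroup of $G$. A chief factor $H/K$ of $G$ is $\sigma$-central in $G$ if $(H/K)\rtimes(G/C_G(H/K))$ is $\sigma$-primary, and $\sigma$-eccentric otherwise. $G$ is an $H\sigma E$-group if: (a) $G=D\rtimes M$, where $D=G^{\mathfrak N_\sigma}$ is a $\sigma$-Hall subgroup of $G$ and $|\sigma(D)|=|\pi(D)|$; (b) $D$ has a Sylow tower and every chief factor of $G$ below $D$ is $\sigma$-eccentric; (c) $M$ acts irreducibly on every $M$-invariant Sylow subgroup of $D$. In "$G=D\rtimes M$ is an $H\sigma E$-group", $D$ and $M$ are the subgroups appearing in (a)–(c). *)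

theory Defs
  imports
    "HOL-Algebra.Product_Groups"
    "HOL-Computational_Algebra.Squarefree"
    "HOL-Library.Disjoint_Sets"
begin

text \<open>
  Throughout, \<open>\<sigma> :: nat set set\<close> is the partition of the set of all primes (the blocks
  \<open>\<sigma>\<^sub>i\<close> are its members), subgroups of \<open>G\<close> are carrier sets, and a subgroup \<open>A\<close> regarded as
  a group in its own right is \<open>G\<lparr>carrier := A\<rparr>\<close>. The set \<open>\<pi>(n)\<close> is \<open>prime_factors n\<close>, and
  the index \<open>|G : A|\<close> is \<open>card (rcosets\<^bsub>G\<^esub> A)\<close>.
\<close>

section \<open>Hall subgroups and permutability\<close>

definition sigma_of :: "nat set set \<Rightarrow> nat \<Rightarrow> nat set set" where
  "sigma_of \<sigma> n = {s \<in> \<sigma>. s \<inter> prime_factors n \<noteq> {}}"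

definition pi_group :: "nat set \<Rightarrow> ('a, 'b) monoid_scheme \<Rightarrow> bool" where
  "pi_group s G \<longleftrightarrow> finite (carrier G) \<and> prime_factors (order G) \<subseteq> s"

definition sigma_primary :: "nat set set \<Rightarrow> ('a, 'b) monoid_scheme \<Rightarrow> bool" where
  "sigma_primary \<sigma> G \<longleftrightarrow> (\<exists>s\<in>\<sigma>. pi_group s G)"

definition hall_subgroup :: "nat set \<Rightarrow> ('a, 'b) monoid_scheme \<Rightarrow> 'a set \<Rightarrow> bool" where
  "hall_subgroup s G H \<longleftrightarrow> subgroup H G \<and> pi_group s (G\<lparr>carrier := H\<rparr>) \<and>
     prime_factors (card (rcosets\<^bsub>G\<^esub> H)) \<inter> s = {}"

definition complete_hall_sigma_set ::
    "nat set set \<Rightarrow> ('a, 'b) monoid_scheme \<Rightarrow> 'a set set \<Rightarrow> bool" where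
  "complete_hall_sigma_set \<sigma> G \<H> \<longleftrightarrow>
     (\<forall>H\<in>\<H>. subgroup H G) \<and>
     (\<forall>H \<in> \<H> - {{\<one>\<^bsub>G\<^esub>}}. \<exists>s\<in>\<sigma>. hall_subgroup s G H) \<and>
     (\<forall>s \<in> sigma_of \<sigma> (order G). \<exists>!H. H \<in> \<H> \<and> hall_subgroup s G H)"

definition sigma_full :: "nat set set \<Rightarrow> ('a, 'b) monoid_scheme \<Rightarrow> bool" where
  "sigma_full \<sigma> G \<longleftrightarrow> (\<exists>\<H>. complete_hall_sigma_set \<sigma> G \<H>)"

definition sigma_hall_subgroup :: "nat set set \<Rightarrow> ('a, 'b) monoid_scheme \<Rightarrow> 'a set \<Rightarrow> bool" where
  "sigma_hall_subgroup \<sigma> G A \<longleftrightarrow> subgroup A G \<and>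
     sigma_of \<sigma> (card A) \<inter> sigma_of \<sigma> (card (rcosets\<^bsub>G\<^esub> A)) = {}"

text \<open>The conjugate \<open>H\<^sup>x = x\<inverse> H x\<close>.\<close>

definition conj_set :: "('a, 'b) monoid_scheme \<Rightarrow> 'a set \<Rightarrow> 'a \<Rightarrow> 'a set" where
  "conj_set G H x = (inv\<^bsub>G\<^esub> x <#\<^bsub>G\<^esub> H) #>\<^bsub>G\<^esub> x"

definition sigma_permutable :: "nat set set \<Rightarrow> ('a, 'b) monoid_scheme \<Rightarrow> 'a set \<Rightarrow> bool" where
  "sigma_permutable \<sigma> G A \<longleftrightarrow> subgroup A G \<and>
     (\<exists>\<H>. complete_hall_sigma_set \<sigma> G \<H> \<and>
        (\<forall>H\<in>\<H>. \<forall>x\<in>carrier G. A <#>\<^bsub>G\<^esub> conj_set G H x = conj_set G H x <#>\<^bsub>G\<^esub> A))"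

definition H_sigma_permutably_embedded ::
    "nat set set \<Rightarrow> ('a, 'b) monoid_scheme \<Rightarrow> 'a set \<Rightarrow> bool" where
  "H_sigma_permutably_embedded \<sigma> G A \<longleftrightarrow>
     (\<exists>E. sigma_permutable \<sigma> G E \<and> sigma_hall_subgroup \<sigma> (G\<lparr>carrier := E\<rparr>) A)"

section \<open>Nilpotency and the residual\<close>

text \<open>
  The factors may be taken over the element type of \<open>G\<close> without loss of generality, because each
  direct factor is isomorphic to a subgroup of \<open>G\<close>. The empty product is the trivial group.
\<close>

definition sigma_nilpotent :: "nat set set \<Rightarrow> ('a, 'b) monoid_scheme \<Rightarrow> bool" where
  "sigma_nilpotent \<sigma> G \<longleftrightarrow>
     (\<exists>(n::nat) (K :: nat \<Rightarrow> 'a monoid).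
        (\<forall>i<n. group (K i) \<and> sigma_primary \<sigma> (K i)) \<and> G \<cong> product_group {..<n} K)"

definition sigma_nilpotent_residual :: "nat set set \<Rightarrow> ('a, 'b) monoid_scheme \<Rightarrow> 'a set" where
  "sigma_nilpotent_residual \<sigma> G = \<Inter>{N. N \<lhd> G \<and> sigma_nilpotent \<sigma> (G Mod N)}"

section \<open>Semidirect products\<close>

definition internal_semidirect :: "('a, 'b) monoid_scheme \<Rightarrow> 'a set \<Rightarrow> 'a set \<Rightarrow> bool" where
  "internal_semidirect G D M \<longleftrightarrow>
     D \<lhd> G \<and> subgroup M G \<and> D <#>\<^bsub>G\<^esub> M = carrier G \<and> D \<inter> M = {\<one>\<^bsub>G\<^esub>}"

text \<open>The external product \<open>N \<rtimes> H\<close> for a left action \<open>\<phi>\<close> of \<open>H\<close> on \<open>N\<close> by automorphisms.\<close>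

definition semidirect_product ::
    "('a, 'c) monoid_scheme \<Rightarrow> ('b, 'd) monoid_scheme \<Rightarrow> ('b \<Rightarrow> 'a \<Rightarrow> 'a) \<Rightarrow> ('a \<times> 'b) monoid" where
  "semidirect_product N H \<phi> =
     \<lparr>carrier = carrier N \<times> carrier H,
      monoid.mult = (\<lambda>(n, h) (n', h'). (n \<otimes>\<^bsub>N\<^esub> \<phi> h n', h \<otimes>\<^bsub>H\<^esub> h')),
      monoid.one = (\<one>\<^bsub>N\<^esub>, \<one>\<^bsub>H\<^esub>)\<rparr>"

lemma group_semidirect_product:
  assumes "group N" "group H"
    and closed: "\<And>h n. h \<in> carrier H \<Longrightarrow> n \<in> carrier N \<Longrightarrow> \<phi> h n \<in> carrier N"
    and hom: "\<And>h n n'. h \<in> carrier H \<Longrightarrow> n \<in> carrier N \<Longrightarrow> n' \<in> carrier N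
               \<Longrightarrow> \<phi> h (n \<otimes>\<^bsub>N\<^esub> n') = \<phi> h n \<otimes>\<^bsub>N\<^esub> \<phi> h n'"
    and mult: "\<And>h h' n. h \<in> carrier H \<Longrightarrow> h' \<in> carrier H \<Longrightarrow> n \<in> carrier N
               \<Longrightarrow> \<phi> (h \<otimes>\<^bsub>H\<^esub> h') n = \<phi> h (\<phi> h' n)"
    and one: "\<And>n. n \<in> carrier N \<Longrightarrow> \<phi> \<one>\<^bsub>H\<^esub> n = n"
  shows "group (semidirect_product N H \<phi>)"
proof -
  interpret N: group N by fact
  interpret H: group H by fact
  show ?thesis
  proof (rule groupI)
    show "\<one>\<^bsub>semidirect_product N H \<phi>\<^esub> \<in> carrier (semidirect_product N H \<phi>)"
      by (simp add: semidirect_product_def)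
  next
    fix x y
    assume "x \<in> carrier (semidirect_product N H \<phi>)" "y \<in> carrier (semidirect_product N H \<phi>)"
    then show "x \<otimes>\<^bsub>semidirect_product N H \<phi>\<^esub> y \<in> carrier (semidirect_product N H \<phi>)"
      by (auto simp: semidirect_product_def closed)
  next
    fix x y z
    assume "x \<in> carrier (semidirect_product N H \<phi>)" "y \<in> carrier (semidirect_product N H \<phi>)"
      "z \<in> carrier (semidirect_product N H \<phi>)"
    then show "x \<otimes>\<^bsub>semidirect_product N H \<phi>\<^esub> y \<otimes>\<^bsub>semidirect_product N H \<phi>\<^esub> z =
               x \<otimes>\<^bsub>semidirect_product N H \<phi>\<^esub> (y \<otimes>\<^bsub>semidirect_product N H \<phi>\<^esub> z)"
      by (auto simp: semidirect_product_def closed hom mult N.m_assoc H.m_assoc)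
  next
    fix x
    assume "x \<in> carrier (semidirect_product N H \<phi>)"
    then show "\<one>\<^bsub>semidirect_product N H \<phi>\<^esub> \<otimes>\<^bsub>semidirect_product N H \<phi>\<^esub> x = x"
      by (auto simp: semidirect_product_def one)
  next
    fix x
    assume "x \<in> carrier (semidirect_product N H \<phi>)"
    then obtain n h where x: "x = (n, h)" "n \<in> carrier N" "h \<in> carrier H"
      by (auto simp: semidirect_product_def)
    have "\<phi> (inv\<^bsub>H\<^esub> h) (inv\<^bsub>N\<^esub> n) \<otimes>\<^bsub>N\<^esub> \<phi> (inv\<^bsub>H\<^esub> h) n = \<phi> (inv\<^bsub>H\<^esub> h) \<one>\<^bsub>N\<^esub>"
      using hom[of "inv\<^bsub>H\<^esub> h" "inv\<^bsub>N\<^esub> n" n] x by simp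
    moreover have "\<phi> (inv\<^bsub>H\<^esub> h) \<one>\<^bsub>N\<^esub> = \<one>\<^bsub>N\<^esub>"
      using hom[of "inv\<^bsub>H\<^esub> h" "\<one>\<^bsub>N\<^esub>" "\<one>\<^bsub>N\<^esub>"] closed[of "inv\<^bsub>H\<^esub> h" "\<one>\<^bsub>N\<^esub>"] x
      by (metis H.inv_closed N.l_cancel_one' N.one_closed N.r_one)
    ultimately show "\<exists>y\<in>carrier (semidirect_product N H \<phi>).
        y \<otimes>\<^bsub>semidirect_product N H \<phi>\<^esub> x = \<one>\<^bsub>semidirect_product N H \<phi>\<^esub>"
      using x by (intro bexI[of _ "(\<phi> (inv\<^bsub>H\<^esub> h) (inv\<^bsub>N\<^esub> n), inv\<^bsub>H\<^esub> h)"])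
        (auto simp: semidirect_product_def closed)
  qed
qed

section \<open>Chief factors\<close>

definition chief_factor :: "('a, 'b) monoid_scheme \<Rightarrow> 'a set \<Rightarrow> 'a set \<Rightarrow> bool" where
  "chief_factor G H K \<longleftrightarrow> H \<lhd> G \<and> K \<lhd> G \<and> K \<subset> H \<and>
     \<not> (\<exists>L. L \<lhd> G \<and> K \<subset> L \<and> L \<subset> H)"

text \<open>\<open>C\<^sub>G(H/K)\<close>, the kernel of the conjugation action of \<open>G\<close> on \<open>H/K\<close>.\<close>

definition factor_centralizer :: "('a, 'b) monoid_scheme \<Rightarrow> 'a set \<Rightarrow> 'a set \<Rightarrow> 'a set" where
  "factor_centralizer G H K =
     {g \<in> carrier G. \<forall>h\<in>H. K #>\<^bsub>G\<^esub> (g \<otimes>\<^bsub>G\<^esub> h \<otimes>\<^bsub>G\<^esub> inv\<^bsub>G\<^esub> g) = K #>\<^bsub>G\<^esub> h}"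

text \<open>
  The action of \<open>G/C\<^sub>G(H/K)\<close> on \<open>H/K\<close>: for every representative \<open>g\<close> of the coset \<open>X\<close>, the set
  \<open>{g b g\<inverse> | b \<in> B}\<close> is one and the same coset of \<open>K\<close>, so the union over all \<open>g \<in> X\<close> is the
  image of \<open>B\<close> under \<open>X\<close>.
\<close>

definition factor_action :: "('a, 'b) monoid_scheme \<Rightarrow> 'a set \<Rightarrow> 'a set \<Rightarrow> 'a set" where
  "factor_action G X B = {g \<otimes>\<^bsub>G\<^esub> b \<otimes>\<^bsub>G\<^esub> inv\<^bsub>G\<^esub> g |g b. g \<in> X \<and> b \<in> B}"

definition sigma_central ::
    "nat set set \<Rightarrow> ('a, 'b) monoid_scheme \<Rightarrow> 'a set \<Rightarrow> 'a set \<Rightarrow> bool" where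
  "sigma_central \<sigma> G H K \<longleftrightarrow>
     sigma_primary \<sigma> (semidirect_product (G\<lparr>carrier := H\<rparr> Mod K) (G Mod factor_centralizer G H K)
       (factor_action G))"

definition sigma_eccentric ::
    "nat set set \<Rightarrow> ('a, 'b) monoid_scheme \<Rightarrow> 'a set \<Rightarrow> 'a set \<Rightarrow> bool" where
  "sigma_eccentric \<sigma> G H K \<longleftrightarrow> \<not> sigma_central \<sigma> G H K"

section \<open>Sylow towers and the main class of groups\<close>

definition sylow_subgroup :: "nat \<Rightarrow> ('a, 'b) monoid_scheme \<Rightarrow> 'a set \<Rightarrow> bool" where
  "sylow_subgroup p G P \<longleftrightarrow>
     prime p \<and> subgroup P G \<and> card P = p ^ multiplicity p (order G)"

definition has_sylow_tower :: "('a, 'b) monoid_scheme \<Rightarrow> bool" where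
  "has_sylow_tower G \<longleftrightarrow>
     (\<exists>(t::nat) S. S 0 = {\<one>\<^bsub>G\<^esub>} \<and> S t = carrier G \<and> (\<forall>i\<le>t. S i \<lhd> G) \<and>
        (\<forall>i<t. S i \<subset> S (Suc i) \<and>
           (\<exists>p P. sylow_subgroup p G P \<and> order (G\<lparr>carrier := S (Suc i)\<rparr> Mod S i) = card P)))"

definition invariant_under :: "('a, 'b) monoid_scheme \<Rightarrow> 'a set \<Rightarrow> 'a set \<Rightarrow> bool" where
  "invariant_under G M P \<longleftrightarrow> (\<forall>m\<in>M. conj_set G P m = P)"

definition acts_irreducibly :: "('a, 'b) monoid_scheme \<Rightarrow> 'a set \<Rightarrow> 'a set \<Rightarrow> bool" where
  "acts_irreducibly G M P \<longleftrightarrow> P \<noteq> {\<one>\<^bsub>G\<^esub>} \<and>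
     (\<forall>Q. subgroup Q G \<and> Q \<subseteq> P \<and> invariant_under G M Q \<longrightarrow> Q = {\<one>\<^bsub>G\<^esub>} \<or> Q = P)"

text \<open>
  In the last condition \<open>p\<close> ranges over the prime divisors of \<open>|D|\<close> only, so that the trivial
  subgroup is never among the Sylow subgroups considered.
\<close>

definition H_sigma_E_group ::
    "nat set set \<Rightarrow> ('a, 'b) monoid_scheme \<Rightarrow> 'a set \<Rightarrow> 'a set \<Rightarrow> bool" where
  "H_sigma_E_group \<sigma> G D M \<longleftrightarrow>
     (internal_semidirect G D M \<and> D = sigma_nilpotent_residual \<sigma> G \<and>
      sigma_hall_subgroup \<sigma> G D \<and> card (sigma_of \<sigma> (card D)) = card (prime_factors (card D))) \<and>
     (has_sylow_tower (G\<lparr>carrier := D\<rparr>) \<and>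
      (\<forall>H K. chief_factor G H K \<and> H \<subseteq> D \<longrightarrow> sigma_eccentric \<sigma> G H K)) \<and>
     (\<forall>p \<in> prime_factors (card D). \<forall>P. sylow_subgroup p (G\<lparr>carrier := D\<rparr>) P \<and>
        invariant_under G M P \<longrightarrow> acts_irreducibly G M P)"

end

theory Submission
  imports Defs "HOL-Algebra.Sylow" "HOL-Algebra.Group_Action" "HOL-Algebra.Multiplicative_Group"
    "HOL-Number_Theory.Residues"
begin

text \<open>
  Conditions (i), (ii) and (iii) are each equivalent to the existence of a normal cyclic \<open>\<sigma>\<close>-Hall
  subgroup \<open>D\<close> of square-free order, with at most one prime from each \<open>\<sigma>\<^sub>i\<close> dividing \<open>|D|\<close>, such that
  \<open>G/D\<close> is \<open>\<sigma>\<close>-nilpotent; a complement \<open>M\<close> then exists because \<open>D\<close> is abelian.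

  Given such a \<open>D\<close> and a subgroup \<open>A\<close>, the subgroup \<open>AD\<close> is \<open>\<sigma>\<close>-permutable, because \<open>DH\<close> is normal for
  every Hall \<open>\<sigma>\<^sub>i\<close>-subgroup \<open>H\<close>, and \<open>A\<close> is a \<open>\<sigma>\<close>-Hall subgroup of it. The residual is a subgroup
  of \<open>D\<close> and inherits its properties. A \<open>\<sigma>\<close>-central chief factor below the residual would yield a
  central subgroup of prime order in it that is a direct factor of \<open>G\<close>, against minimality.

  Conversely, assume (i). The section \<open>X/Z\<close> above a maximal normal subgroup \<open>Z\<close> of a normal subgroup
  \<open>X\<close> has no room for an embedding subgroup other than \<open>X\<close> (Kegel), and transfer to a Sylow subgroup for
  the smallest prime shows that it is a \<open>\<sigma>\<^sub>i\<close>-group for some \<open>i\<close>. Hence \<open>C\<close>, the intersection of the centralizers of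
  all \<open>O\<^bsub>\<sigma>\<^sub>i\<^esub>(G)\<close>, is abelian. If an element \<open>g\<close> of \<open>\<sigma>\<^sub>i'\<close>-order does not centralize
  \<open>O\<^bsub>\<sigma>\<^sub>i\<^esub>(G)\<close>, embedding the cyclic subgroups of this core forces \<open>[x,g]\<close> to lie in the subgroup
  generated by \<open>x\<close> for each \<open>x\<close> in it, so that it has prime order, and a Frattini argument makes it a Hall
  subgroup. If no such \<open>g\<close> exists, \<open>G\<close> has a normal \<open>\<sigma>\<^sub>i\<close>-complement. The intersection of these
  complements is the required \<open>D\<close>, the product of the cores of prime order.
\<close>

section \<open>Numbers\<close>

text \<open>The obstacle in deriving structure from (i) is that no solubility is available to begin
  with, and that the embedding hypothesis is inherited by normal subgroups rather than carried to
  quotients. Sections are therefore treated as pairs Z \<le> X inside one fixed group, and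
  conditions are phrased through orders and indices. The working principle is arithmetic: a number
  that is both an s-number and a t-number for disjoint s and t equals 1, and the decisive identities
  (E = X, L \<inter> N = A \<inter> N, DH = T) are indices shown to be of both kinds. Likewise
  \<sigma>-nilpotency of G/Y is read on elements: for each union s of blocks, the elements that are
  s-elements modulo Y are closed under products. One exponent, the s-part of |G|, detects all of
  them, so the property passes to intersections of normal subgroups, and the kernels of several
  actions can be examined one at a time. The prime order of a core acted on nontrivially comes from
  embedding a product of two cyclic subgroups: every commutator [x,g] lies in every nontrivial
  cyclic subgroup of the core, while x \<mapsto> [x,g] is injective.\<close>

definition pi_number :: "nat set \<Rightarrow> nat \<Rightarrow> bool" where
  "pi_number s n \<longleftrightarrow> n > 0 \<and> prime_factors n \<subseteq> s"

lemma pi_number_pos: "pi_number s n \<Longrightarrow> n > 0"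
  by (simp add: pi_number_def)

lemma pi_number_1 [simp]: "pi_number s 1" "pi_number s (Suc 0)"
  by (simp_all add: pi_number_def)

lemma pi_number_prime: "pi_number s n \<Longrightarrow> prime p \<Longrightarrow> p dvd n \<Longrightarrow> p \<in> s"
  by (auto simp: pi_number_def in_prime_factors_iff)

lemma pi_numberI: "n > 0 \<Longrightarrow> (\<And>p. prime p \<Longrightarrow> p dvd n \<Longrightarrow> p \<in> s) \<Longrightarrow> pi_number s n"
  by (auto simp: pi_number_def in_prime_factors_iff)

lemma pi_number_mult [simp]: "pi_number s (a * b) \<longleftrightarrow> pi_number s a \<and> pi_number s b"
  by (auto simp: pi_number_def prime_factors_product)

lemma pi_number_dvd: "pi_number s b \<Longrightarrow> a dvd b \<Longrightarrow> pi_number s a"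
  by (rule pi_numberI) (auto intro: pi_number_prime pi_number_pos dvd_trans dvd_pos_nat)

lemma pi_number_mono: "pi_number s n \<Longrightarrow> s \<subseteq> t \<Longrightarrow> pi_number t n"
  by (auto simp: pi_number_def)

lemma pi_number_prime_power: "prime p \<Longrightarrow> p \<in> s \<Longrightarrow> pi_number s (p ^ k)"
  by (auto intro!: pi_numberI simp: prime_gt_0_nat dest: prime_dvd_power primes_dvd_imp_eq)

lemma pi_number_prime_self: "prime p \<Longrightarrow> pi_number s p \<longleftrightarrow> p \<in> s"
  by (auto simp: pi_number_def prime_prime_factors prime_gt_0_nat)

lemma pi_number_coprime:
  assumes "pi_number s a" "pi_number t b" "s \<inter> t = {}" shows "coprime a b"
proof (rule ccontr)
  assume "\<not> coprime a b"
  then have "gcd a b \<noteq> 1" by (simp add: coprime_iff_gcd_eq_1)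
  then obtain p where p: "prime p" "p dvd gcd a b" using prime_factor_nat by blast
  then have "p dvd a" "p dvd b" by auto
  then have "p \<in> s" "p \<in> t" using p(1) pi_number_prime assms by auto
  with assms(3) show False by auto
qed

lemma pi_number_coprime_compl: "pi_number s a \<Longrightarrow> pi_number (- s) b \<Longrightarrow> coprime a b"
  by (rule pi_number_coprime[of s a "- s"]) auto

lemma pi_number_dvd_1:
  "pi_number s a \<Longrightarrow> pi_number (- s) b \<Longrightarrow> c dvd a \<Longrightarrow> c dvd b \<Longrightarrow> c = 1"
  using coprime_common_divisor_nat[of a b c] pi_number_coprime_compl by blast

definition pi_part :: "nat set \<Rightarrow> nat \<Rightarrow> nat" where
  "pi_part s n = (\<Prod>p\<in>prime_factors n \<inter> s. p ^ multiplicity p n)"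

lemma pi_part_mult: assumes "n > 0" shows "pi_part s n * pi_part (- s) n = n"
proof -
  have "(\<Prod>p\<in>prime_factors n. p ^ multiplicity p n) = pi_part s n * pi_part (- s) n"
    unfolding pi_part_def by (subst prod.union_disjoint[symmetric]) (auto intro!: prod.cong)
  then show ?thesis using prime_factorization_nat[of n] assms by simp
qed

lemma pi_number_pi_part: assumes "n > 0" shows "pi_number s (pi_part s n)"
proof -
  have "pi_number s (\<Prod>p\<in>A. p ^ multiplicity p n)" if "finite A" "A \<subseteq> prime_factors n \<inter> s" for A
    using that
    by (induction A rule: finite_induct) (auto intro: pi_number_prime_power simp: in_prime_factors_iff)
  then show ?thesis unfolding pi_part_def by simp
qed

lemma pi_part_pos: "n > 0 \<Longrightarrow> pi_part s n > 0"
  using pi_number_pi_part pi_number_pos by blast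

lemma dvd_pi_part: assumes "n > 0" "k dvd n" "pi_number s k" shows "k dvd pi_part s n"
proof -
  have "coprime k (pi_part (- s) n)"
    using assms pi_number_coprime_compl pi_number_pi_part by blast
  moreover have "k dvd pi_part s n * pi_part (- s) n" using assms pi_part_mult by simp
  ultimately show ?thesis by (simp add: coprime_dvd_mult_left_iff)
qed

lemma squarefree_not_dvd_div:
  assumes "squarefree (n::nat)" "prime p" "p dvd n" shows "\<not> p dvd n div p"
proof
  assume "p dvd n div p"
  then have "p * p dvd n div p * p" by (rule mult_dvd_mono) simp
  then have "p ^ 2 dvd n" using assms(3) by (simp add: power2_eq_square)
  then show False using squarefreeD[OF assms(1)] assms(2) not_prime_unit by blast
qed

section \<open>Subgroups of a finite group\<close>

locale finite_group = group G for G (structure) +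
  assumes fin: "finite (carrier G)"

lemma (in group) cancel_left [simp]:
  "x \<in> carrier G \<Longrightarrow> y \<in> carrier G \<Longrightarrow> inv x \<otimes> (x \<otimes> y) = y"
  "x \<in> carrier G \<Longrightarrow> y \<in> carrier G \<Longrightarrow> x \<otimes> (inv x \<otimes> y) = y"
  by (simp_all flip: m_assoc)

context group begin

lemmas group_simps = m_assoc inv_mult_group

text \<open>Arbitrary sets are allowed on both sides: \<open>normalizes {x} Z\<close> describes the
  normalizer of \<open>Z\<close> one element at a time. Only an inclusion is required; equality
  follows when \<open>X\<close> is a subgroup or \<open>Z\<close> is finite.\<close>

definition normalizes :: "'a set \<Rightarrow> 'a set \<Rightarrow> bool" where
  "normalizes X Z \<longleftrightarrow> (\<forall>x\<in>X. \<forall>z\<in>Z. x \<otimes> z \<otimes> inv x \<in> Z)"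

lemma normalizesD: "normalizes X Z \<Longrightarrow> x \<in> X \<Longrightarrow> z \<in> Z \<Longrightarrow> x \<otimes> z \<otimes> inv x \<in> Z"
  by (simp add: normalizes_def)

lemma subgroup_carrier: "subgroup X G \<Longrightarrow> x \<in> X \<Longrightarrow> x \<in> carrier G"
  by (rule subgroup.mem_carrier)

lemma normalizes_inv:
  "subgroup X G \<Longrightarrow> Z \<subseteq> carrier G \<Longrightarrow> normalizes X Z \<Longrightarrow> x \<in> X \<Longrightarrow> z \<in> Z \<Longrightarrow> inv x \<otimes> z \<otimes> x \<in> Z"
  using normalizesD[of X Z "inv x" z] by (simp add: subgroup.m_inv_closed subgroup_carrier)

lemma normal_iff_normalizes:
  assumes "subgroup X G" "subgroup Z G" "Z \<subseteq> X"
  shows "Z \<lhd> (G\<lparr>carrier := X\<rparr>) \<longleftrightarrow> normalizes X Z"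
proof -
  interpret X: group "G\<lparr>carrier := X\<rparr>" by (rule subgroup_imp_group[OF assms(1)])
  show ?thesis
    using assms subgroup_incl[OF assms(2,1,3)] m_inv_consistent[OF assms(1)]
    by (auto simp: X.normal_inv_iff normalizes_def)
qed

lemma normal_iff_normalizes_carrier: "Z \<lhd> G \<longleftrightarrow> subgroup Z G \<and> normalizes (carrier G) Z"
  by (auto simp: normal_inv_iff normalizes_def)

lemma mult_set_memI: "a \<in> A \<Longrightarrow> b \<in> B \<Longrightarrow> a \<otimes> b \<in> A <#> B"
  by (auto simp: set_mult_def)

lemma mult_set_memE: "x \<in> A <#> B \<Longrightarrow> (\<And>a b. x = a \<otimes> b \<Longrightarrow> a \<in> A \<Longrightarrow> b \<in> B \<Longrightarrow> thesis) \<Longrightarrow> thesis"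
  by (auto simp: set_mult_def)

lemma subgroup_permI:
  assumes A: "subgroup A G" and B: "subgroup B G" and AB: "B <#> A \<subseteq> A <#> B"
  shows "subgroup (A <#> B) G"
proof (rule subgroupI)
  note [simp] = subgroup_carrier[OF A] subgroup_carrier[OF B]
  show "A <#> B \<subseteq> carrier G" by (auto simp: set_mult_def)
  show "A <#> B \<noteq> {}" using subgroup.one_closed[OF A] subgroup.one_closed[OF B]
    by (auto simp: set_mult_def)
  fix x assume "x \<in> A <#> B"
  then obtain a b where x: "x = a \<otimes> b" "a \<in> A" "b \<in> B" by (auto simp: set_mult_def)
  then have "inv x = inv b \<otimes> inv a" by (simp add: inv_mult_group)
  then have "inv x \<in> B <#> A"
    using x subgroup.m_inv_closed[OF A] subgroup.m_inv_closed[OF B] by (auto simp: set_mult_def)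
  then show "inv x \<in> A <#> B" using AB by auto
  fix y assume "y \<in> A <#> B"
  then obtain c d where y: "y = c \<otimes> d" "c \<in> A" "d \<in> B" by (auto simp: set_mult_def)
  have "b \<otimes> c \<in> B <#> A" using x y by (auto simp: set_mult_def)
  then have "b \<otimes> c \<in> A <#> B" using AB by blast
  then obtain e f where e: "b \<otimes> c = e \<otimes> f" "e \<in> A" "f \<in> B" by (auto simp: set_mult_def)
  have "x \<otimes> y = a \<otimes> (b \<otimes> c) \<otimes> d" using x y by (simp add: m_assoc)
  also have "\<dots> = (a \<otimes> e) \<otimes> (f \<otimes> d)" unfolding e(1) using x y e by (simp add: m_assoc)
  finally show "x \<otimes> y \<in> A <#> B"
    using mult_set_memI[of "a \<otimes> e" A "f \<otimes> d" B] x y e subgroup.m_closed[OF A]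
      subgroup.m_closed[OF B] by simp
qed

lemma subset_set_mult:
  assumes "subgroup A G" "subgroup B G" shows "A \<subseteq> A <#> B" "B \<subseteq> A <#> B"
  using mult_set_memI[of _ A "\<one>" B] mult_set_memI[of "\<one>" A _ B] assms
  by (auto simp: subgroup.one_closed subgroup_carrier)

lemma set_mult_subset:
  "subgroup L G \<Longrightarrow> A \<subseteq> L \<Longrightarrow> B \<subseteq> L \<Longrightarrow> A <#> B \<subseteq> L"
  by (auto simp: set_mult_def intro!: subgroup.m_closed)

lemma normalizes_permutes:
  assumes "subgroup X G" "subgroup Z G" "normalizes X Z"
  shows "X <#> Z = Z <#> X"
proof
  note [simp] = subgroup_carrier[OF assms(1)] subgroup_carrier[OF assms(2)]
  show "X <#> Z \<subseteq> Z <#> X"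
  proof
    fix y assume "y \<in> X <#> Z"
    then obtain x z where "y = x \<otimes> z" "x \<in> X" "z \<in> Z" by (auto simp: set_mult_def)
    then show "y \<in> Z <#> X"
      using mult_set_memI[of "x \<otimes> z \<otimes> inv x" Z x X] normalizesD[OF assms(3), of x z]
      by (simp add: m_assoc)
  qed
  show "Z <#> X \<subseteq> X <#> Z"
  proof
    fix y assume "y \<in> Z <#> X"
    then obtain x z where "y = z \<otimes> x" "x \<in> X" "z \<in> Z" by (auto simp: set_mult_def)
    then show "y \<in> X <#> Z"
      using mult_set_memI[of x X "inv x \<otimes> z \<otimes> x" Z]
        normalizes_inv[OF assms(1) subgroup.subset[OF assms(2)] assms(3), of x z]
      by (simp add: m_assoc)
  qed
qed

lemma normalizes_subgroup_mult:
  assumes "subgroup X G" "subgroup Z G" "normalizes X Z"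
  shows "subgroup (Z <#> X) G"
  using subgroup_permI[OF assms(2,1)] normalizes_permutes[OF assms] by simp

lemma normalizes_subset: "normalizes X Z \<Longrightarrow> Y \<subseteq> X \<Longrightarrow> normalizes Y Z"
  by (auto simp: normalizes_def)

lemma normalizes_Int: "normalizes X Z \<Longrightarrow> normalizes X Y \<Longrightarrow> normalizes X (Z \<inter> Y)"
  by (auto simp: normalizes_def)

lemma normalizes_self: "subgroup X G \<Longrightarrow> normalizes X X"
  by (auto simp: normalizes_def subgroup.m_closed subgroup.m_inv_closed)

lemma subgroup_pow_closed: "subgroup X G \<Longrightarrow> x \<in> X \<Longrightarrow> x [^] (n::nat) \<in> X"
  by (induction n) (auto simp: subgroup.one_closed subgroup.m_closed)

text \<open>By Bezout, x is a product of powers of x^a and x^b. With \<open>X = {\<one>}\<close>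
  this makes an element with two coprime exponents trivial; with \<open>X\<close> normal it is the
  same fact modulo \<open>X\<close>, without a quotient group.\<close>

lemma pow_coprime_closed:
  assumes X: "subgroup X G" and x: "x \<in> carrier G" and ab: "coprime a b" "a > 0"
    and "x [^] (a::nat) \<in> X" "x [^] (b::nat) \<in> X"
  shows "x \<in> X"
proof -
  obtain u v where uv: "a * u = b * v + 1"
    using bezout_nat[of a b] ab by (auto simp: coprime_iff_gcd_eq_1)
  have "x [^] (a * u) \<in> X" "x [^] (b * v) \<in> X"
    using assms by (auto simp: nat_pow_pow[symmetric] subgroup_pow_closed)
  moreover have "x = inv (x [^] (b * v)) \<otimes> x [^] (a * u)"
    unfolding uv using x by (simp add: nat_pow_mult[symmetric])
  ultimately show ?thesis
    using X by (metis subgroup.m_closed subgroup.m_inv_closed)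
qed

lemma conj_pow:
  assumes "x \<in> carrier G" "y \<in> carrier G"
  shows "(x \<otimes> y \<otimes> inv x) [^] (n::nat) = x \<otimes> y [^] n \<otimes> inv x"
  using assms by (induction n) (simp_all add: m_assoc)

lemma conj_subgroup:
  assumes X: "subgroup X G" and x: "x \<in> carrier G"
  shows "subgroup ((\<lambda>y. x \<otimes> y \<otimes> inv x) ` X) G"
proof (rule subgroupI)
  note [simp] = subgroup_carrier[OF X] x
  show "(\<lambda>y. x \<otimes> y \<otimes> inv x) ` X \<subseteq> carrier G" by auto
  show "(\<lambda>y. x \<otimes> y \<otimes> inv x) ` X \<noteq> {}" using subgroup.one_closed[OF X] by auto
  fix a assume "a \<in> (\<lambda>y. x \<otimes> y \<otimes> inv x) ` X"
  then obtain y where y: "y \<in> X" "a = x \<otimes> y \<otimes> inv x" by auto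
  have "inv a = x \<otimes> inv y \<otimes> inv x" using y by (simp add: group_simps)
  then show "inv a \<in> (\<lambda>y. x \<otimes> y \<otimes> inv x) ` X" using y subgroup.m_inv_closed[OF X] by auto
  fix b assume "b \<in> (\<lambda>y. x \<otimes> y \<otimes> inv x) ` X"
  then obtain z where z: "z \<in> X" "b = x \<otimes> z \<otimes> inv x" by auto
  have "a \<otimes> b = x \<otimes> (y \<otimes> z) \<otimes> inv x" using y z by (simp add: group_simps)
  then show "a \<otimes> b \<in> (\<lambda>y. x \<otimes> y \<otimes> inv x) ` X" using y z subgroup.m_closed[OF X] by auto
qed

lemma conj_card:
  assumes X: "X \<subseteq> carrier G" and x: "x \<in> carrier G"
  shows "card ((\<lambda>y. x \<otimes> y \<otimes> inv x) ` X) = card X"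
proof (rule card_image, rule inj_onI)
  fix y z assume "y \<in> X" "z \<in> X" and eq: "x \<otimes> y \<otimes> inv x = x \<otimes> z \<otimes> inv x"
  then have "y \<in> carrier G" "z \<in> carrier G" using X by auto
  with eq x show "y = z" by simp
qed

end

section \<open>Indices and products of subgroups\<close>

context finite_group begin

lemma subgroup_finite: "subgroup X G \<Longrightarrow> finite X"
  using fin finite_subset subgroup.subset by blast

lemma card_pos: "subgroup X G \<Longrightarrow> card X > 0"
  using subgroup_finite subgroup.one_closed card_gt_0_iff by blast

lemma finite_subgroup_group: "subgroup X G \<Longrightarrow> finite_group (G\<lparr>carrier := X\<rparr>)"
  by (simp add: finite_group_def finite_group_axioms_def subgroup_imp_group subgroup_finite)

lemma card_dvd:
  assumes "subgroup A G" "subgroup B G" "A \<subseteq> B"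
  shows "card A dvd card B"
proof -
  have "card (rcosets\<^bsub>G\<lparr>carrier := B\<rparr>\<^esub> A) * card A = order (G\<lparr>carrier := B\<rparr>)"
    by (rule group.lagrange[OF subgroup_imp_group[OF assms(2)] subgroup_incl[OF assms]])
  then show ?thesis using dvd_triv_right[of "card A" "card (rcosets\<^bsub>G\<lparr>carrier := B\<rparr>\<^esub> A)"]
    by (simp add: order_def)
qed

lemma card_rcosets:
  assumes "subgroup A G" "subgroup B G" "A \<subseteq> B"
  shows "card (rcosets\<^bsub>G\<lparr>carrier := B\<rparr>\<^esub> A) = card B div card A"
proof -
  have "card (rcosets\<^bsub>G\<lparr>carrier := B\<rparr>\<^esub> A) * card A = card B"
    using group.lagrange[OF subgroup_imp_group[OF assms(2)] subgroup_incl[OF assms]]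
    by (simp add: order_def)
  then show ?thesis using card_pos[OF assms(1)]
    nonzero_mult_div_cancel_right[of "card A" "card (rcosets\<^bsub>G\<lparr>carrier := B\<rparr>\<^esub> A)"] by simp
qed

lemma card_rcosets_carrier:
  assumes A: "subgroup A G" shows "card (rcosets A) = card (carrier G) div card A"
proof -
  have "card (rcosets A) * card A = card (carrier G)"
    using lagrange[OF A] by (simp add: order_def)
  then show ?thesis using card_pos[OF A] nonzero_mult_div_cancel_right[of "card A" "card (rcosets A)"]
    by simp
qed

lemma card_mult_div:
  assumes "subgroup A G" "subgroup B G" "A \<subseteq> B"
  shows "card A * (card B div card A) = card B"
  using card_dvd[OF assms] by simp

lemma card_div_pos:
  assumes "subgroup A G" "subgroup B G" "A \<subseteq> B"
  shows "card B div card A > 0"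
  using card_mult_div[OF assms] card_pos[OF assms(2)] by (cases "card B div card A") auto

lemma card_eqD:
  assumes "subgroup A G" "subgroup B G" "A \<subseteq> B" "card B div card A = 1"
  shows "A = B"
  using card_mult_div[OF assms(1-3)] card_subset_eq[OF subgroup_finite[OF assms(2)] assms(3)]
  by (simp add: assms(4))

lemma card_tower:
  assumes "subgroup A G" "subgroup B G" "subgroup C G" "A \<subseteq> B" "B \<subseteq> C"
  shows "card C div card A = (card C div card B) * (card B div card A)"
proof -
  have "card C = card B * (card C div card B)" "card B = card A * (card B div card A)"
    using card_mult_div assms by auto
  then have "card C = card A * (card B div card A) * (card C div card B)" by simp
  then have "card C = card A * ((card C div card B) * (card B div card A))" by (simp only: ac_simps)
  then show ?thesis using card_pos[OF assms(1)]
    nonzero_mult_div_cancel_left[of "card A" "(card C div card B) * (card B div card A)"] by simp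
qed

text \<open>Every fibre of the multiplication map from pairs to AB is parametrized by A \<inter> B:
  the pairs over ab are (ac, c^-1 b).\<close>

lemma card_set_mult:
  assumes A: "subgroup A G" and B: "subgroup B G"
  shows "card (A <#> B) * card (A \<inter> B) = card A * card B"
proof -
  note [simp] = subgroup_carrier[OF A] subgroup_carrier[OF B]
  have finAB: "finite (A \<times> B)" using subgroup_finite A B by auto
  let ?f = "\<lambda>(a, b). a \<otimes> b"
  have im: "A <#> B = ?f ` (A \<times> B)" by (auto simp: set_mult_def)
  have fib: "card {z \<in> A \<times> B. ?f z = y} = card (A \<inter> B)" if "y \<in> A <#> B" for y
  proof -
    obtain a b where ab: "y = a \<otimes> b" "a \<in> A" "b \<in> B" using \<open>y \<in> A <#> B\<close> by (rule mult_set_memE)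
    have "bij_betw (\<lambda>c. (a \<otimes> c, inv c \<otimes> b)) (A \<inter> B) {z \<in> A \<times> B. ?f z = y}"
    proof (rule bij_betwI[where g = "\<lambda>(a', b'). inv a \<otimes> a'"])
      show "(\<lambda>c. (a \<otimes> c, inv c \<otimes> b)) \<in> A \<inter> B \<rightarrow> {z \<in> A \<times> B. ?f z = y}"
        using ab subgroup.m_closed[OF A] subgroup.m_closed[OF B] subgroup.m_inv_closed[OF B]
        by (auto simp: m_assoc)
      show "(\<lambda>(a', b'). inv a \<otimes> a') \<in> {z \<in> A \<times> B. ?f z = y} \<rightarrow> A \<inter> B"
      proof
        fix z assume "z \<in> {z \<in> A \<times> B. ?f z = y}"
        then obtain a' b' where z: "z = (a', b')" "a' \<in> A" "b' \<in> B" "a' \<otimes> b' = a \<otimes> b"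
          using ab by auto
        have "inv a \<otimes> a' = inv a \<otimes> (a' \<otimes> b') \<otimes> inv b'"
          using z(2,3) ab by (simp add: m_assoc)
        also have "\<dots> = b \<otimes> inv b'" unfolding z(4) using z(2,3) ab by (simp add: m_assoc)
        finally have "inv a \<otimes> a' \<in> B"
          using z ab subgroup.m_closed[OF B] subgroup.m_inv_closed[OF B] by simp
        then show "(case z of (a', b') \<Rightarrow> inv a \<otimes> a') \<in> A \<inter> B"
          using z ab subgroup.m_closed[OF A] subgroup.m_inv_closed[OF A] by simp
      qed
      show "(case (a \<otimes> c, inv c \<otimes> b) of (a', b') \<Rightarrow> inv a \<otimes> a') = c" if "c \<in> A \<inter> B" for c
        using that ab by auto
      show "(a \<otimes> (case z of (a', b') \<Rightarrow> inv a \<otimes> a'), inv (case z of (a', b') \<Rightarrow> inv a \<otimes> a') \<otimes> b) = z"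
        if "z \<in> {z \<in> A \<times> B. ?f z = y}" for z
      proof -
        obtain a' b' where z: "z = (a', b')" "a' \<in> A" "b' \<in> B" "a' \<otimes> b' = a \<otimes> b"
          using ab(1) \<open>z \<in> {z \<in> A \<times> B. ?f z = y}\<close> by auto
        have "inv (inv a \<otimes> a') \<otimes> b = inv a' \<otimes> (a \<otimes> b)" using z(2,3) ab by (simp add: group_simps)
        also have "\<dots> = b'" unfolding z(4)[symmetric] using z(2,3) by simp
        finally show ?thesis using z ab by simp
      qed
    qed
    then show ?thesis by (simp add: bij_betw_same_card)
  qed
  have "card A * card B = (\<Sum>z\<in>A \<times> B. 1)" by (simp add: card_cartesian_product)
  also have "\<dots> = (\<Sum>y\<in>?f ` (A \<times> B). \<Sum>z\<in>{z \<in> A \<times> B. ?f z = y}. 1)"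
    by (rule sum.image_gen[OF finAB])
  also have "\<dots> = (\<Sum>y\<in>A <#> B. card (A \<inter> B))"
    unfolding im[symmetric] using fib by (intro sum.cong) auto
  finally show ?thesis by simp
qed

lemma card_set_mult_div:
  assumes "subgroup A G" "subgroup B G" "subgroup (A <#> B) G"
  shows "card (A <#> B) div card A = card B div card (A \<inter> B)"
proof -
  have 1: "subgroup (A \<inter> B) G" using subgroups_Inter_pair assms by blast
  have "card (A <#> B) * card (A \<inter> B) = card A * card B" by (rule card_set_mult[OF assms(1,2)])
  moreover have "card (A <#> B) = card A * (card (A <#> B) div card A)"
    using card_mult_div[OF assms(1,3)] subset_set_mult[OF assms(1,2)] by simp
  moreover have "card B = card (A \<inter> B) * (card B div card (A \<inter> B))"
    using card_mult_div[OF 1 assms(2)] by simp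
  ultimately have "(card A * (card (A <#> B) div card A)) * card (A \<inter> B)
      = card A * (card (A \<inter> B) * (card B div card (A \<inter> B)))"
    by simp
  then have "card A * card (A \<inter> B) * (card (A <#> B) div card A)
      = card A * card (A \<inter> B) * (card B div card (A \<inter> B))"
    by (simp only: ac_simps)
  then show ?thesis using card_pos[OF 1] card_pos[OF assms(1)] by simp
qed

text \<open>From |L:X| |X : X \<inter> Y| = |L:Y| |Y : X \<inter> Y| and coprimality, |L:Y| divides
  |X : X \<inter> Y|, so the set XY has at least |L| elements. Applied in both orders it shows that
  X and Y permute.\<close>

lemma set_mult_coprime_index:
  assumes X: "subgroup X G" and Y: "subgroup Y G" and L: "subgroup L G" and "X \<subseteq> L" "Y \<subseteq> L"
    and cop: "coprime (card L div card X) (card L div card Y)"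
  shows "X <#> Y = L"
proof -
  have XY: "subgroup (X \<inter> Y) G" using subgroups_Inter_pair X Y by blast
  let ?c = "card X div card (X \<inter> Y)" and ?d = "card Y div card (X \<inter> Y)"
  let ?a = "card L div card X" and ?b = "card L div card Y"
  have "?a * ?c = ?b * ?d"
    using card_tower[OF XY X L] card_tower[OF XY Y L] assms by simp
  then have "?b dvd ?a * ?c" by simp
  then have "?b dvd ?c" using cop by (simp add: coprime_commute coprime_dvd_mult_right_iff)
  then have bc: "?b \<le> ?c" using card_div_pos[OF XY X] by (simp add: dvd_imp_le)
  have "card (X <#> Y) * card (X \<inter> Y) = ?c * card Y * card (X \<inter> Y)"
    using card_set_mult[OF X Y] card_mult_div[OF XY X] by (simp add: ac_simps)
  then have "card (X <#> Y) = ?c * card Y" using card_pos[OF XY] by simp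
  moreover have "card L = ?b * card Y" using card_mult_div[OF Y L] assms by (simp add: mult.commute)
  ultimately have "card L \<le> card (X <#> Y)" using bc by (metis mult_le_mono1)
  then show ?thesis
    by (rule card_seteq[OF subgroup_finite[OF L] set_mult_subset[OF L \<open>X \<subseteq> L\<close> \<open>Y \<subseteq> L\<close>]])
qed

section \<open>Sylow subgroups, Cauchy's theorem and tests by elements of prime power order\<close>

lemma sylow_exists:
  assumes "subgroup X G" "prime p"
  obtains P k where "subgroup P G" "P \<subseteq> X" "card P = p ^ k" "\<not> p dvd card X div card P"
proof -
  interpret X: finite_group "G\<lparr>carrier := X\<rparr>" by (rule finite_subgroup_group[OF assms(1)])
  have "card X \<noteq> 0" "\<not> is_unit p" using card_pos[OF assms(1)] assms(2) by auto
  from multiplicity_decompose'[OF this]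
  obtain m where m: "card X = p ^ multiplicity p (card X) * m" "\<not> p dvd m" by blast
  obtain P where P: "subgroup P (G\<lparr>carrier := X\<rparr>)" "card P = p ^ multiplicity p (card X)"
    using sylow_thm[OF assms(2) X.is_group, of "multiplicity p (card X)" m] m(1) X.fin
    by (simp add: order_def) blast
  have "P \<subseteq> X" using P(1) subgroup.subset by fastforce
  moreover have "subgroup P G" using P(1) assms(1) incl_subgroup by blast
  moreover have "\<not> p dvd card X div card P"
  proof -
    have "card X div card P = m" unfolding P(2) using m(1) assms(2)
      by (metis nonzero_mult_div_cancel_left not_prime_0 power_not_zero)
    then show ?thesis using m(2) by simp
  qed
  ultimately show ?thesis using that P(2) by blast
qed

lemma cauchy:
  assumes "subgroup X G" "prime p" "p dvd card X"
  obtains x where "x \<in> X" "ord x = p"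
proof -
  interpret X: finite_group "G\<lparr>carrier := X\<rparr>" by (rule finite_subgroup_group[OF assms(1)])
  obtain m where "card X = p ^ 1 * m" using assms(3) by auto
  then obtain P where P: "subgroup P (G\<lparr>carrier := X\<rparr>)" "card P = p"
    using sylow_thm[OF assms(2) X.is_group, of 1 m] X.fin by (simp add: order_def) blast
  have PX: "P \<subseteq> X" using P(1) subgroup.subset by fastforce
  have PG: "subgroup P G" using P(1) assms(1) incl_subgroup by blast
  have "card P > 1" using P(2) assms(2) prime_gt_1_nat by blast
  then have "\<not> P \<subseteq> {\<one>}" using card_mono[of "{\<one>}" P] by auto
  then obtain x where x: "x \<in> P" "x \<noteq> \<one>" by blast
  have xG: "x \<in> carrier G" using x PG subgroup_carrier by blast
  have "ord x dvd p"
  proof -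
    have "card (generate G {x}) dvd card P"
      using x PG xG generate_subgroup_incl[of "{x}" P] by (intro card_dvd generate_is_subgroup) auto
    then show ?thesis using generate_pow_card[OF xG] P(2) by simp
  qed
  then have "ord x = p" using assms(2) x(2) xG ord_eq_1 prime_nat_iff by auto
  then show ?thesis using that x PX by blast
qed

lemma ord_dvd_card: "subgroup X G \<Longrightarrow> x \<in> X \<Longrightarrow> ord x dvd card X"
proof -
  assume X: "subgroup X G" "x \<in> X"
  have "card (generate G {x}) dvd card X"
    using X subgroup_carrier[OF X] generate_subgroup_incl[of "{x}" X] by (intro card_dvd generate_is_subgroup) auto
  then show ?thesis using generate_pow_card X subgroup_carrier by metis
qed

lemma pow_card: "subgroup X G \<Longrightarrow> x \<in> X \<Longrightarrow> x [^] card X = \<one>"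
  using ord_dvd_card subgroup_carrier pow_eq_id by metis

lemma pi_number_card_elementI:
  assumes X: "subgroup X G" and "\<And>x p. x \<in> X \<Longrightarrow> prime p \<Longrightarrow> ord x = p \<Longrightarrow> p \<in> s"
  shows "pi_number s (card X)"
  using cauchy[OF X] assms card_pos[OF X] by (metis pi_numberI)

text \<open>The test elements are those of prime power order, because a Sylow subgroup consists of such.\<close>

lemma not_dvd_indexI:
  assumes X: "subgroup X G" and Y: "subgroup Y G" "Y \<subseteq> X" and p: "prime p"
    and el: "\<And>x k. x \<in> X \<Longrightarrow> x [^] (p ^ k :: nat) = \<one> \<Longrightarrow> x \<in> Y"
  shows "\<not> p dvd card X div card Y"
proof
  assume dvd: "p dvd card X div card Y"
  obtain P k where P: "subgroup P G" "P \<subseteq> X" "card P = p ^ k" "\<not> p dvd card X div card P"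
    using sylow_exists[OF X p] .
  have "x \<in> Y" if "x \<in> P" for x using pow_card[OF P(1) that] el[of x k] P that by auto
  then have "P \<subseteq> Y" by auto
  then have "card X div card P = (card X div card Y) * (card Y div card P)"
    using card_tower[OF P(1) Y(1) X] Y by auto
  with dvd P(4) show False by simp
qed

lemma pi_number_indexI:
  assumes "subgroup X G" "subgroup Y G" "Y \<subseteq> X"
    and "\<And>x p k. prime p \<Longrightarrow> p \<notin> s \<Longrightarrow> x \<in> X \<Longrightarrow> x [^] (p ^ k :: nat) = \<one> \<Longrightarrow> x \<in> Y"
  shows "pi_number s (card X div card Y)"
  using not_dvd_indexI[OF assms(1-3)] assms(4) card_div_pos[OF assms(2,1,3)]
  by (metis pi_numberI)

lemma pow_index_mem:
  assumes X: "subgroup X G" and Z: "subgroup Z G" "Z \<subseteq> X" "normalizes X Z" and x: "x \<in> X"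
  shows "x [^] (card X div card Z) \<in> Z"
proof -
  interpret N: normal Z "G\<lparr>carrier := X\<rparr>"
    using normal_iff_normalizes[OF X Z(1,2)] Z(3) by simp
  interpret Q: group "G\<lparr>carrier := X\<rparr> Mod Z" by (rule N.factorgroup_is_group)
  have c: "order (G\<lparr>carrier := X\<rparr> Mod Z) = card X div card Z"
    using card_rcosets[OF Z(1) X Z(2)] by (simp add: order_def FactGroup_def)
  have xc: "Z #>\<^bsub>G\<lparr>carrier := X\<rparr>\<^esub> x \<in> carrier (G\<lparr>carrier := X\<rparr> Mod Z)"
    using x by (auto simp: carrier_FactGroup)
  have "(Z #>\<^bsub>G\<lparr>carrier := X\<rparr>\<^esub> x) [^]\<^bsub>G\<lparr>carrier := X\<rparr> Mod Z\<^esub> (card X div card Z) = Z"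
    using Q.pow_order_eq_1[OF xc] c by simp
  then have "Z #>\<^bsub>G\<lparr>carrier := X\<rparr>\<^esub> (x [^]\<^bsub>G\<lparr>carrier := X\<rparr>\<^esub> (card X div card Z)) = Z"
    using N.FactGroup_pow[of x] x by simp
  then have "Z #> (x [^] (card X div card Z)) = Z"
    by (simp add: nat_pow_consistent[symmetric])
  moreover have "x [^] (card X div card Z) \<in> carrier G" using x X subgroup_carrier by blast
  ultimately show ?thesis using rcos_self[OF _ Z(1)] by metis
qed

lemma cyclic_commute:
  assumes z: "z \<in> carrier G" and "x \<in> generate G {z}" "y \<in> generate G {z}" shows "x \<otimes> y = y \<otimes> x"
proof -
  obtain i j :: nat where ij: "x = z [^] i" "y = z [^] j"
    using assms(2,3) generate_pow_on_finite_carrier[OF fin z] by auto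
  show ?thesis unfolding ij using z by (simp add: nat_pow_mult add.commute)
qed

lemma generate_eqI:
  assumes X: "subgroup X G" and x: "x \<in> X" "ord x = card X"
  shows "generate G {x} = X"
proof (rule card_subset_eq[OF subgroup_finite[OF X]])
  show "generate G {x} \<subseteq> X" using x(1) by (intro generate_subgroup_incl[OF _ X]) simp
  show "card (generate G {x}) = card X" using generate_pow_card[OF subgroup_carrier[OF X x(1)]] x(2) by simp
qed

lemma generate_prime_card:
  assumes X: "subgroup X G" "prime (card X)" and x: "x \<in> X" "x \<noteq> \<one>"
  shows "generate G {x} = X"
proof (rule generate_eqI[OF X(1) x(1)])
  have "ord x \<noteq> 1" using x subgroup_carrier[OF X(1) x(1)] ord_eq_1 by simp
  then show "ord x = card X" using ord_dvd_card[OF X(1) x(1)] X(2) by (auto simp: prime_nat_iff)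
qed

end

section \<open>Complements, fixed points and transfer\<close>

lemma (in comm_group) finprod_hom:
  assumes "\<And>x. x \<in> carrier G \<Longrightarrow> h x \<in> carrier G"
    and "\<And>x y. x \<in> carrier G \<Longrightarrow> y \<in> carrier G \<Longrightarrow> h (x \<otimes> y) = h x \<otimes> h y" and "h \<one> = \<one>"
    and "finite A" "f \<in> A \<rightarrow> carrier G"
  shows "h (finprod G f A) = finprod G (\<lambda>x. h (f x)) A"
  using assms(4,5)
proof (induction A rule: finite_induct)
  case (insert a A)
  then have "finprod G f (insert a A) = f a \<otimes> finprod G f A" by (intro finprod_insert) auto
  moreover have "finprod G (\<lambda>x. h (f x)) (insert a A) = h (f a) \<otimes> finprod G (\<lambda>x. h (f x)) A"
    using insert assms(1) by (intro finprod_insert) auto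
  moreover have "finprod G f A \<in> carrier G" "f a \<in> carrier G" using insert by auto
  ultimately show ?case using insert assms(2) by auto
qed (simp add: assms(3))

context finite_group begin

lemma subgroup_comm_group:
  assumes "subgroup N G" "\<And>x y. x \<in> N \<Longrightarrow> y \<in> N \<Longrightarrow> x \<otimes> y = y \<otimes> x"
  shows "comm_group (G\<lparr>carrier := N\<rparr>)"
  using group.group_comm_groupI[OF subgroup_imp_group[OF assms(1)]] assms(2) by simp

lemma finite_rcosets: "finite (rcosets P)"
  using fin by (simp add: RCOSETS_def)

text \<open>
  For a section \<open>t\<close> of \<open>G \<rightarrow> G/N\<close>, the product of \<open>g t(X) t(gX)\<inverse>\<close> over all cosets \<open>X\<close> is a
  crossed homomorphism \<open>G \<rightarrow> N\<close> whose restriction to \<open>N\<close> is the power map with exponent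
  \<open>|G : N|\<close>; its kernel is a complement of \<open>N\<close>.
\<close>

lemma schur_zassenhaus_abelian:
  assumes N: "N \<lhd> G" and comm: "\<And>x y. x \<in> N \<Longrightarrow> y \<in> N \<Longrightarrow> x \<otimes> y = y \<otimes> x"
    and cop: "coprime (card N) (card (carrier G) div card N)"
  obtains K where "subgroup K G" "K \<inter> N = {\<one>}" "N <#> K = carrier G"
proof -
  interpret N: normal N G by (rule N)
  have NG: "subgroup N G" by (rule N.is_subgroup)
  interpret NN: comm_group "G\<lparr>carrier := N\<rparr>" by (rule subgroup_comm_group[OF NG comm])
  let ?N = "G\<lparr>carrier := N\<rparr>"
  let ?E = "rcosets N"
  let ?m = "card ?E"
  have m: "?m = card (carrier G) div card N" by (rule card_rcosets_carrier[OF NG])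
  define t where "t X = (SOME y. y \<in> X)" for X :: "'a set"
  have t: "t X \<in> X" if "X \<in> ?E" for X
    unfolding t_def using N.rcosets_non_empty[OF that] by (simp add: some_in_eq)
  have EG: "X \<subseteq> carrier G" if "X \<in> ?E" for X
    using that N.rcosets_carrier by blast
  \<comment> \<open>The group acts by left translation on right cosets, which is possible because
    left and right cosets of the normal subgroup coincide; this makes the cocycle identity
    \<open>ncoc\<close> come out with conjugation by \<open>g\<close>.\<close>
  have act: "g <# X \<in> ?E" if g: "g \<in> carrier G" and X: "X \<in> ?E" for g X
  proof -
    obtain x where x: "x \<in> carrier G" "X = N #> x" using X by (auto simp: RCOSETS_def)
    have "g <# (N #> x) = (g <# N) #> x" using g x N.subset by (simp add: rcos_assoc_lcos lcos_m_assoc r_coset_eq_set_mult l_coset_eq_set_mult set_mult_assoc)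
    also have "\<dots> = (N #> g) #> x" using N.coset_eq g by simp
    also have "\<dots> = N #> (g \<otimes> x)" using g x N.subset by (simp add: coset_mult_assoc)
    finally show ?thesis using x g by (auto simp: RCOSETS_def)
  qed
  have tG [simp]: "t X \<in> carrier G" if "X \<in> ?E" for X using t EG that by blast
  define n where "n g X = g \<otimes> t X \<otimes> inv (t (g <# X))" for g X
  have nN: "n g X \<in> N" if "g \<in> carrier G" "X \<in> ?E" for g X
  proof -
    have "g \<otimes> t X \<in> g <# X" using t that by (auto simp: l_coset_def)
    then show ?thesis unfolding n_def
      using diff_neutralizes[OF NG act[OF that]] t[OF act[OF that]] by blast
  qed
  have actm: "(g \<otimes> h) <# X = g <# (h <# X)" if "g \<in> carrier G" "h \<in> carrier G" "X \<in> ?E" for g h X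
    using lcos_m_assoc[OF EG[OF that(3)] that(1,2)] by simp
  have ncoc: "n (g \<otimes> h) X = (g \<otimes> n h X \<otimes> inv g) \<otimes> n g (h <# X)"
    if "g \<in> carrier G" "h \<in> carrier G" "X \<in> ?E" for g h X
    unfolding n_def using that act[OF that(2,3)] act[OF that(1) act[OF that(2,3)]]
    by (simp add: actm group_simps)
  define \<phi> where "\<phi> g = finprod ?N (n g) ?E" for g
  have pi: "n g \<in> ?E \<rightarrow> carrier ?N" if "g \<in> carrier G" for g using nN that by auto
  have \<phi>N: "\<phi> g \<in> N" if "g \<in> carrier G" for g
    unfolding \<phi>_def using NN.finprod_closed[OF pi[OF that]] by simp
  have crossed: "\<phi> (g \<otimes> h) = (g \<otimes> \<phi> h \<otimes> inv g) \<otimes> \<phi> g" if g: "g \<in> carrier G" and h: "h \<in> carrier G" for g h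
  proof -
    have im: "(\<lambda>X. h <# X) ` ?E = ?E"
    proof
      show "(\<lambda>X. h <# X) ` ?E \<subseteq> ?E" using act h by auto
      show "?E \<subseteq> (\<lambda>X. h <# X) ` ?E"
      proof
        fix X assume X: "X \<in> ?E"
        have "X = h <# (inv h <# X)" using actm[of h "inv h" X] h X EG[OF X] by (simp add: lcos_mult_one)
        then show "X \<in> (\<lambda>X. h <# X) ` ?E" using act[of "inv h" X] h X by auto
      qed
    qed
    have inj: "inj_on (\<lambda>X. h <# X) ?E"
      by (rule eq_card_imp_inj_on[OF finite_rcosets]) (simp add: im)
    have conjc: "g \<otimes> z \<otimes> inv g \<in> N" if "z \<in> N" for z using that g N.inv_op_closed2 by simp
    have "\<phi> (g \<otimes> h) = finprod ?N (\<lambda>X. (g \<otimes> n h X \<otimes> inv g) \<otimes>\<^bsub>?N\<^esub> n g (h <# X)) ?E"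
      unfolding \<phi>_def using g h nN act conjc by (intro NN.finprod_cong') (auto simp: ncoc N.m_closed)
    also have "\<dots> = finprod ?N (\<lambda>X. g \<otimes> n h X \<otimes> inv g) ?E \<otimes>\<^bsub>?N\<^esub> finprod ?N (\<lambda>X. n g (h <# X)) ?E"
      using g h nN act conjc by (intro NN.finprod_multf) auto
    also have "finprod ?N (\<lambda>X. n g (h <# X)) ?E = finprod ?N (n g) ((\<lambda>X. h <# X) ` ?E)"
      using g h nN act inj by (intro NN.finprod_reindex[symmetric]) auto
    also have "\<dots> = \<phi> g" unfolding im \<phi>_def by simp
    also have "finprod ?N (\<lambda>X. g \<otimes> n h X \<otimes> inv g) ?E = g \<otimes> \<phi> h \<otimes> inv g" unfolding \<phi>_def
      using conjc g pi[OF h]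
      by (intro NN.finprod_hom[symmetric, where h = "\<lambda>z. g \<otimes> z \<otimes> inv g"] finite_rcosets)
        (auto simp: group_simps)
    finally show ?thesis by simp
  qed
  have \<phi>_N: "\<phi> z = z [^] ?m" if z: "z \<in> N" for z
  proof -
    have zG: "z \<in> carrier G" using z N.subset by auto
    have "n z X = z" if X: "X \<in> ?E" for X
    proof -
      obtain x where x: "x \<in> carrier G" "X = N #> x" using X by (auto simp: RCOSETS_def)
      have "z <# X = (z <# N) #> x" unfolding x(2) using zG x N.subset
        by (simp add: r_coset_eq_set_mult l_coset_eq_set_mult set_mult_assoc)
      also have "z <# N = N" using N.coset_eq zG coset_join2[OF zG NG z] by simp
      finally have "z <# X = X" using x by simp
      then show ?thesis unfolding n_def using X zG by (simp add: m_assoc)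
    qed
    then have "\<phi> z = finprod ?N (\<lambda>_. z) ?E" unfolding \<phi>_def using z by (intro NN.finprod_cong') auto
    also have "\<dots> = z [^]\<^bsub>?N\<^esub> ?m" using z by (intro NN.finprod_const) simp
    finally show ?thesis by (simp add: nat_pow_consistent[symmetric])
  qed
  define K where "K = {g \<in> carrier G. \<phi> g = \<one>}"
  have \<phi>1: "\<phi> \<one> = \<one>" using \<phi>_N[of \<one>] NG by (simp add: subgroup.one_closed)
  have K: "subgroup K G"
  proof (rule subgroupI)
    show "K \<subseteq> carrier G" "K \<noteq> {}" using \<phi>1 by (auto simp: K_def)
    fix g assume g: "g \<in> K"
    then have gG: "g \<in> carrier G" "\<phi> g = \<one>" by (auto simp: K_def)
    have c1: "\<one> = g \<otimes> \<phi> (inv g) \<otimes> inv g" using crossed[of g "inv g"] gG \<phi>1 \<phi>N[of "inv g"] N.subset by auto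
    have "\<phi> (inv g) \<in> carrier G" using gG \<phi>N[of "inv g"] N.subset by auto
    then have "\<phi> (inv g) = inv g \<otimes> (g \<otimes> \<phi> (inv g) \<otimes> inv g) \<otimes> g" using gG by (simp add: m_assoc)
    then have "\<phi> (inv g) = \<one>" unfolding c1[symmetric] using gG by simp
    then show "inv g \<in> K" using gG by (simp add: K_def)
    fix h assume "h \<in> K"
    then have "h \<in> carrier G" "\<phi> h = \<one>" by (auto simp: K_def)
    then show "g \<otimes> h \<in> K" using crossed[of g h] gG by (simp add: K_def)
  qed
  have copm: "coprime (card N) ?m" using cop m by simp
  have "K \<inter> N = {\<one>}"
  proof -
    have "z = \<one>" if "z \<in> K" "z \<in> N" for z
    proof -
      have "z [^] ?m = \<one>" using \<phi>_N that by (auto simp: K_def)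
      then show ?thesis
        using pow_coprime_closed[OF triv_subgroup, of z "card N" ?m] copm card_pos[OF NG]
          pow_card[OF NG] that by (auto simp: K_def)
    qed
    then show ?thesis using subgroup.one_closed[OF K] subgroup.one_closed[OF NG] by blast
  qed
  moreover have "N <#> K = carrier G"
  proof
    show "N <#> K \<subseteq> carrier G" by (rule set_mult_subset[OF subgroup_self N.subset subgroup.subset[OF K]])
    show "carrier G \<subseteq> N <#> K"
    proof
      fix g assume g: "g \<in> carrier G"
      \<comment> \<open>\<open>u\<close> inverts the index modulo |N|, so that \<open>?z\<close>
        satisfies \<open>\<phi> ?z = inv (\<phi> g)\<close> and \<open>?z \<otimes> g\<close> falls
        into the kernel \<open>K\<close>.\<close>
      obtain u v where uv: "?m * u = card N * v + 1"
        using bezout_nat[of ?m "card N"] copm m card_div_pos[OF NG subgroup_self] N.subset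
        by (auto simp: coprime_iff_gcd_eq_1 gcd.commute)
      let ?z = "inv (\<phi> g) [^] u"
      have zN: "?z \<in> N" using \<phi>N[OF g] NG by (simp add: subgroup.m_inv_closed subgroup_pow_closed)
      have igN: "inv (\<phi> g) \<in> N" using \<phi>N[OF g] NG by (simp add: subgroup.m_inv_closed)
      have igG: "inv (\<phi> g) \<in> carrier G" using igN N.subset by auto
      have "?z [^] ?m = inv (\<phi> g) [^] (card N * v + 1)"
        using igG uv by (simp add: nat_pow_pow mult.commute)
      also have "\<dots> = (inv (\<phi> g) [^] card N) [^] v \<otimes> inv (\<phi> g)"
        using igG by (simp add: nat_pow_pow nat_pow_mult[symmetric])
      also have "\<dots> = inv (\<phi> g)" using pow_card[OF NG igN] igG by simp
      finally have "\<phi> ?z = inv (\<phi> g)" using \<phi>_N[OF zN] by simp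
      moreover have "?z \<in> carrier G" using igG by simp
      moreover have "?z \<otimes> \<phi> g \<otimes> inv ?z = \<phi> g"
        using comm[OF zN \<phi>N[OF g]] \<open>?z \<in> carrier G\<close> \<phi>N[OF g] N.subset by (auto simp: m_assoc)
      ultimately have "\<phi> (?z \<otimes> g) = \<one>"
        using crossed[of ?z g] g \<phi>N[OF g] N.subset by auto
      then have "?z \<otimes> g \<in> K" using g \<open>?z \<in> carrier G\<close> by (simp add: K_def)
      moreover have "g = inv ?z \<otimes> (?z \<otimes> g)" using g \<open>?z \<in> carrier G\<close> by simp
      ultimately show "g \<in> N <#> K"
        using mult_set_memI[of "inv ?z" N "?z \<otimes> g" K] zN NG by (simp add: subgroup.m_inv_closed)
    qed
  qed
  ultimately show ?thesis using that K by blast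
qed

lemma schur_zassenhaus_abelian_subgroup:
  assumes X: "subgroup X G" and N: "subgroup N G" "N \<subseteq> X" "normalizes X N"
    and comm: "\<And>x y. x \<in> N \<Longrightarrow> y \<in> N \<Longrightarrow> x \<otimes> y = y \<otimes> x"
    and cop: "coprime (card N) (card X div card N)"
  obtains K where "subgroup K G" "K \<subseteq> X" "K \<inter> N = {\<one>}" "N <#> K = X"
proof -
  interpret X: finite_group "G\<lparr>carrier := X\<rparr>" by (rule finite_subgroup_group[OF X])
  have "N \<lhd> G\<lparr>carrier := X\<rparr>" using normal_iff_normalizes[OF X N(1,2)] N(3) by simp
  then obtain K where K: "subgroup K (G\<lparr>carrier := X\<rparr>)" "K \<inter> N = {\<one>}" "N <#> K = X"
    by (rule X.schur_zassenhaus_abelian) (use comm cop in auto)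
  show ?thesis
    using that[of K] K incl_subgroup[OF X K(1)] subgroup.subset[OF K(1)] by simp
qed

text \<open>A central Hall subgroup has a complement by the abelian case, and X is the direct
  product of N and K. If x = zy with z in N and x^k = 1, then z is killed by k|K|, which is coprime
  to |N|; so every element with an s'-exponent lies in K. Thus K is determined by the orders of
  elements, which makes it invariant under conjugation by X.\<close>

lemma central_hall_split:
  assumes X: "subgroup X G" and N: "subgroup N G" "N \<subseteq> X"
    and central: "\<And>x z. x \<in> X \<Longrightarrow> z \<in> N \<Longrightarrow> x \<otimes> z = z \<otimes> x"
    and s: "pi_number s (card N)" "pi_number (- s) (card X div card N)"
  obtains K where "subgroup K G" "K \<subseteq> X" "pi_number (- s) (card K)" "K \<inter> N = {\<one>}" "N <#> K = X"
    "\<And>x k. x \<in> X \<Longrightarrow> pi_number (- s) k \<Longrightarrow> x [^] k = \<one> \<Longrightarrow> x \<in> K"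
    "normalizes X K"
proof -
  have nrm: "normalizes X N"
    unfolding normalizes_def
  proof (intro ballI)
    fix x z assume "x \<in> X" "z \<in> N"
    then show "x \<otimes> z \<otimes> inv x \<in> N"
      using central[of x z] subgroup_carrier[OF X] subgroup_carrier[OF N(1)] by (simp add: m_assoc)
  qed
  obtain K where K: "subgroup K G" "K \<subseteq> X" "K \<inter> N = {\<one>}" "N <#> K = X"
    by (rule schur_zassenhaus_abelian_subgroup[OF X N nrm])
      (use central N(2) pi_number_coprime_compl[OF s] in auto)
  have cK: "card K = card X div card N"
  proof -
    have "card X = card N * card K" using card_set_mult[OF N(1) K(1)] K(3,4) by (simp add: Int_commute)
    then show ?thesis using card_pos[OF N(1)] by simp
  qed
  have sK: "pi_number (- s) (card K)" using cK s by simp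
  have tor: "x \<in> K" if x: "x \<in> X" and k: "pi_number (- s) k" "x [^] k = \<one>" for x k
  proof -
    obtain z y where zy: "x = z \<otimes> y" "z \<in> N" "y \<in> K" using x K(4) by (auto elim: mult_set_memE)
    have zG: "z \<in> carrier G" "y \<in> carrier G" using zy N(1) K(1) subgroup_carrier by auto
    have c: "z \<otimes> y = y \<otimes> z" using central[of y z] zy K(2) by auto
    have "x [^] (k * card K) = z [^] (k * card K) \<otimes> y [^] (k * card K)"
      unfolding zy(1) by (rule pow_mult_distrib[OF c zG])
    moreover have "y [^] (k * card K) = \<one>"
      using pow_card[OF K(1) zy(3)] zG nat_pow_pow[of y "card K" k] by (simp add: mult.commute)
    moreover have "x [^] (k * card K) = \<one>"
      using k zy zG by (simp add: nat_pow_pow[symmetric])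
    ultimately have "z [^] (k * card K) = \<one>" using zG by simp
    moreover have "coprime (card N) (k * card K)"
      using pi_number_coprime_compl[OF s(1)] k(1) sK by simp
    ultimately have "z = \<one>"
      using pow_coprime_closed[OF triv_subgroup zG(1), of "card N" "k * card K"] card_pos[OF N(1)]
        pow_card[OF N(1) zy(2)] by simp
    then show ?thesis using zy zG by simp
  qed
  have "normalizes X K" unfolding normalizes_def
  proof (intro ballI)
    fix x y assume xy: "x \<in> X" "y \<in> K"
    then have G: "x \<in> carrier G" "y \<in> carrier G" using subgroup_carrier X K by auto
    have "(x \<otimes> y \<otimes> inv x) [^] card K = \<one>" using pow_card[OF K(1) xy(2)] G by (simp add: conj_pow)
    moreover have "x \<otimes> y \<otimes> inv x \<in> X"
      using xy K(2) X by (auto simp: subgroup.m_closed subgroup.m_inv_closed)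
    ultimately show "x \<otimes> y \<otimes> inv x \<in> K" using tor sK by blast
  qed
  then show ?thesis using that K sK tor by blast
qed

text \<open>P permutes the |G:H| cosets of H; as p does not divide this number, some orbit has
  length one, and a fixed coset Hx means that x P x^-1 lies in H. It is applied both to Sylow and to
  Hall subgroups H.\<close>

lemma p_subgroup_conj_into:
  assumes P: "subgroup P G" "card P = p ^ k" and p: "prime p"
    and H: "subgroup H G" and idx: "\<not> p dvd card (carrier G) div card H"
  obtains x where "x \<in> carrier G" "\<And>u. u \<in> P \<Longrightarrow> x \<otimes> u \<otimes> inv x \<in> H"
proof -
  interpret H: subgroup H G by (rule H)
  let ?E = "rcosets H" and ?P = "G\<lparr>carrier := P\<rparr>"
  note [simp] = subgroup_carrier[OF P(1)]
  \<comment> \<open>Translation by the inverse turns right multiplication into a left action; the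
    restriction to \<open>?E\<close> is required since members of \<open>BijGroup\<close> are
    extensional.\<close>
  define \<phi> where "\<phi> g = (\<lambda>X\<in>?E. X #> inv g)" for g
  have EG: "X \<subseteq> carrier G" if "X \<in> ?E" for X using that H.rcosets_carrier by blast
  have act: "X #> g \<in> ?E" if g: "g \<in> carrier G" and X: "X \<in> ?E" for g X
  proof -
    obtain x where x: "x \<in> carrier G" "X = H #> x" using X by (auto simp: RCOSETS_def)
    have "X #> g = H #> (x \<otimes> g)" using g x H.subset by (simp add: coset_mult_assoc)
    then show ?thesis using g x(1) by (auto simp: RCOSETS_def)
  qed
  have bij: "\<phi> g \<in> Bij ?E" if g: "g \<in> carrier G" for g
  proof -
    have "bij_betw (\<phi> g) ?E ?E"
      by (rule bij_betwI[where g = "\<lambda>X. X #> g"]) (use g act EG in \<open>auto simp: \<phi>_def coset_mult_assoc\<close>)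
    then show ?thesis by (simp add: Bij_def \<phi>_def)
  qed
  have "group_action ?P ?E \<phi>"
    unfolding group_action_def group_hom_def group_hom_axioms_def
  proof (intro conjI subgroup_imp_group[OF P(1)] group_BijGroup homI)
    show "\<phi> x \<in> carrier (BijGroup ?E)" if "x \<in> carrier ?P" for x
      using bij that by (simp add: BijGroup_def)
    show "\<phi> (x \<otimes>\<^bsub>?P\<^esub> y) = \<phi> x \<otimes>\<^bsub>BijGroup ?E\<^esub> \<phi> y" if "x \<in> carrier ?P" "y \<in> carrier ?P" for x y
    proof
      fix X
      have "x \<in> carrier G" "y \<in> carrier G" using that by auto
      then show "\<phi> (x \<otimes>\<^bsub>?P\<^esub> y) X = (\<phi> x \<otimes>\<^bsub>BijGroup ?E\<^esub> \<phi> y) X"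
        using bij[of x] bij[of y] act EG
        by (auto simp: BijGroup_def \<phi>_def compose_def coset_mult_assoc inv_mult_group)
    qed
  qed
  then interpret A: group_action ?P ?E \<phi> .
  have "\<exists>X\<in>?E. card (orbit ?P \<phi> X) = 1"
  proof (rule ccontr)
    assume no: "\<not> ?thesis"
    have "p dvd card O'" if "O' \<in> orbits ?P ?E \<phi>" for O'
    proof -
      obtain X where X: "X \<in> ?E" "O' = orbit ?P \<phi> X" using \<open>O' \<in> _\<close> by (auto simp: orbits_def)
      have "card O' * card (stabilizer ?P \<phi> X) = p ^ k"
        using A.orbit_stabilizer_theorem[OF X(1)] X(2) P(2) by (simp add: order_def)
      then have "card O' dvd p ^ k" by (metis dvd_triv_left)
      then obtain i where "card O' = p ^ i" using divides_primepow_nat[OF p] by blast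
      moreover have "card O' \<noteq> 1" using no X by auto
      ultimately show ?thesis by (cases i) auto
    qed
    then have "p dvd (\<Sum>O'\<in>orbits ?P ?E \<phi>. card O')" by (rule dvd_sum)
    moreover have "(\<Sum>O'\<in>orbits ?P ?E \<phi>. card O') = card ?E"
      using A.disjoint_sum[OF finite_rcosets, of "\<lambda>_. 1::nat"] by simp
    ultimately show False using idx card_rcosets_carrier[OF H] by simp
  qed
  then obtain X where X: "X \<in> ?E" "card (orbit ?P \<phi> X) = 1" by blast
  obtain x where x: "x \<in> carrier G" "X = H #> x" using X(1) by (auto simp: RCOSETS_def)
  have "x \<otimes> u \<otimes> inv x \<in> H" if u: "u \<in> P" for u
  proof -
    obtain Z where "orbit ?P \<phi> X = {Z}" using X(2) by (auto simp: card_1_singleton_iff)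
    moreover have "\<phi> (inv u) X \<in> orbit ?P \<phi> X" "\<phi> \<one> X \<in> orbit ?P \<phi> X"
      using u P(1) by (auto simp: orbit_def subgroup.m_inv_closed subgroup.one_closed)
    ultimately have "\<phi> (inv u) X = \<phi> \<one> X" by auto
    then have "X #> u = X" using X(1) u EG[OF X(1)] by (simp add: \<phi>_def)
    then have "H #> (x \<otimes> u) = H #> x" using x u H.subset by (simp add: coset_mult_assoc)
    then have "x \<otimes> u \<in> H #> x" using rcos_self[of "x \<otimes> u" H] x u H by simp
    then obtain h where h: "h \<in> H" "x \<otimes> u = h \<otimes> x" by (auto simp: r_coset_def)
    then have "x \<otimes> u \<otimes> inv x = h" using x h(1) by (simp add: m_assoc)
    then show ?thesis using h(1) by simp
  qed
  then show ?thesis using that x by blast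
qed

end

section \<open>Transfer into a subgroup of prime order\<close>

context finite_group begin

text \<open>
  The transfer into a subgroup \<open>P\<close> of prime order that is central in its normalizer. On the cosets
  not fixed by \<open>P\<close> the section can be chosen \<open>P\<close>-equivariant, so that only the fixed cosets
  contribute to the transfer of an element of \<open>P\<close>.
\<close>

lemma burnside_transfer:
  assumes P: "subgroup P G" "card P = p" and p: "prime p" "\<not> p dvd card (carrier G) div p"
    and NC: "\<And>x u. x \<in> carrier G \<Longrightarrow> normalizes {x} P \<Longrightarrow> u \<in> P \<Longrightarrow> x \<otimes> u = u \<otimes> x"
  obtains K where "K \<lhd> G" "K \<inter> P = {\<one>}" "card (carrier G) dvd card K * p"
proof -
  interpret P: subgroup P G by (rule P)
  have comm: "x \<otimes> y = y \<otimes> x" if "x \<in> P" "y \<in> P" for x y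
    using NC[of x y] normalizes_self[OF P(1)] that by (auto simp: normalizes_def)
  let ?P = "G\<lparr>carrier := P\<rparr>" and ?E = "rcosets P"
  interpret PP: comm_group ?P by (rule subgroup_comm_group[OF P(1) comm])
  have EG: "X \<subseteq> carrier G" if "X \<in> ?E" for X using that P.rcosets_carrier by blast
  have act: "X #> g \<in> ?E" if g: "g \<in> carrier G" and X: "X \<in> ?E" for g X
  proof -
    obtain x where x: "x \<in> carrier G" "X = P #> x" using X by (auto simp: RCOSETS_def)
    have "X #> g = P #> (x \<otimes> g)" using g x P.subset by (simp add: coset_mult_assoc)
    then show ?thesis using g x(1) by (auto simp: RCOSETS_def)
  qed
  have actm: "X #> (g \<otimes> h) = X #> g #> h" if "g \<in> carrier G" "h \<in> carrier G" "X \<in> ?E" for g h X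
    using coset_mult_assoc[OF EG[OF that(3)] that(1,2)] by simp
  define c where "c D = (SOME y. y \<in> D)" for D :: "'a set"
  \<comment> \<open>\<open>X <#> P\<close> is the union of the \<open>P\<close>-orbit of the coset
    \<open>X\<close>, a double coset. Taking all representatives of one orbit inside the single left
    coset \<open>c (X <#> P) <# P\<close> is what makes \<open>t\<close> equivariant on free
    orbits.\<close>
  define t where "t X = (SOME y. y \<in> X \<and> (\<exists>w\<in>P. y = c (X <#> P) \<otimes> w))" for X
  have tX: "t X \<in> X \<and> (\<exists>w\<in>P. t X = c (X <#> P) \<otimes> w)" if X: "X \<in> ?E" for X
  proof -
    obtain x where x: "x \<in> X" using P.rcosets_non_empty[OF X] by auto
    have "x \<otimes> \<one> \<in> X <#> P" by (rule mult_set_memI) (use x in auto)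
    then have "c (X <#> P) \<in> X <#> P" unfolding c_def by (rule someI)
    then obtain y w where y: "c (X <#> P) = y \<otimes> w" "y \<in> X" "w \<in> P" by (rule mult_set_memE)
    have "y = c (X <#> P) \<otimes> inv w" using y EG[OF X] by (auto simp: m_assoc)
    then have "y \<in> X \<and> (\<exists>w\<in>P. y = c (X <#> P) \<otimes> w)" using y by auto
    then show ?thesis unfolding t_def by (rule someI)
  qed
  have tG [simp]: "t X \<in> carrier G" if "X \<in> ?E" for X using tX that EG by blast
  define n where "n g X = t X \<otimes> g \<otimes> inv (t (X #> g))" for g X
  have nP: "n g X \<in> P" if "g \<in> carrier G" "X \<in> ?E" for g X
  proof -
    have "t X \<otimes> g \<in> X #> g" using tX that by (auto simp: r_coset_def)
    then show ?thesis unfolding n_def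
      using diff_neutralizes[OF P(1) act[OF that]] tX[OF act[OF that]] by blast
  qed
  define V where "V g = finprod ?P (n g) ?E" for g
  have pi: "n g \<in> ?E \<rightarrow> carrier ?P" if "g \<in> carrier G" for g using nP that by auto
  have VP: "V g \<in> P" if "g \<in> carrier G" for g
    unfolding V_def using PP.finprod_closed[OF pi[OF that]] by simp
  have Vm: "V (g \<otimes> h) = V g \<otimes> V h" if g: "g \<in> carrier G" and h: "h \<in> carrier G" for g h
  proof -
    have im: "(\<lambda>X. X #> g) ` ?E = ?E"
    proof
      show "(\<lambda>X. X #> g) ` ?E \<subseteq> ?E" using act g by auto
      show "?E \<subseteq> (\<lambda>X. X #> g) ` ?E"
      proof
        fix X assume X: "X \<in> ?E"
        have "X = X #> inv g #> g" using actm[of "inv g" g X] g X EG[OF X] by simp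
        then show "X \<in> (\<lambda>X. X #> g) ` ?E" using act[of "inv g" X] g X by auto
      qed
    qed
    have inj: "inj_on (\<lambda>X. X #> g) ?E"
      by (rule eq_card_imp_inj_on[OF finite_rcosets]) (simp add: im)
    have nm: "n (g \<otimes> h) X = n g X \<otimes> n h (X #> g)" if "X \<in> ?E" for X
      unfolding n_def using that g h act[OF g that] act[OF h act[OF g that]]
      by (simp add: actm group_simps)
    have "V (g \<otimes> h) = finprod ?P (\<lambda>X. n g X \<otimes>\<^bsub>?P\<^esub> n h (X #> g)) ?E"
      unfolding V_def using g h nP act by (intro PP.finprod_cong') (auto simp: nm)
    also have "\<dots> = finprod ?P (n g) ?E \<otimes>\<^bsub>?P\<^esub> finprod ?P (\<lambda>X. n h (X #> g)) ?E"
      using g h nP act by (intro PP.finprod_multf) auto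
    also have "finprod ?P (\<lambda>X. n h (X #> g)) ?E = finprod ?P (n h) ((\<lambda>X. X #> g) ` ?E)"
      using g h nP act inj by (intro PP.finprod_reindex[symmetric]) auto
    also have "\<dots> = V h" unfolding im V_def by simp
    finally show ?thesis by (simp add: V_def)
  qed
  let ?F = "{X \<in> ?E. \<forall>u\<in>P. X #> u = X}"
  have moved: "n u X = \<one>" if u: "u \<in> P" and X: "X \<in> ?E" "X \<notin> ?F" for u X
  proof -
    have uG: "u \<in> carrier G" using u by simp
    \<comment> \<open>The stabilizer in \<open>P\<close> of a coset that is not fixed is a proper
      subgroup of a group of prime order, hence trivial.\<close>
    have free: "v = \<one>" if v: "v \<in> P" "X #> v = X" for v
    proof (rule ccontr)
      assume "v \<noteq> \<one>"
      let ?S = "{v \<in> P. X #> v = X}"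
      have S: "subgroup ?S G"
      proof (rule subgroupI)
        show "?S \<subseteq> carrier G" by auto
        show "?S \<noteq> {}" using EG[OF X(1)] by (auto intro!: exI[of _ \<one>])
        fix a assume a: "a \<in> ?S"
        then have "X #> inv a = X #> a #> inv a" by simp
        also have "\<dots> = X #> (a \<otimes> inv a)" using actm[of a "inv a" X] a X(1) by simp
        also have "\<dots> = X" using a EG[OF X(1)] by simp
        finally show "inv a \<in> ?S" using a by simp
        fix b assume "b \<in> ?S"
        then show "a \<otimes> b \<in> ?S" using a by (simp add: actm X(1))
      qed
      have "card ?S dvd p" using card_dvd[OF S P(1)] P(2) by auto
      moreover have "card ?S \<noteq> 1"
      proof
        assume "card ?S = 1"
        then obtain z where z: "?S = {z}" by (auto simp: card_1_singleton_iff)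
        have "v \<in> ?S" using v by simp
        moreover have "\<one> \<in> ?S" by (rule subgroup.one_closed[OF S])
        ultimately show False using \<open>v \<noteq> \<one>\<close> unfolding z by simp
      qed
      ultimately have "card ?S = card P" using p(1) P(2) by (auto simp: prime_nat_iff)
      then have "?S = P" by (intro card_subset_eq subgroup_finite P) auto
      then show False using X by auto
    qed
    have XuP: "(X #> u) <#> P = X <#> P"
    proof -
      have "{u} <#> P = P" using u coset_join3[of u P] P(1) by (simp add: l_coset_eq_set_mult)
      then show ?thesis using EG[OF X(1)] uG P.subset
        by (simp add: r_coset_eq_set_mult set_mult_assoc)
    qed
    obtain w where w: "w \<in> P" "t X = c (X <#> P) \<otimes> w" using tX[OF X(1)] by auto
    obtain w' where w': "w' \<in> P" "t (X #> u) = c (X <#> P) \<otimes> w'"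
      using tX[OF act[OF uG X(1)]] XuP by auto
    let ?c = "c (X <#> P)"
    have cG: "?c \<in> carrier G"
    proof -
      obtain x where x: "x \<in> X" using P.rcosets_non_empty[OF X(1)] by auto
      have "x \<otimes> \<one> \<in> X <#> P" by (rule mult_set_memI) (use x in auto)
      then have "?c \<in> X <#> P" unfolding c_def by (rule someI)
      then show ?thesis using set_mult_closed[OF EG[OF X(1)] P.subset] by auto
    qed
    \<comment> \<open>With t X = c w and t (Xu) = c w', the element w^-1 w' u^-1 stabilizes X;
      freeness gives w' = wu, that is, t (Xu) = (t X) u.\<close>
    let ?v = "inv w \<otimes> (w' \<otimes> inv u)"
    have vP: "?v \<in> P" using w w' u by simp
    have "t X \<otimes> ?v \<in> X"
    proof -
      have "t X \<otimes> ?v = t (X #> u) \<otimes> inv u" using w w' u cG by (simp add: m_assoc)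
      also have "\<dots> \<in> X #> u #> inv u" using tX[OF act[OF uG X(1)]] by (auto simp: r_coset_def)
      also have "X #> u #> inv u = X" using EG[OF X(1)] uG by (simp add: coset_mult_assoc)
      finally show ?thesis .
    qed
    moreover have "t X \<otimes> ?v \<in> X #> ?v" using tX[OF X(1)] by (auto simp: r_coset_def)
    ultimately have "X #> ?v = X"
      using rcos_disjoint[OF P(1)] act[OF _ X(1), of ?v] X(1) vP
      by (auto simp: pairwise_def disjnt_def)
    then have "?v = \<one>" using free vP by blast
    then have "w' = w \<otimes> u"
    proof -
      have "w' = w \<otimes> ?v \<otimes> u" using w w' u by (simp add: m_assoc)
      then show ?thesis unfolding \<open>?v = \<one>\<close> using w by simp
    qed
    then have "t (X #> u) = t X \<otimes> u" using w w' cG u by (simp add: m_assoc)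
    then show ?thesis unfolding n_def using X uG by simp
  qed
  have norm: "normalizes {x} P" if x: "x \<in> carrier G" "P #> x \<in> ?F" for x
    unfolding normalizes_def
  proof (intro ballI)
    fix y u assume "y \<in> {x}" "u \<in> P"
    then have yu: "y = x" "u \<in> P" by auto
    have "P #> (x \<otimes> u) = P #> x" using x yu P.subset by (simp add: coset_mult_assoc[symmetric])
    then have "x \<otimes> u \<in> P #> x" using rcos_self[of "x \<otimes> u" P] x yu P(1) by simp
    then obtain h where h: "h \<in> P" "x \<otimes> u = h \<otimes> x" by (auto simp: r_coset_def)
    then show "y \<otimes> u \<otimes> inv y \<in> P" using x yu by (simp add: m_assoc)
  qed
  have fixed: "n u X = u" if u: "u \<in> P" and X: "X \<in> ?F" for u X
  proof -
    have XE: "X \<in> ?E" using X by simp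
    obtain x where x: "x \<in> carrier G" "X = P #> x" using XE by (auto simp: RCOSETS_def)
    have "X = P #> t X" using tX[OF XE] repr_independence[of "t X" P x] x P(1) by simp
    then have "normalizes {t X} P" using norm[of "t X"] X tG[OF XE] by metis
    then have "t X \<otimes> u = u \<otimes> t X" using NC[OF tG[OF XE]] u by blast
    then show ?thesis unfolding n_def using X u tG[OF XE] by (simp add: m_assoc)
  qed
  have VPow: "V u = u [^] card ?F" if u: "u \<in> P" for u
  proof -
    have "V u = finprod ?P (n u) ?F"
      unfolding V_def using moved[OF u] nP u
      by (intro PP.finprod_mono_neutral_cong_right finite_rcosets) auto
    also have "\<dots> = finprod ?P (\<lambda>_. u) ?F" using fixed[OF u] u by (intro PP.finprod_cong') auto
    also have "\<dots> = u [^]\<^bsub>?P\<^esub> card ?F" using u by (intro PP.finprod_const) simp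
    finally show ?thesis by (simp add: nat_pow_consistent[symmetric])
  qed
  \<comment> \<open>The fixed cosets are those inside the normalizer of \<open>P\<close>, so their
    number is |N(P):P|, prime to p. The transfer therefore acts on \<open>P\<close> as an invertible
    power map, and its kernel meets \<open>P\<close> trivially.\<close>
  have "\<not> p dvd card ?F"
  proof -
    let ?N = "{x \<in> carrier G. normalizes {x} P}"
    have nP': "x \<otimes> u = u \<otimes> x" if "x \<in> ?N" "u \<in> P" for x u using NC that by auto
    have conj: "x \<otimes> u \<otimes> inv x = u" "inv x \<otimes> u \<otimes> inv (inv x) = u" if "x \<in> ?N" "u \<in> P" for x u
    proof -
      have G: "x \<in> carrier G" "u \<in> carrier G" using that by auto
      show "x \<otimes> u \<otimes> inv x = u" unfolding nP'[OF that] using G by (simp add: m_assoc)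
      have "inv x \<otimes> u \<otimes> inv (inv x) = inv x \<otimes> (u \<otimes> x)" using G by (simp add: m_assoc)
      also have "\<dots> = u" unfolding nP'[OF that, symmetric] using G by simp
      finally show "inv x \<otimes> u \<otimes> inv (inv x) = u" .
    qed
    have N: "subgroup ?N G"
    proof (rule subgroupI)
      show "?N \<subseteq> carrier G" by auto
      show "?N \<noteq> {}" by (auto simp: normalizes_def intro!: exI[of _ \<one>])
      fix x assume x: "x \<in> ?N"
      show "inv x \<in> ?N" using x conj(2)[OF x] by (simp add: normalizes_def)
      fix y assume y: "y \<in> ?N"
      have "x \<otimes> y \<otimes> u \<otimes> inv (x \<otimes> y) = u" if "u \<in> P" for u
      proof -
        have "x \<otimes> y \<otimes> u \<otimes> inv (x \<otimes> y) = x \<otimes> (y \<otimes> u \<otimes> inv y) \<otimes> inv x"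
          using x y that by (simp add: group_simps)
        then show ?thesis using conj(1)[OF y that] conj(1)[OF x that] by simp
      qed
      then show "x \<otimes> y \<in> ?N" using x y by (simp add: normalizes_def)
    qed
    have PN: "P \<subseteq> ?N" using normalizes_self[OF P(1)] by (auto simp: normalizes_def)
    have "?F = rcosets\<^bsub>G\<lparr>carrier := ?N\<rparr>\<^esub> P"
    proof
      show "?F \<subseteq> rcosets\<^bsub>G\<lparr>carrier := ?N\<rparr>\<^esub> P"
      proof
        fix X assume X: "X \<in> ?F"
        then obtain x where x: "x \<in> carrier G" "X = P #> x" by (auto simp: RCOSETS_def)
        then show "X \<in> rcosets\<^bsub>G\<lparr>carrier := ?N\<rparr>\<^esub> P" using norm[of x] X by (auto simp: RCOSETS_def)
      qed
      show "rcosets\<^bsub>G\<lparr>carrier := ?N\<rparr>\<^esub> P \<subseteq> ?F"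
      proof
        fix X assume "X \<in> rcosets\<^bsub>G\<lparr>carrier := ?N\<rparr>\<^esub> P"
        then obtain x where x: "x \<in> ?N" "X = P #> x" by (auto simp: RCOSETS_def)
        have "X #> u = X" if u: "u \<in> P" for u
        proof -
          have "X #> u = P #> (u \<otimes> x)" using x u nP'[OF x(1) u] P.subset by (simp add: coset_mult_assoc)
          also have "\<dots> = (P #> u) #> x" using x u P.subset by (simp add: coset_mult_assoc)
          also have "P #> u = P" using coset_join2[of u P] u P(1) by simp
          finally show ?thesis using x by simp
        qed
        then show "X \<in> ?F" using x by (auto simp: RCOSETS_def)
      qed
    qed
    then have "card ?F = card ?N div p" using card_rcosets[OF P(1) N PN] P(2) by simp
    moreover have "card (carrier G) div p = (card (carrier G) div card ?N) * (card ?N div p)"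
      using card_tower[OF P(1) N subgroup_self PN] P(2) by auto
    ultimately show ?thesis using p(2) by auto
  qed
  then have cop: "coprime p (card ?F)" using p(1) by (simp add: prime_imp_coprime)
  have "V \<in> hom G ?P" using VP Vm by (auto simp: hom_def)
  then interpret V: group_hom G ?P V
    using PP.is_group by (simp add: group_hom_def group_hom_axioms_def)
  let ?K = "kernel G ?P V"
  have KN: "?K \<lhd> G" by (rule V.normal_kernel)
  have K: "subgroup ?K G" by (rule V.subgroup_kernel)
  have KP: "?K \<inter> P = {\<one>}"
  proof -
    have "z = \<one>" if "z \<in> ?K" "z \<in> P" for z
    proof -
      have "z [^] card ?F = \<one>" using VPow that by (auto simp: kernel_def)
      then show ?thesis
        using pow_coprime_closed[OF triv_subgroup, of z p "card ?F"] cop prime_gt_0_nat[OF p(1)]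
          pow_card[OF P(1) that(2)] P(2) that by (auto simp: kernel_def)
    qed
    then show ?thesis using subgroup.one_closed[OF K] subgroup.one_closed[OF P(1)] by blast
  qed
  have "card (carrier G) dvd card ?K * p"
  proof -
    have inj: "inj_on (\<lambda>X. the_elem (V ` X)) (carrier (G Mod ?K))" by (rule V.FactGroup_inj_on)
    have hm: "(\<lambda>X. the_elem (V ` X)) \<in> hom (G Mod ?K) ?P" by (rule V.FactGroup_hom)
    interpret KK: normal ?K G by (rule KN)
    have Q: "group (G Mod ?K)" by (rule KK.factorgroup_is_group)
    interpret Q: group_hom "G Mod ?K" ?P "\<lambda>X. the_elem (V ` X)"
      using Q PP.is_group hm by (simp add: group_hom_def group_hom_axioms_def)
    have "subgroup ((\<lambda>X. the_elem (V ` X)) ` carrier (G Mod ?K)) ?P" by (rule Q.img_is_subgroup)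
    then have "subgroup ((\<lambda>X. the_elem (V ` X)) ` carrier (G Mod ?K)) G"
      "(\<lambda>X. the_elem (V ` X)) ` carrier (G Mod ?K) \<subseteq> P"
      using incl_subgroup[OF P(1)] subgroup.subset by fastforce+
    then have "card ((\<lambda>X. the_elem (V ` X)) ` carrier (G Mod ?K)) dvd p"
      using card_dvd[OF _ P(1)] P(2) by auto
    then have "card (carrier (G Mod ?K)) dvd p" by (simp add: card_image[OF inj])
    then have "card (carrier G) div card ?K dvd p"
      using card_rcosets_carrier[OF K] by (simp add: FactGroup_def)
    then have "card ?K * (card (carrier G) div card ?K) dvd card ?K * p" by (rule mult_dvd_mono[OF dvd_refl])
    then show ?thesis using card_mult_div[OF K subgroup_self subgroup.subset[OF K]] by simp
  qed
  then show ?thesis using that KN KP by blast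
qed

lemma subgroup_centralizer:
  assumes "A \<subseteq> carrier G"
  shows "subgroup {h \<in> carrier G. \<forall>a\<in>A. h \<otimes> a = a \<otimes> h} G"
proof (rule subgroupI)
  show "{h \<in> carrier G. \<forall>a\<in>A. h \<otimes> a = a \<otimes> h} \<subseteq> carrier G" by auto
  have "\<one> \<in> {h \<in> carrier G. \<forall>a\<in>A. h \<otimes> a = a \<otimes> h}" using assms by (simp add: subset_iff)
  then show "{h \<in> carrier G. \<forall>a\<in>A. h \<otimes> a = a \<otimes> h} \<noteq> {}" by blast
  fix h assume h: "h \<in> {h \<in> carrier G. \<forall>a\<in>A. h \<otimes> a = a \<otimes> h}"
  have "inv h \<otimes> a = a \<otimes> inv h" if "a \<in> A" for a
  proof -
    have G: "h \<in> carrier G" "a \<in> carrier G" and c: "h \<otimes> a = a \<otimes> h" using h that assms by auto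
    have "inv h \<otimes> a = inv h \<otimes> (a \<otimes> h) \<otimes> inv h" using G by (simp add: m_assoc)
    also have "\<dots> = a \<otimes> inv h" unfolding c[symmetric] using G by (simp add: m_assoc)
    finally show ?thesis .
  qed
  then show "inv h \<in> {h \<in> carrier G. \<forall>a\<in>A. h \<otimes> a = a \<otimes> h}" using h by auto
  fix k assume k: "k \<in> {h \<in> carrier G. \<forall>a\<in>A. h \<otimes> a = a \<otimes> h}"
  have "h \<otimes> k \<otimes> a = a \<otimes> (h \<otimes> k)" if "a \<in> A" for a
  proof -
    have aG: "a \<in> carrier G" using that assms by auto
    have "h \<otimes> k \<otimes> a = h \<otimes> (k \<otimes> a)" using h k aG by (simp add: m_assoc)
    also have "k \<otimes> a = a \<otimes> k" using k that by simp
    also have "h \<otimes> (a \<otimes> k) = (h \<otimes> a) \<otimes> k" using h k aG by (simp add: m_assoc)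
    also have "h \<otimes> a = a \<otimes> h" using h that by simp
    finally show ?thesis using h k aG by (simp add: m_assoc)
  qed
  then show "h \<otimes> k \<in> {h \<in> carrier G. \<forall>a\<in>A. h \<otimes> a = a \<otimes> h}" using h k by auto
qed

text \<open>An element g normalizing a subgroup <x> of order p sends x to some x^k, and g^(p-1)
  centralizes x by Fermat. No prime below p divides |G|, so p - 1 is coprime to the order of g, and
  g itself centralizes x. This is the hypothesis of \<open>burnside_transfer\<close>. The last
  clause turns a trivial kernel into |G| = p.\<close>

lemma smallest_prime_normal_subgroup:
  assumes p: "prime p" "p dvd card (carrier G)" "\<not> p dvd card (carrier G) div p"
    and least: "\<And>q. prime q \<Longrightarrow> q dvd card (carrier G) \<Longrightarrow> p \<le> q"
  obtains K where "K \<lhd> G" "K \<noteq> carrier G" "K = {\<one>} \<Longrightarrow> card (carrier G) = p"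
proof -
  obtain x where x: "x \<in> carrier G" "ord x = p" using cauchy[OF subgroup_self p(1,2)] .
  let ?P = "generate G {x}"
  have P: "subgroup ?P G" "card ?P = p"
    using x generate_pow_card[of x] by (auto intro: generate_is_subgroup)
  have Pe: "\<exists>k::nat. u = x [^] k" if "u \<in> ?P" for u
    using that generate_pow_on_finite_carrier[OF fin x(1)] by auto
  have "g \<otimes> u = u \<otimes> g" if g: "g \<in> carrier G" and nrm: "normalizes {g} ?P" and u: "u \<in> ?P" for g u
  proof -
    have xP: "x \<in> ?P" by (simp add: generate.incl)
    then have "g \<otimes> x \<otimes> inv g \<in> ?P" using nrm by (simp add: normalizes_def)
    then obtain k :: nat where k: "g \<otimes> x \<otimes> inv g = x [^] k" using Pe by blast
    have it: "g [^] i \<otimes> x \<otimes> inv (g [^] i) = x [^] (k ^ i)" for i :: nat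
    proof (induction i)
      case 0
      then show ?case using x by simp
    next
      case (Suc i)
      have "g [^] Suc i \<otimes> x \<otimes> inv (g [^] Suc i) = g \<otimes> (g [^] i \<otimes> x \<otimes> inv (g [^] i)) \<otimes> inv g"
        unfolding nat_pow_Suc2[OF g] using g x by (simp add: group_simps)
      also have "\<dots> = (g \<otimes> x \<otimes> inv g) [^] (k ^ i)" unfolding Suc.IH using g x by (simp add: conj_pow)
      also have "\<dots> = x [^] (k ^ Suc i)" unfolding k using x by (simp add: nat_pow_pow)
      finally show ?case .
    qed
    have "\<not> p dvd k"
    proof
      assume "p dvd k"
      then have "x [^] k = \<one>" using x pow_eq_id by simp
      then have "g \<otimes> x \<otimes> inv g = \<one>" using k by simp
      moreover have "x = inv g \<otimes> (g \<otimes> x \<otimes> inv g) \<otimes> g" using g x by (simp add: m_assoc)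
      ultimately have "x = \<one>" using g by simp
      then show False using x p(1) by (auto simp: ord_id)
    qed
    then have "[k ^ (p - 1) = 1] (mod p)" using fermat_theorem[OF p(1)] by blast
    then have "[int (k ^ (p - 1)) = int 1] (mod int p)" by (simp only: cong_int_iff)
    then have "int p dvd int 1 - int (k ^ (p - 1))"
      by (simp only: cong_iff_dvd_diff dvd_diff_commute)
    then have "x [^] int (k ^ (p - 1)) = x [^] int 1"
      using int_pow_eq[OF x(1), of "int (k ^ (p - 1))" "int 1"] x(2) by simp
    then have "x [^] (k ^ (p - 1)) = x" using x by (simp only: int_pow_int) simp
    then have c1: "g [^] (p - 1) \<otimes> x \<otimes> inv (g [^] (p - 1)) = x" using it[of "p - 1"] by simp
    let ?C = "{h \<in> carrier G. h \<otimes> x = x \<otimes> h}"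
    have C: "subgroup ?C G" using subgroup_centralizer[of "{x}"] x by simp
    have "g [^] (p - 1) \<otimes> x = x \<otimes> g [^] (p - 1)"
    proof -
      have "g [^] (p - 1) \<otimes> x = (g [^] (p - 1) \<otimes> x \<otimes> inv (g [^] (p - 1))) \<otimes> g [^] (p - 1)"
        using g x by (simp add: m_assoc)
      then show ?thesis using c1 by simp
    qed
    then have "g [^] (p - 1) \<in> ?C" using g by simp
    moreover have "g [^] ord g \<in> ?C" using g x by simp
    moreover have "coprime (p - 1) (ord g)"
    proof (rule ccontr)
      assume "\<not> coprime (p - 1) (ord g)"
      then have "gcd (p - 1) (ord g) \<noteq> 1" by (simp add: coprime_iff_gcd_eq_1)
      then obtain q where q: "prime q" "q dvd gcd (p - 1) (ord g)" using prime_factor_nat by blast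
      then have q': "q dvd p - 1" "q dvd ord g" by auto
      then have "q dvd card (carrier G)" using ord_dvd_card[OF subgroup_self g] dvd_trans by blast
      then have "p \<le> q" using least q by blast
      moreover have "q \<le> p - 1" using q' prime_gt_1_nat[OF p(1)] by (simp add: dvd_imp_le)
      ultimately show False using prime_gt_1_nat[OF p(1)] by simp
    qed
    ultimately have "g \<in> ?C"
      by (intro pow_coprime_closed[OF C g, of "p - 1" "ord g"]) (use prime_gt_1_nat[OF p(1)] in simp_all)
    then have gx: "g \<otimes> x = x \<otimes> g" by blast
    obtain i :: nat where "u = x [^] i" using Pe[OF u] by blast
    then show ?thesis using group_commutes_pow[OF gx[symmetric] x(1) g] by simp
  qed
  then obtain K where K: "K \<lhd> G" "K \<inter> ?P = {\<one>}" "card (carrier G) dvd card K * p"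
    using burnside_transfer[OF P p(1,3)] by blast
  show ?thesis
  proof (rule that[OF K(1)])
    show "K \<noteq> carrier G"
    proof
      assume "K = carrier G"
      then have "?P = {\<one>}" using K(2) subgroup.subset[OF P(1)] by auto
      then have "card ?P = 1" by (metis card_1_singleton_iff One_nat_def)
      then show False using P(2) p(1) by simp
    qed
    show "card (carrier G) = p" if "K = {\<one>}"
    proof -
      have "card (carrier G) dvd p" using K(3) that by simp
      then show ?thesis using p(1,2) dvd_antisym by blast
    qed
  qed
qed

end

section \<open>Subgroups permuting with Hall subgroups\<close>

context group begin

text \<open>This is x H x^-1, in accordance with \<open>normalizes\<close>, whereas
  \<open>conj_set\<close> is x^-1 H x; under a quantifier over all x the two agree.\<close>

definition conjugate :: "'a \<Rightarrow> 'a set \<Rightarrow> 'a set" where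
  "conjugate x H = (\<lambda>y. x \<otimes> y \<otimes> inv x) ` H"

lemma conjugate_mem: "y \<in> H \<Longrightarrow> x \<otimes> y \<otimes> inv x \<in> conjugate x H"
  by (simp add: conjugate_def)

lemma conjugateE:
  assumes "z \<in> conjugate x H" obtains y where "y \<in> H" "z = x \<otimes> y \<otimes> inv x"
  using assms by (auto simp: conjugate_def)

lemma conjugate_one: "H \<subseteq> carrier G \<Longrightarrow> conjugate \<one> H = H"
  by (force simp: conjugate_def)

lemma conjugate_conjugate:
  assumes "x \<in> carrier G" "y \<in> carrier G" "H \<subseteq> carrier G"
  shows "conjugate x (conjugate y H) = conjugate (x \<otimes> y) H"
  unfolding conjugate_def image_image using assms
  by (intro image_cong refl) (auto simp: group_simps)

lemma conjugate_mono: "A \<subseteq> B \<Longrightarrow> conjugate x A \<subseteq> conjugate x B"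
  by (auto simp: conjugate_def)

lemma conjugate_subset:
  assumes "subgroup X G" "x \<in> X" "H \<subseteq> X" shows "conjugate x H \<subseteq> X"
  using assms by (auto simp: conjugate_def intro!: subgroup.m_closed subgroup.m_inv_closed)

lemma conjugate_set_mult:
  assumes "x \<in> carrier G" "A \<subseteq> carrier G" "B \<subseteq> carrier G"
  shows "conjugate x (A <#> B) = conjugate x A <#> conjugate x B"
proof -
  have e: "x \<otimes> (a \<otimes> b) \<otimes> inv x = (x \<otimes> a \<otimes> inv x) \<otimes> (x \<otimes> b \<otimes> inv x)" if "a \<in> A" "b \<in> B" for a b
    using assms that by (auto simp: subset_iff m_assoc)
  show ?thesis
  proof
    show "conjugate x (A <#> B) \<subseteq> conjugate x A <#> conjugate x B"
    proof
      fix z assume "z \<in> conjugate x (A <#> B)"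
      then obtain a b where "a \<in> A" "b \<in> B" "z = x \<otimes> (a \<otimes> b) \<otimes> inv x"
        by (auto simp: conjugate_def set_mult_def)
      then show "z \<in> conjugate x A <#> conjugate x B"
        using e by (auto intro!: mult_set_memI conjugate_mem)
    qed
    show "conjugate x A <#> conjugate x B \<subseteq> conjugate x (A <#> B)"
    proof
      fix z assume "z \<in> conjugate x A <#> conjugate x B"
      then obtain a b where "a \<in> A" "b \<in> B" "z = (x \<otimes> a \<otimes> inv x) \<otimes> (x \<otimes> b \<otimes> inv x)"
        by (auto simp: conjugate_def set_mult_def)
      then show "z \<in> conjugate x (A <#> B)"
        using e[symmetric] by (auto intro!: mult_set_memI conjugate_mem)
    qed
  qed
qed

lemma conjugate_subgroup: "subgroup H G \<Longrightarrow> x \<in> carrier G \<Longrightarrow> subgroup (conjugate x H) G"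
  unfolding conjugate_def by (rule conj_subgroup)

lemma conjugate_card: "H \<subseteq> carrier G \<Longrightarrow> x \<in> carrier G \<Longrightarrow> card (conjugate x H) = card H"
  unfolding conjugate_def by (rule conj_card)

lemma normalizes_iff_conjugate: "normalizes X Z \<longleftrightarrow> (\<forall>x\<in>X. conjugate x Z \<subseteq> Z)"
  by (auto simp: normalizes_def conjugate_def)

lemma normalizes_conjugate_eq:
  assumes X: "subgroup X G" and Z: "Z \<subseteq> carrier G" and "normalizes X Z" "x \<in> X"
  shows "conjugate x Z = Z"
proof
  show "conjugate x Z \<subseteq> Z" using assms normalizes_iff_conjugate by blast
  have xG: "x \<in> carrier G" using X assms(4) subgroup_carrier by blast
  have "conjugate (inv x) Z \<subseteq> Z" using assms normalizes_iff_conjugate subgroup.m_inv_closed[OF X] by blast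
  then have "conjugate x (conjugate (inv x) Z) \<subseteq> conjugate x Z" by (rule conjugate_mono)
  then show "Z \<subseteq> conjugate x Z" using xG Z by (simp add: conjugate_conjugate conjugate_one)
qed

definition hall_in :: "nat set \<Rightarrow> 'a set \<Rightarrow> 'a set \<Rightarrow> bool" where
  "hall_in s X H \<longleftrightarrow> subgroup H G \<and> H \<subseteq> X \<and> pi_number s (card H) \<and> pi_number (- s) (card X div card H)"

definition permutes_conjugates :: "'a set \<Rightarrow> 'a set \<Rightarrow> 'a set \<Rightarrow> bool" where
  "permutes_conjugates X E H \<longleftrightarrow> (\<forall>x\<in>X. E <#> conjugate x H = conjugate x H <#> E)"

text \<open>
  A form of the hypothesis that every subgroup is \<open>H\<^sub>\<sigma>\<close>-permutably embedded which passes to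
  normal subgroups: the Hall subgroups for the various members of \<open>\<sigma>\<close> are chosen independently.
\<close>

definition all_embedded :: "nat set set \<Rightarrow> 'a set \<Rightarrow> bool" where
  "all_embedded \<sigma> X \<longleftrightarrow> (\<forall>A. subgroup A G \<longrightarrow> A \<subseteq> X \<longrightarrow>
     (\<exists>E. subgroup E G \<and> A \<subseteq> E \<and> E \<subseteq> X \<and>
        (\<forall>s\<in>\<sigma>. \<not> pi_number (- s) (card A) \<longrightarrow> pi_number (- s) (card E div card A)) \<and>
        (\<forall>s\<in>\<sigma>. \<exists>H. hall_in s X H \<and> permutes_conjugates X E H)))"

lemma all_embeddedE:
  assumes "all_embedded \<sigma> X" "subgroup A G" "A \<subseteq> X"
  obtains E where "subgroup E G" "A \<subseteq> E" "E \<subseteq> X"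
    "\<And>s. s \<in> \<sigma> \<Longrightarrow> \<not> pi_number (- s) (card A) \<Longrightarrow> pi_number (- s) (card E div card A)"
    "\<And>s. s \<in> \<sigma> \<Longrightarrow> \<exists>H. hall_in s X H \<and> permutes_conjugates X E H"
proof -
  from assms(1)[unfolded all_embedded_def, rule_format, OF assms(2,3)]
  show thesis by (elim exE conjE) (rule that, assumption+, (simp; fail)+)
qed

text \<open>An element of H can be moved past a word in A and B letter by letter, which gives one
  inclusion; taking inverses gives the other.\<close>

lemma permutes_generate:
  assumes H: "subgroup H G" and A: "subgroup A G" "A <#> H = H <#> A"
    and B: "subgroup B G" "B <#> H = H <#> B"
  shows "generate G (A \<union> B) <#> H = H <#> generate G (A \<union> B)"
proof -
  let ?C = "generate G (A \<union> B)"
  have AB: "A \<union> B \<subseteq> carrier G" using A B subgroup.subset by blast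
  have C: "subgroup ?C G" by (rule generate_is_subgroup[OF AB])
  note [simp] = subgroup_carrier[OF H] subgroup_carrier[OF C]
  have gen: "c \<otimes> h \<in> H <#> ?C" if c: "c \<in> A \<union> B" and h: "h \<in> H" for c h
  proof -
    have "c \<otimes> h \<in> A <#> H \<or> c \<otimes> h \<in> B <#> H" using c h mult_set_memI by blast
    then have "c \<otimes> h \<in> H <#> A \<or> c \<otimes> h \<in> H <#> B" using A B by simp
    moreover have "H <#> A \<subseteq> H <#> ?C" "H <#> B \<subseteq> H <#> ?C"
      by (intro mono_set_mult subset_refl; auto intro: generate.incl)+
    ultimately show ?thesis by blast
  qed
  have *: "\<forall>h\<in>H. c \<otimes> h \<in> H <#> ?C" if "c \<in> ?C" for c
    using that
  proof induction
    case one
    then show ?case using mult_set_memI[of _ H \<one> ?C] subgroup.one_closed[OF C] by simp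
  next
    case (incl h) then show ?case using gen by blast
  next
    case (inv h)
    then have "inv h \<in> A \<union> B" using subgroup.m_inv_closed[OF A(1)] subgroup.m_inv_closed[OF B(1)] by auto
    then show ?case using gen by blast
  next
    case (eng h1 h2)
    show ?case
    proof
      fix h assume h: "h \<in> H"
      have "h2 \<otimes> h \<in> H <#> ?C" using eng h by blast
      then obtain h' c where 1: "h2 \<otimes> h = h' \<otimes> c" "h' \<in> H" "c \<in> ?C" by (rule mult_set_memE)
      have "h1 \<otimes> h' \<in> H <#> ?C" using eng 1 by blast
      then obtain h'' c' where 2: "h1 \<otimes> h' = h'' \<otimes> c'" "h'' \<in> H" "c' \<in> ?C" by (rule mult_set_memE)
      have "h1 \<otimes> h2 \<otimes> h = h1 \<otimes> (h2 \<otimes> h)" using eng h by (simp add: m_assoc)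
      also have "\<dots> = (h1 \<otimes> h') \<otimes> c" unfolding 1(1) using eng 1(2,3) by (simp add: m_assoc)
      also have "\<dots> = h'' \<otimes> (c' \<otimes> c)" unfolding 2(1) using eng 1(2,3) 2(2,3) by (simp add: m_assoc)
      finally show "h1 \<otimes> h2 \<otimes> h \<in> H <#> ?C"
        using mult_set_memI[of h'' H "c' \<otimes> c" ?C] 1(3) 2(2,3) subgroup.m_closed[OF C] by simp
    qed
  qed
  have sub: "?C <#> H \<subseteq> H <#> ?C" using * by (auto simp: set_mult_def[of _ ?C])
  moreover have "H <#> ?C \<subseteq> ?C <#> H"
  proof
    fix z assume "z \<in> H <#> ?C"
    then obtain h c where z: "z = h \<otimes> c" "h \<in> H" "c \<in> ?C" by (rule mult_set_memE)
    have "inv c \<otimes> inv h \<in> H <#> ?C"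
      using * subgroup.m_inv_closed[OF C z(3)] subgroup.m_inv_closed[OF H z(2)] by blast
    then obtain h' c' where 1: "inv c \<otimes> inv h = h' \<otimes> c'" "h' \<in> H" "c' \<in> ?C" by (rule mult_set_memE)
    have "z = inv (inv c \<otimes> inv h)" using z by (simp add: inv_mult_group)
    also have "\<dots> = inv c' \<otimes> inv h'" unfolding 1(1) using 1(2,3) by (simp add: inv_mult_group)
    finally show "z \<in> ?C <#> H"
      using mult_set_memI[OF subgroup.m_inv_closed[OF C 1(3)] subgroup.m_inv_closed[OF H 1(2)]] by simp
  qed
  ultimately show ?thesis by blast
qed

text \<open>If x = eh, then x H x^-1 = e H e^-1, and E e H e^-1 = E H e^-1 = X.\<close>

lemma factorization_conjugate:
  assumes E: "subgroup E G" "E \<subseteq> X" and H: "subgroup H G" "H \<subseteq> X" and X: "subgroup X G"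
    and EH: "E <#> H = X" and x: "x \<in> X"
  shows "E <#> conjugate x H = X"
proof
  note [simp] = subgroup_carrier[OF H(1)] subgroup_carrier[OF E(1)] subgroup_carrier[OF X]
  show "E <#> conjugate x H \<subseteq> X"
    by (rule set_mult_subset[OF X E(2) conjugate_subset[OF X x H(2)]])
  obtain e h where eh: "x = e \<otimes> h" "e \<in> E" "h \<in> H" using x EH by (auto elim: mult_set_memE)
  show "X \<subseteq> E <#> conjugate x H"
  proof
    fix y assume y: "y \<in> X"
    have "y \<otimes> e \<in> E <#> H" using EH y eh E(2) subgroup.m_closed[OF X] by auto
    then obtain b k where bk: "y \<otimes> e = b \<otimes> k" "b \<in> E" "k \<in> H" by (rule mult_set_memE)
    let ?k = "inv h \<otimes> k \<otimes> h"
    have kH: "?k \<in> H" using bk eh H(1) by (simp add: subgroup.m_closed subgroup.m_inv_closed)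
    have "y = (y \<otimes> e) \<otimes> inv e" using y eh by (simp add: m_assoc)
    also have "\<dots> = (b \<otimes> inv e) \<otimes> (x \<otimes> ?k \<otimes> inv x)"
      unfolding bk(1) eh(1) using y bk(2,3) eh(2,3) by (simp add: group_simps)
    finally show "y \<in> E <#> conjugate x H"
      using mult_set_memI[of "b \<otimes> inv e" E "x \<otimes> ?k \<otimes> inv x" "conjugate x H"] conjugate_mem[OF kH, of x]
        bk(2) eh(2) E(1) by (simp add: subgroup.m_closed subgroup.m_inv_closed)
  qed
qed

lemma generate_normalizes:
  assumes X: "subgroup X G" and S: "S \<subseteq> carrier G" "\<And>x y. x \<in> X \<Longrightarrow> y \<in> S \<Longrightarrow> x \<otimes> y \<otimes> inv x \<in> S"
  shows "normalizes X (generate G S)"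
  unfolding normalizes_def
proof (intro ballI)
  fix x y assume x: "x \<in> X" and y: "y \<in> generate G S"
  have xG: "x \<in> carrier G" using x X subgroup_carrier by blast
  note [simp] = generate_in_carrier[OF S(1)] xG
  from y show "x \<otimes> y \<otimes> inv x \<in> generate G S"
  proof induction
    case one then show ?case by (simp add: generate.one)
  next
    case (incl h) then show ?case using S(2) x by (blast intro: generate.incl)
  next
    case (inv h)
    then have "h \<in> carrier G" using S(1) by blast
    then have "x \<otimes> inv h \<otimes> inv x = inv (x \<otimes> h \<otimes> inv x)" by (simp add: group_simps)
    then show ?case using S(2) x inv by (metis generate.inv)
  next
    case (eng h1 h2)
    have "x \<otimes> (h1 \<otimes> h2) \<otimes> inv x = (x \<otimes> h1 \<otimes> inv x) \<otimes> (x \<otimes> h2 \<otimes> inv x)"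
      using eng(1,2) by (simp add: m_assoc)
    then show ?case using eng(3,4) by (simp add: generate.eng)
  qed
qed

end

section \<open>Kegel's argument and the passage to normal subgroups\<close>

context finite_group begin

lemma normalizer_subgroup:
  assumes E: "subgroup E G" shows "subgroup {x \<in> carrier G. normalizes {x} E} G"
proof (rule subgroupI)
  show "{x \<in> carrier G. normalizes {x} E} \<subseteq> carrier G" by auto
  have "\<one> \<in> {x \<in> carrier G. normalizes {x} E}" using subgroup_carrier[OF E] by (simp add: normalizes_def)
  then show "{x \<in> carrier G. normalizes {x} E} \<noteq> {}" by blast
  fix x assume x: "x \<in> {x \<in> carrier G. normalizes {x} E}"
  then have xG: "x \<in> carrier G" and sub: "conjugate x E \<subseteq> E" by (auto simp: normalizes_iff_conjugate)
  have "conjugate x E = E"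
    using card_subset_eq[OF subgroup_finite[OF E] sub] conjugate_card[OF subgroup.subset[OF E] xG] by simp
  then have "conjugate (inv x) E = conjugate (inv x) (conjugate x E)" by simp
  also have "\<dots> = E" using xG subgroup.subset[OF E] by (simp add: conjugate_conjugate conjugate_one)
  finally show "inv x \<in> {x \<in> carrier G. normalizes {x} E}" using xG by (simp add: normalizes_iff_conjugate)
  fix y assume y: "y \<in> {x \<in> carrier G. normalizes {x} E}"
  then have yG: "y \<in> carrier G" and suby: "conjugate y E \<subseteq> E" by (auto simp: normalizes_iff_conjugate)
  have "conjugate (x \<otimes> y) E = conjugate x (conjugate y E)"
    using xG yG subgroup.subset[OF E] by (simp add: conjugate_conjugate)
  also have "\<dots> \<subseteq> E" using conjugate_mono[OF suby, of x] sub by blast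
  finally show "x \<otimes> y \<in> {x \<in> carrier G. normalizes {x} E}" using xG yG by (simp add: normalizes_iff_conjugate)
qed

text \<open>|M : E \<inter> M| = |EM : E|, and EM lies between E and L.\<close>

lemma index_Int_dvd:
  assumes L: "subgroup L G" and E: "subgroup E G" "E \<subseteq> L" and M: "subgroup M G" "M \<subseteq> L"
    and nrm: "normalizes E M"
  shows "card M div card (E \<inter> M) dvd card L div card E"
proof -
  have EM: "subgroup (E <#> M) G"
    using normalizes_subgroup_mult[OF E(1) M(1) nrm] normalizes_permutes[OF E(1) M(1) nrm] by simp
  have "card L div card E = (card L div card (E <#> M)) * (card (E <#> M) div card E)"
    by (rule card_tower[OF E(1) EM L subset_set_mult(1)[OF E(1) M(1)] set_mult_subset[OF L E(2) M(2)]])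
  then show ?thesis using card_set_mult_div[OF E(1) M(1) EM] by simp
qed

lemma obtain_max_card:
  assumes "F \<noteq> {}" "F \<subseteq> Pow (carrier G)"
  obtains M where "M \<in> F" "\<And>N. N \<in> F \<Longrightarrow> card N \<le> card M"
proof -
  have fF: "finite F" using assms(2) fin by (meson finite_Pow_iff finite_subset)
  then have "Max (card ` F) \<in> card ` F" using assms(1) by (intro Max_in) auto
  then obtain M where "M \<in> F" "card M = Max (card ` F)" by auto
  then show ?thesis using that fF by (metis Max_ge finite_imageI imageI)
qed

text \<open>Choose E1 of largest order among the overgroups of E that permute with all conjugates of
  H and do not supplement H. For b in a conjugate of H, the subgroup generated by E1 and its
  conjugate by b permutes as well. It lies in the product of E1 with that conjugate of H, which is a
  proper subgroup, hence it is no supplement either. Maximality shows that b normalizes E1.\<close>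

lemma kegel_permutes:
  assumes X: "subgroup X G" and E: "subgroup E G" "E \<subseteq> X" and H: "subgroup H G" "H \<subseteq> X"
    and perm: "permutes_conjugates X E H" and EH: "E <#> H \<noteq> X"
  obtains E1 where "subgroup E1 G" "E \<subseteq> E1" "E1 \<subseteq> X" "E1 <#> H \<noteq> X"
    "\<And>x. x \<in> X \<Longrightarrow> normalizes (conjugate x H) E1"
proof -
  define F where "F = {E1. subgroup E1 G \<and> E \<subseteq> E1 \<and> E1 \<subseteq> X \<and> permutes_conjugates X E1 H \<and> E1 <#> H \<noteq> X}"
  have "E \<in> F" using assms by (auto simp: F_def)
  then have "F \<noteq> {}" "F \<subseteq> Pow (carrier G)" by (auto simp: F_def dest: subgroup.subset)
  then obtain E1 where E1: "E1 \<in> F" and max: "\<And>E2. E2 \<in> F \<Longrightarrow> card E2 \<le> card E1"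
    using obtain_max_card by blast
  then have E1s: "subgroup E1 G" "E \<subseteq> E1" "E1 \<subseteq> X" "permutes_conjugates X E1 H" "E1 <#> H \<noteq> X"
    by (auto simp: F_def)
  have HG: "H \<subseteq> carrier G" using H subgroup.subset by blast
  have "normalizes (conjugate x H) E1" if x: "x \<in> X" for x
    unfolding normalizes_iff_conjugate
  proof
    fix b assume b: "b \<in> conjugate x H"
    have xG: "x \<in> carrier G" using x X subgroup_carrier by blast
    let ?H = "conjugate x H" and ?E2 = "generate G (E1 \<union> conjugate b E1)"
    have Hx: "subgroup ?H G" "?H \<subseteq> X"
      using conjugate_subgroup[OF H(1) xG] conjugate_subset[OF X x H(2)] by auto
    have bX: "b \<in> X" and bG: "b \<in> carrier G" using b Hx subgroup_carrier[OF X] by auto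
    have bE: "subgroup (conjugate b E1) G" "conjugate b E1 \<subseteq> X"
      using conjugate_subgroup[OF E1s(1) bG] conjugate_subset[OF X bX E1s(3)] by auto
    have E2: "subgroup ?E2 G" "?E2 \<subseteq> X"
      using bE E1s(3) subgroup.subset[OF bE(1)] subgroup.subset[OF E1s(1)]
      by (auto intro!: generate_is_subgroup generate_subgroup_incl[OF _ X])
    have E2E1: "E1 \<subseteq> ?E2" "conjugate b E1 \<subseteq> ?E2" by (auto intro: generate.incl)
    have perm2: "permutes_conjugates X ?E2 H"
      unfolding permutes_conjugates_def
    proof
      fix y assume y: "y \<in> X"
      have yG: "y \<in> carrier G" using y X subgroup_carrier by blast
      have iy: "inv b \<otimes> y \<in> X" using bX y X by (simp add: subgroup.m_closed subgroup.m_inv_closed)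
      let ?K = "conjugate (inv b \<otimes> y) H"
      have K: "?K \<subseteq> carrier G" using conjugate_subset[OF X iy H(2)] subgroup.subset[OF X] by blast
      have cK: "conjugate b ?K = conjugate y H" using bG yG HG by (simp add: conjugate_conjugate)
      have "conjugate b (E1 <#> ?K) = conjugate b (?K <#> E1)"
        using E1s(4) iy by (simp add: permutes_conjugates_def)
      then have "conjugate b E1 <#> conjugate y H = conjugate y H <#> conjugate b E1"
        using bG K subgroup.subset[OF E1s(1)] by (simp add: conjugate_set_mult cK)
      moreover have "E1 <#> conjugate y H = conjugate y H <#> E1"
        using E1s(4) y by (simp add: permutes_conjugates_def)
      ultimately show "?E2 <#> conjugate y H = conjugate y H <#> ?E2"
        using permutes_generate[OF conjugate_subgroup[OF H(1) yG] E1s(1) _ bE(1)] by blast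
    qed
    have "?E2 <#> H \<noteq> X"
    proof
      assume "?E2 <#> H = X"
      then have X2: "?E2 <#> ?H = X" by (rule factorization_conjugate[OF E2 H X _ x])
      have P: "E1 <#> ?H = ?H <#> E1" using E1s(4) x by (simp add: permutes_conjugates_def)
      then have L: "subgroup (E1 <#> ?H) G" by (intro subgroup_permI[OF E1s(1) Hx(1)]) simp
      have HL: "?H \<subseteq> E1 <#> ?H" "E1 \<subseteq> E1 <#> ?H" using subset_set_mult[OF E1s(1) Hx(1)] by auto
      have "conjugate b E1 \<subseteq> E1 <#> ?H" using conjugate_subset[OF L _ HL(2)] b HL(1) by blast
      then have "?E2 \<subseteq> E1 <#> ?H" using HL by (intro generate_subgroup_incl[OF _ L]) auto
      then have "X \<subseteq> E1 <#> ?H" using X2 set_mult_subset[OF L _ HL(1)] by blast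
      then have "E1 <#> ?H = X" using set_mult_subset[OF X E1s(3) Hx(2)] by blast
      then have "E1 <#> conjugate (inv x) ?H = X"
        using x by (intro factorization_conjugate[OF E1s(1,3) Hx X]) (simp_all add: subgroup.m_inv_closed[OF X])
      then show False using E1s(5) xG HG by (simp add: conjugate_conjugate conjugate_one)
    qed
    then have "?E2 \<in> F" using E2 perm2 E1s(2) E2E1(1) by (auto simp: F_def)
    then have "card ?E2 \<le> card E1" by (rule max)
    then have "E1 = ?E2" using card_seteq[OF subgroup_finite[OF E2(1)] E2E1(1)] by simp
    then show "conjugate b E1 \<subseteq> E1" using E2E1(2) by simp
  qed
  then show ?thesis using that E1s by blast
qed

text \<open>E and H are replaced by their intersections with N. The point is permutability: for L =
  E H^x, the subgroups E \<inter> N and H^x \<inter> N have in L \<inter> N indices that are an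
  s-number and an s'-number respectively, so their product is L \<inter> N in either order.\<close>

lemma all_embedded_normal:
  assumes X: "subgroup X G" and W: "all_embedded \<sigma> X"
    and N: "subgroup N G" "N \<subseteq> X" "normalizes X N"
  shows "all_embedded \<sigma> N"
  unfolding all_embedded_def
proof (intro allI impI)
  fix A assume A: "subgroup A G" "A \<subseteq> N"
  then have "A \<subseteq> X" using N by blast
  then obtain E where E: "subgroup E G" "A \<subseteq> E" "E \<subseteq> X"
    and idx: "\<And>s. s \<in> \<sigma> \<Longrightarrow> \<not> pi_number (- s) (card A) \<Longrightarrow> pi_number (- s) (card E div card A)"
    and perm: "\<And>s. s \<in> \<sigma> \<Longrightarrow> \<exists>H. hall_in s X H \<and> permutes_conjugates X E H"
    using all_embeddedE[OF W A(1)] by metis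
  have EN: "subgroup (E \<inter> N) G" by (rule subgroups_Inter_pair[OF E(1) N(1)])
  show "\<exists>E. subgroup E G \<and> A \<subseteq> E \<and> E \<subseteq> N \<and>
        (\<forall>s\<in>\<sigma>. \<not> pi_number (- s) (card A) \<longrightarrow> pi_number (- s) (card E div card A)) \<and>
        (\<forall>s\<in>\<sigma>. \<exists>H. hall_in s N H \<and> permutes_conjugates N E H)"
  proof (rule exI[of _ "E \<inter> N"], intro conjI ballI impI EN)
    show "A \<subseteq> E \<inter> N" "E \<inter> N \<subseteq> N" using A E by auto
    fix s assume s: "s \<in> \<sigma>"
    show "pi_number (- s) (card (E \<inter> N) div card A)" if "\<not> pi_number (- s) (card A)"
    proof -
      have "card E div card A = (card E div card (E \<inter> N)) * (card (E \<inter> N) div card A)"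
        using A E by (intro card_tower EN) auto
      then show ?thesis using idx[OF s that] by simp
    qed
    obtain H where H: "hall_in s X H" "permutes_conjugates X E H" using perm[OF s] by blast
    then have Hs: "subgroup H G" "H \<subseteq> X" "pi_number s (card H)" "pi_number (- s) (card X div card H)"
      by (auto simp: hall_in_def)
    have HN: "subgroup (H \<inter> N) G" by (rule subgroups_Inter_pair[OF Hs(1) N(1)])
    have "pi_number s (card (H \<inter> N))"
      using pi_number_dvd[OF Hs(3)] card_dvd[OF HN Hs(1)] by auto
    moreover have "pi_number (- s) (card N div card (H \<inter> N))"
      using pi_number_dvd[OF Hs(4)] index_Int_dvd[OF X Hs(1,2) N(1,2)] normalizes_subset[OF N(3) Hs(2)]
      by blast
    ultimately have hall: "hall_in s N (H \<inter> N)" using HN by (auto simp: hall_in_def)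
    have "permutes_conjugates N (E \<inter> N) (H \<inter> N)"
      unfolding permutes_conjugates_def
    proof
      fix x assume x: "x \<in> N"
      then have xX: "x \<in> X" and xG: "x \<in> carrier G" using N subgroup_carrier by auto
      let ?H = "conjugate x H" and ?L = "E <#> conjugate x H"
      have Hx: "subgroup ?H G" "?H \<subseteq> X"
        using conjugate_subgroup[OF Hs(1) xG] conjugate_subset[OF X xX Hs(2)] by auto
      have cHN: "conjugate x (H \<inter> N) = ?H \<inter> N"
      proof
        show "conjugate x (H \<inter> N) \<subseteq> ?H \<inter> N"
          using conjugate_mono[of "H \<inter> N" H x] conjugate_subset[OF N(1) x, of "H \<inter> N"] by auto
        show "?H \<inter> N \<subseteq> conjugate x (H \<inter> N)"
        proof
          fix z assume z: "z \<in> ?H \<inter> N"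
          then obtain y where y: "y \<in> H" "z = x \<otimes> y \<otimes> inv x" by (auto elim: conjugateE)
          have "y = inv x \<otimes> z \<otimes> x" using y xG Hs(1) subgroup_carrier[of H y] by (simp add: m_assoc)
          then have "y \<in> N" using z x N(1) by (simp add: subgroup.m_closed subgroup.m_inv_closed)
          then show "z \<in> conjugate x (H \<inter> N)" using y by (auto intro: conjugate_mem)
        qed
      qed
      have P: "E <#> ?H = ?H <#> E" using H(2) xX by (simp add: permutes_conjugates_def)
      then have L: "subgroup ?L G" by (intro subgroup_permI[OF E(1) Hx(1)]) simp
      have LE: "E \<subseteq> ?L" "?H \<subseteq> ?L" using subset_set_mult[OF E(1) Hx(1)] by auto
      have LX: "?L \<subseteq> X" using set_mult_subset[OF X E(3) Hx(2)] .
      have LN: "subgroup (?L \<inter> N) G" by (rule subgroups_Inter_pair[OF L N(1)])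
      have nLN: "normalizes ?L (?L \<inter> N)"
        using normalizes_Int[OF normalizes_self[OF L] normalizes_subset[OF N(3) LX]] .
      have HxN: "subgroup (?H \<inter> N) G" by (rule subgroups_Inter_pair[OF Hx(1) N(1)])
      have e1: "E \<inter> (?L \<inter> N) = E \<inter> N" "?H \<inter> (?L \<inter> N) = ?H \<inter> N" using LE by auto
      have "card (?L \<inter> N) div card (E \<inter> N) dvd card ?L div card E"
        using index_Int_dvd[OF L E(1) LE(1) LN _ normalizes_subset[OF nLN LE(1)]] e1 by simp
      moreover have "card ?L div card E = card ?H div card (E \<inter> ?H)"
        by (rule card_set_mult_div[OF E(1) Hx(1) L])
      moreover have "card ?H div card (E \<inter> ?H) dvd card ?H"
      proof -
        have "subgroup (E \<inter> ?H) G" by (rule subgroups_Inter_pair[OF E(1) Hx(1)])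
        from card_mult_div[OF this Hx(1)] show ?thesis using dvd_triv_right[of "card ?H div card (E \<inter> ?H)" "card (E \<inter> ?H)"] by simp
      qed
      moreover have "card ?H = card H" using conjugate_card[OF _ xG] subgroup.subset[OF Hs(1)] by simp
      ultimately have 1: "pi_number s (card (?L \<inter> N) div card (E \<inter> N))"
        using pi_number_dvd[OF Hs(3)] dvd_trans by fastforce
      have "card (?L \<inter> N) div card (?H \<inter> N) dvd card ?L div card ?H"
        using index_Int_dvd[OF L Hx(1) LE(2) LN _ normalizes_subset[OF nLN LE(2)]] e1 by simp
      moreover have "card ?L div card ?H dvd card X div card ?H"
        unfolding card_tower[OF Hx(1) L X LE(2) LX] by (rule dvd_triv_right)
      ultimately have 2: "pi_number (- s) (card (?L \<inter> N) div card (?H \<inter> N))"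
        using pi_number_dvd[OF Hs(4)] \<open>card ?H = card H\<close> dvd_trans by fastforce
      have cop: "coprime (card (?L \<inter> N) div card (E \<inter> N)) (card (?L \<inter> N) div card (?H \<inter> N))"
        by (rule pi_number_coprime_compl[OF 1 2])
      have "(E \<inter> N) <#> (?H \<inter> N) = ?L \<inter> N"
        by (rule set_mult_coprime_index[OF EN HxN LN _ _ cop]) (use LE in auto)
      moreover have "(?H \<inter> N) <#> (E \<inter> N) = ?L \<inter> N"
        by (rule set_mult_coprime_index[OF HxN EN LN]) (use LE cop in \<open>auto simp: coprime_commute\<close>)
      ultimately show "(E \<inter> N) <#> conjugate x (H \<inter> N) = conjugate x (H \<inter> N) <#> (E \<inter> N)"
        unfolding cHN by simp
    qed
    then show "\<exists>H. hall_in s N H \<and> permutes_conjugates N (E \<inter> N) H" using hall by blast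
  qed
qed

text \<open>The largest normal subgroup with \<open>|M : Z|\<close> an \<open>s\<close>-number is characteristic.\<close>

lemma normal_pi_core:
  assumes X: "subgroup X G" and N: "subgroup N G" "N \<subseteq> X" "normalizes X N"
    and Z: "subgroup Z G" "Z \<subseteq> N" "normalizes X Z"
  obtains M where "subgroup M G" "Z \<subseteq> M" "M \<subseteq> N" "normalizes X M" "pi_number s (card M div card Z)"
    "\<And>L. subgroup L G \<Longrightarrow> Z \<subseteq> L \<Longrightarrow> L \<subseteq> N \<Longrightarrow> normalizes N L \<Longrightarrow> pi_number s (card L div card Z) \<Longrightarrow> L \<subseteq> M"
proof -
  define F where "F = {M. subgroup M G \<and> Z \<subseteq> M \<and> M \<subseteq> N \<and> normalizes N M \<and> pi_number s (card M div card Z)}"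
  have "Z \<in> F" using Z normalizes_subset[OF Z(3) N(2)] card_pos[OF Z(1)] by (simp add: F_def)
  then have "F \<noteq> {}" "F \<subseteq> Pow (carrier G)" by (auto simp: F_def dest: subgroup.subset)
  then obtain M where M: "M \<in> F" and max: "\<And>M'. M' \<in> F \<Longrightarrow> card M' \<le> card M"
    using obtain_max_card by blast
  have Ms: "subgroup M G" "Z \<subseteq> M" "M \<subseteq> N" "normalizes N M" "pi_number s (card M div card Z)"
    using M by (auto simp: F_def)
  \<comment> \<open>|M M' : Z| = |M' : M \<inter> M'| |M : Z| is again an s-number, so a member of
    largest order absorbs every other one.\<close>
  have contains: "M' \<subseteq> M" if "M' \<in> F" for M'
  proof -
    have M': "subgroup M' G" "Z \<subseteq> M'" "M' \<subseteq> N" "normalizes N M'" "pi_number s (card M' div card Z)"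
      using that by (auto simp: F_def)
    have MM: "subgroup (M <#> M') G"
      using normalizes_subgroup_mult[OF M'(1) Ms(1) normalizes_subset[OF Ms(4) M'(3)]] .
    have I: "subgroup (M \<inter> M') G" by (rule subgroups_Inter_pair[OF Ms(1) M'(1)])
    have sub: "M \<subseteq> M <#> M'" "M' \<subseteq> M <#> M'" using subset_set_mult[OF Ms(1) M'(1)] by auto
    have "card (M <#> M') div card Z = (card (M <#> M') div card M) * (card M div card Z)"
      using card_tower[OF Z(1) Ms(1) MM Ms(2) sub(1)] .
    moreover have "card (M <#> M') div card M = card M' div card (M \<inter> M')"
      by (rule card_set_mult_div[OF Ms(1) M'(1) MM])
    moreover have "card M' div card Z = (card M' div card (M \<inter> M')) * (card (M \<inter> M') div card Z)"
      using card_tower[OF Z(1) I M'(1)] Ms(2) M'(2) by auto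
    ultimately have "pi_number s (card (M <#> M') div card Z)" using Ms(5) M'(5) by simp
    moreover have "normalizes N (M <#> M')"
      unfolding normalizes_iff_conjugate
    proof
      fix x assume x: "x \<in> N"
      then have xG: "x \<in> carrier G" using subgroup_carrier N by blast
      have "conjugate x (M <#> M') = conjugate x M <#> conjugate x M'"
        by (rule conjugate_set_mult[OF xG subgroup.subset[OF Ms(1)] subgroup.subset[OF M'(1)]])
      also have "\<dots> \<subseteq> M <#> M'"
        using Ms(4) M'(4) x by (intro mono_set_mult) (auto simp: normalizes_iff_conjugate)
      finally show "conjugate x (M <#> M') \<subseteq> M <#> M'" .
    qed
    ultimately have "M <#> M' \<in> F"
      using MM Ms(2) sub set_mult_subset[OF N(1) Ms(3) M'(3)] by (auto simp: F_def)
    then have "M = M <#> M'"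
      using max sub(1) subgroup_finite[OF MM] card_seteq by blast
    then show ?thesis using sub(2) by simp
  qed
  \<comment> \<open>Conjugation by an element of X preserves N, Z and the order, so it carries M to
    another member of the family, which is contained in M.\<close>
  have "normalizes X M" unfolding normalizes_iff_conjugate
  proof
    fix x assume x: "x \<in> X"
    then have xG: "x \<in> carrier G" using subgroup_carrier X by blast
    have MG: "M \<subseteq> carrier G" using subgroup.subset Ms(1) by blast
    have "subgroup (conjugate x M) G" by (rule conjugate_subgroup[OF Ms(1) xG])
    moreover have "Z \<subseteq> conjugate x M"
      using conjugate_mono[OF Ms(2), of x] normalizes_conjugate_eq[OF X subgroup.subset[OF Z(1)] Z(3) x] by simp
    moreover have "conjugate x M \<subseteq> N"
      using conjugate_mono[OF Ms(3), of x] normalizes_conjugate_eq[OF X subgroup.subset[OF N(1)] N(3) x] by simp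
    moreover have "normalizes N (conjugate x M)" unfolding normalizes_iff_conjugate
    proof
      fix y assume y: "y \<in> N"
      then have yG: "y \<in> carrier G" using subgroup_carrier N by blast
      have ix: "inv x \<in> X" by (rule subgroup.m_inv_closed[OF X x])
      have y': "inv x \<otimes> y \<otimes> x \<in> N" using normalizesD[OF N(3) ix y] xG by simp
      have "conjugate y (conjugate x M) = conjugate x (conjugate (inv x \<otimes> y \<otimes> x) M)"
        using xG yG MG by (simp add: conjugate_conjugate m_assoc)
      also have "\<dots> \<subseteq> conjugate x M"
        using Ms(4) y' by (intro conjugate_mono) (simp add: normalizes_iff_conjugate)
      finally show "conjugate y (conjugate x M) \<subseteq> conjugate x M" .
    qed
    moreover have "card (conjugate x M) = card M" by (rule conjugate_card[OF MG xG])
    ultimately have "conjugate x M \<in> F" using Ms(5) by (simp add: F_def)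
    then show "conjugate x M \<subseteq> M" by (rule contains)
  qed
  moreover have "L \<subseteq> M" if "subgroup L G" "Z \<subseteq> L" "L \<subseteq> N" "normalizes N L" "pi_number s (card L div card Z)" for L
    by (rule contains) (use that in \<open>simp add: F_def\<close>)
  ultimately show ?thesis by (intro that[OF Ms(1,2,3) _ Ms(5)])
qed

end

section \<open>Normal sections and normal s-subgroups under the embedding hypothesis\<close>

context finite_group begin

lemma quotient_prime_subgroup:
  assumes X: "subgroup X G" and Z: "subgroup Z G" "Z \<subseteq> X" "normalizes X Z"
    and p: "prime p" "p dvd card X div card Z"
  obtains A where "subgroup A G" "Z \<subseteq> A" "A \<subseteq> X" "card A = p * card Z"
proof -
  let ?X = "G\<lparr>carrier := X\<rparr>"
  interpret N: normal Z ?X using normal_iff_normalizes[OF X Z(1,2)] Z(3) by simp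
  interpret Q: finite_group "?X Mod Z"
    using N.factorgroup_is_group subgroup_finite[OF X]
    by (simp add: finite_group_def finite_group_axioms_def carrier_FactGroup)
  have c: "card (carrier (?X Mod Z)) = card X div card Z"
    using card_rcosets[OF Z(1) X Z(2)] by (simp add: FactGroup_def)
  obtain x where x: "x \<in> carrier (?X Mod Z)" "group.ord (?X Mod Z) x = p"
    using Q.cauchy[OF Q.subgroup_self p(1)] p(2) c by auto
  let ?A = "generate (?X Mod Z) {x}"
  have A: "subgroup ?A (?X Mod Z)" "card ?A = p"
    using x Q.generate_pow_card[of x] by (auto intro: Q.generate_is_subgroup)
  have UX: "subgroup (\<Union>?A) ?X" by (rule N.factgroup_subgroup_union_subgroup[OF A(1)])
  have UG: "subgroup (\<Union>?A) G" by (rule incl_subgroup[OF X UX])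
  have "Z \<in> ?A" using subgroup.one_closed[OF A(1)] by simp
  then have ZU: "Z \<subseteq> \<Union>?A" by blast
  have UsX: "\<Union>?A \<subseteq> X" using subgroup.subset[OF UX] by simp
  have "card (rcosets\<^bsub>G\<lparr>carrier := \<Union>?A\<rparr>\<^esub> Z) = p"
    using N.factgroup_subgroup_union_factor[OF A(1)] A(2) by simp
  then have "card (\<Union>?A) div card Z = p" using card_rcosets[OF Z(1) UG ZU] by simp
  then have "card (\<Union>?A) = p * card Z" using card_mult_div[OF Z(1) UG ZU] by (simp add: mult.commute)
  then show ?thesis using that UG ZU UsX by blast
qed

text \<open>The transfer result for X/Z, pulled back to subgroups between Z and X so that the
  arguments that use it stay inside G.\<close>

lemma quotient_smallest_prime:
  assumes X: "subgroup X G" and Z: "subgroup Z G" "Z \<subseteq> X" "normalizes X Z"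
    and p: "prime p" "p dvd card X div card Z" "\<not> p dvd (card X div card Z) div p"
    and least: "\<And>q. prime q \<Longrightarrow> q dvd card X div card Z \<Longrightarrow> p \<le> q"
  obtains K where "subgroup K G" "Z \<subseteq> K" "K \<subseteq> X" "normalizes X K" "K \<noteq> X"
    "K = Z \<Longrightarrow> card X div card Z = p"
proof -
  let ?X = "G\<lparr>carrier := X\<rparr>"
  interpret N: normal Z ?X using normal_iff_normalizes[OF X Z(1,2)] Z(3) by simp
  interpret Q: finite_group "?X Mod Z"
    using N.factorgroup_is_group subgroup_finite[OF X]
    by (simp add: finite_group_def finite_group_axioms_def carrier_FactGroup)
  have c: "card (carrier (?X Mod Z)) = card X div card Z"
    using card_rcosets[OF Z(1) X Z(2)] by (simp add: FactGroup_def)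
  obtain K where K: "K \<lhd> ?X Mod Z" "K \<noteq> carrier (?X Mod Z)"
    "K = {\<one>\<^bsub>?X Mod Z\<^esub>} \<Longrightarrow> card (carrier (?X Mod Z)) = p"
    using Q.smallest_prime_normal_subgroup[of p] p least c by auto
  have Ks: "subgroup K (?X Mod Z)" using K(1) by (rule normal_imp_subgroup)
  have U: "\<Union>K \<lhd> ?X" by (rule N.factgroup_subgroup_union_normal[OF K(1)])
  have UX: "subgroup (\<Union>K) ?X" using U by (rule normal_imp_subgroup)
  have UG: "subgroup (\<Union>K) G" by (rule incl_subgroup[OF X UX])
  have "Z \<in> K" using subgroup.one_closed[OF Ks] by simp
  then have ZU: "Z \<subseteq> \<Union>K" by blast
  have UsX: "\<Union>K \<subseteq> X" using subgroup.subset[OF UX] by simp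
  have nrm: "normalizes X (\<Union>K)" using normal_iff_normalizes[OF X UG UsX] U by simp
  have fac: "K = rcosets\<^bsub>G\<lparr>carrier := \<Union>K\<rparr>\<^esub> Z"
    using N.factgroup_subgroup_union_factor[OF Ks] by simp
  have "\<Union>K \<noteq> X"
  proof
    assume "\<Union>K = X"
    then have "K = carrier (?X Mod Z)" using fac by (simp add: FactGroup_def)
    then show False using K(2) by simp
  qed
  moreover have "card X div card Z = p" if "\<Union>K = Z"
  proof -
    have "card K = card (\<Union>K) div card Z" using card_rcosets[OF Z(1) UG ZU] fac by simp
    then have "card K = 1" using that card_pos[OF Z(1)] by simp
    then obtain k where "K = {k}" by (auto simp: card_1_singleton_iff)
    then have "K = {\<one>\<^bsub>?X Mod Z\<^esub>}" using \<open>Z \<in> K\<close> by simp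
    then show ?thesis using K(3) c by simp
  qed
  ultimately show ?thesis using that UG ZU UsX nrm by blast
qed

text \<open>
  Above a maximal normal subgroup \<open>Z\<close> of \<open>X\<close>, Kegel's argument forces the subgroup \<open>E\<close> that embeds
  a given \<open>A > Z\<close> to be \<open>X\<close> itself. Taking \<open>|A : Z|\<close> to be the smallest prime divisor \<open>p\<close> of
  \<open>|X : Z|\<close>, one finds that \<open>p\<close> divides \<open>|X : Z|\<close> only once, and \<open>X/Z\<close> has a normal \<open>p\<close>-complement.
\<close>

lemma all_embedded_pi_factor:
  assumes cover: "\<And>p. prime p \<Longrightarrow> \<exists>s\<in>\<sigma>. p \<in> s" and disj: "\<And>s t. s \<in> \<sigma> \<Longrightarrow> t \<in> \<sigma> \<Longrightarrow> s \<noteq> t \<Longrightarrow> s \<inter> t = {}"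
    and "subgroup X G" "all_embedded \<sigma> X" "subgroup Z G" "Z \<subseteq> X" "Z \<noteq> X" "normalizes X Z"
  shows "\<exists>s\<in>\<sigma>. \<exists>L. subgroup L G \<and> Z \<subseteq> L \<and> L \<subseteq> X \<and> Z \<noteq> L \<and> normalizes X L \<and>
    pi_number s (card L div card Z)"
  using assms(3-)
proof (induction "card X" arbitrary: X rule: less_induct)
  case less
  note X = less.prems(1) and W = less.prems(2) and Z = less.prems(3,4,6) and ZX = less.prems(5)
  show ?case
  proof (cases "\<exists>N. subgroup N G \<and> Z \<subseteq> N \<and> N \<subseteq> X \<and> normalizes X N \<and> N \<noteq> Z \<and> N \<noteq> X")
    case True
    then obtain N where N: "subgroup N G" "Z \<subseteq> N" "N \<subseteq> X" "normalizes X N" "N \<noteq> Z" "N \<noteq> X" by blast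
    have "card N < card X" using N subgroup_finite[OF X] by (simp add: psubset_card_mono psubsetI)
    moreover have "all_embedded \<sigma> N" by (rule all_embedded_normal[OF X W N(1,3,4)])
    moreover have "normalizes N Z" by (rule normalizes_subset[OF Z(3) N(3)])
    ultimately obtain s L where L: "s \<in> \<sigma>" "subgroup L G" "Z \<subseteq> L" "L \<subseteq> N" "Z \<noteq> L" "normalizes N L"
      "pi_number s (card L div card Z)"
      using less.hyps[OF _ N(1) _ Z(1) N(2)] N(5) by blast
    \<comment> \<open>\<open>L\<close> is normal in \<open>N\<close> only. The largest normal
      subgroup of \<open>N\<close> whose index over \<open>Z\<close> is an s-number contains
      \<open>L\<close> and is invariant under \<open>X\<close>.\<close>
    obtain M where M: "subgroup M G" "L \<subseteq> M" "M \<subseteq> N" "normalizes X M" "pi_number s (card M div card Z)"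
      using normal_pi_core[OF X N(1,3,4) Z(1) N(2) Z(3), of s] L by metis
    have "Z \<subseteq> M" "M \<subseteq> X" "Z \<noteq> M" using L(3,5) M(2,3) N(3) by auto
    then show ?thesis using M(1,4,5) L(1) by blast
  next
    case False
    then have max: "N = Z \<or> N = X" if "subgroup N G" "Z \<subseteq> N" "N \<subseteq> X" "normalizes X N" for N
      using that by blast
    show ?thesis
    proof (rule ccontr)
      assume no: "\<not> ?thesis"
      let ?i = "card X div card Z"
      have nopi: "\<not> pi_number s ?i" if "s \<in> \<sigma>" for s
      proof
        assume "pi_number s ?i"
        then show False using no that X Z(2) ZX normalizes_self[OF X] by blast
      qed
      have ipos: "?i > 0" by (rule card_div_pos[OF Z(1) X Z(2)])
      have trivial: "E = X" if E: "subgroup E G" "Z \<subseteq> E" "E \<subseteq> X" "E \<noteq> Z"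
        and perm: "\<And>s. s \<in> \<sigma> \<Longrightarrow> \<exists>H. hall_in s X H \<and> permutes_conjugates X E H" for E
      proof (rule ccontr)
        assume EX: "E \<noteq> X"
        \<comment> \<open>If EH were proper, Kegel's E1 would be normalized by Z and by all
          conjugates of H. These generate a normal subgroup of X that differs from Z, since p
          divides |X:Z| but not |X:H|; so it is X, and E1 is normal and equal to X, contrary to E1 H
          \<noteq> X.\<close>
        have full: "E <#> H = X"
          if s: "s \<in> \<sigma>" and H: "hall_in s X H" "permutes_conjugates X E H" and p: "prime p" "p dvd ?i" "p \<in> s"
          for s H p
        proof (rule ccontr)
          assume "E <#> H \<noteq> X"
          have Hs: "subgroup H G" "H \<subseteq> X" "pi_number (- s) (card X div card H)"
            using H(1) by (auto simp: hall_in_def)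
          obtain E1 where E1: "subgroup E1 G" "E \<subseteq> E1" "E1 \<subseteq> X" "E1 <#> H \<noteq> X"
            "\<And>x. x \<in> X \<Longrightarrow> normalizes (conjugate x H) E1"
            using kegel_permutes[OF X E(1,3) Hs(1,2) H(2) \<open>E <#> H \<noteq> X\<close>] by metis
          let ?S = "Z \<union> (\<Union>x\<in>X. conjugate x H)"
          let ?T = "generate G ?S"
          have SX: "?S \<subseteq> X" using Z(2) conjugate_subset[OF X _ Hs(2)] by blast
          then have SG: "?S \<subseteq> carrier G" using subgroup.subset[OF X] by blast
          have T: "subgroup ?T G" "?T \<subseteq> X"
            using generate_is_subgroup[OF SG] generate_subgroup_incl[OF SX X] by auto
          have "normalizes X ?T"
          proof (rule generate_normalizes[OF X SG])
            fix x y assume x: "x \<in> X" and y: "y \<in> ?S"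
            have xG: "x \<in> carrier G" by (rule subgroup_carrier[OF X x])
            show "x \<otimes> y \<otimes> inv x \<in> ?S"
            proof (cases "y \<in> Z")
              case True then show ?thesis using normalizesD[OF Z(3) x] by simp
            next
              case False
              then obtain u where u: "u \<in> X" "y \<in> conjugate u H" using y by blast
              have "x \<otimes> y \<otimes> inv x \<in> conjugate x (conjugate u H)" using u(2) by (rule conjugate_mem)
              also have "\<dots> = conjugate (x \<otimes> u) H"
                using xG subgroup_carrier[OF X u(1)] subgroup.subset[OF Hs(1)] by (rule conjugate_conjugate)
              finally show ?thesis using subgroup.m_closed[OF X x u(1)] by blast
            qed
          qed
          moreover have ZT: "Z \<subseteq> ?T" by (auto intro: generate.incl)
          moreover have "?T \<noteq> Z"
          proof
            assume TZ: "?T = Z"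
            have "H = conjugate \<one> H" using conjugate_one[OF subgroup.subset[OF Hs(1)]] by simp
            then have "H \<subseteq> ?S" using subgroup.one_closed[OF X] by blast
            then have "H \<subseteq> ?T" by (auto intro: generate.incl)
            then have HZ: "H \<subseteq> Z" using TZ by simp
            have "card X div card H = ?i * (card Z div card H)"
              by (rule card_tower[OF Hs(1) Z(1) X HZ Z(2)])
            then have "p dvd card X div card H" using p(2) by simp
            then show False using pi_number_prime[OF Hs(3) p(1)] p(3) by simp
          qed
          ultimately have TX: "?T = X" using max T by blast
          have NE: "subgroup {x \<in> carrier G. normalizes {x} E1} G" by (rule normalizer_subgroup[OF E1(1)])
          have "?S \<subseteq> {x \<in> carrier G. normalizes {x} E1}"
          proof
            fix y assume y: "y \<in> ?S"
            have yG: "y \<in> carrier G" using y SG by blast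
            have "normalizes {y} E1"
            proof (cases "y \<in> Z")
              case True
              then have "y \<in> E1" using E(2) E1(2) by blast
              then show ?thesis using normalizes_subset[OF normalizes_self[OF E1(1)], of "{y}"] by simp
            next
              case False
              then obtain u where u: "u \<in> X" "y \<in> conjugate u H" using y by blast
              then show ?thesis using normalizes_subset[OF E1(5)[OF u(1)], of "{y}"] by simp
            qed
            then show "y \<in> {x \<in> carrier G. normalizes {x} E1}" using yG by simp
          qed
          then have "X \<subseteq> {x \<in> carrier G. normalizes {x} E1}"
            using generate_subgroup_incl[OF _ NE] TX by blast
          then have "normalizes X E1" by (auto simp: normalizes_def)
          moreover have "Z \<subseteq> E1" "E1 \<noteq> Z" using E(2,4) E1(2) by auto
          ultimately have "E1 = X" using max E1(1,3) by blast
          moreover have "X <#> H = X"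
            using set_mult_subset[OF X subset_refl Hs(2)] subset_set_mult(1)[OF X Hs(1)] by blast
          ultimately show False using E1(4) by simp
        qed
        have idx: "pi_number s (card X div card E)"
          if s: "s \<in> \<sigma>" and p: "prime p" "p dvd ?i" "p \<in> s" for s p
        proof -
          obtain H where H: "hall_in s X H" "permutes_conjugates X E H" using perm[OF s] by blast
          have Hs: "subgroup H G" "pi_number s (card H)" using H(1) by (auto simp: hall_in_def)
          have EH: "E <#> H = X" by (rule full[OF s H p])
          have "card X div card E = card H div card (E \<inter> H)"
            using card_set_mult_div[OF E(1) Hs(1)] X EH by simp
          moreover have "card (E \<inter> H) * (card H div card (E \<inter> H)) = card H"
            by (rule card_mult_div[OF subgroups_Inter_pair[OF E(1) Hs(1)] Hs(1)]) simp
          ultimately have "card (E \<inter> H) * (card X div card E) = card H" by simp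
          then show ?thesis using Hs(2) by (metis pi_number_mult)
        qed
        have "?i \<noteq> 1" using card_eqD[OF Z(1) X Z(2)] ZX by blast
        \<comment> \<open>At least two blocks meet the primes of |X:Z|, since this index is not an
          s-number for any single block s. So |X:E| is a number for two disjoint blocks and equals
          1.\<close>
        then obtain p1 where p1: "prime p1" "p1 dvd ?i" using prime_factor_nat by blast
        obtain s1 where s1: "s1 \<in> \<sigma>" "p1 \<in> s1" using cover[OF p1(1)] by blast
        obtain p2 where p2: "prime p2" "p2 dvd ?i" "p2 \<notin> s1"
          using nopi[OF s1(1)] pi_numberI[OF ipos] by blast
        obtain s2 where s2: "s2 \<in> \<sigma>" "p2 \<in> s2" using cover[OF p2(1)] by blast
        have "s1 \<inter> s2 = {}" using disj[OF s1(1) s2(1)] s2(2) p2(3) by blast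
        then have "coprime (card X div card E) (card X div card E)"
          using pi_number_coprime[OF idx[OF s1(1) p1 s1(2)] idx[OF s2(1) p2(1,2) s2(2)]] by simp
        then have "card X div card E = 1" by simp
        then show False using card_eqD[OF E(1) X E(3)] EX by simp
      qed
      have "?i \<noteq> 1" using card_eqD[OF Z(1) X Z(2)] ZX by blast
      then have ex: "\<exists>p. prime p \<and> p dvd ?i" using prime_factor_nat by blast
      define p where "p = (LEAST p. prime p \<and> p dvd ?i)"
      have p: "prime p" "p dvd ?i" using LeastI_ex[OF ex] by (auto simp: p_def)
      have least: "p \<le> q" if "prime q" "q dvd ?i" for q
        unfolding p_def using that by (intro Least_le) simp
      \<comment> \<open>The subgroup that embeds A will be all of X, so A has s'-index in X, and p
        divides |X:Z| exactly once, as the transfer argument requires.\<close>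
      obtain A where A: "subgroup A G" "Z \<subseteq> A" "A \<subseteq> X" "card A = p * card Z"
        by (rule quotient_prime_subgroup[OF X Z p])
      obtain s where s: "s \<in> \<sigma>" "p \<in> s" using cover[OF p(1)] by blast
      obtain E where E: "subgroup E G" "A \<subseteq> E" "E \<subseteq> X"
        "\<And>s. s \<in> \<sigma> \<Longrightarrow> \<not> pi_number (- s) (card A) \<Longrightarrow> pi_number (- s) (card E div card A)"
        "\<And>s. s \<in> \<sigma> \<Longrightarrow> \<exists>H. hall_in s X H \<and> permutes_conjugates X E H"
        using all_embeddedE[OF W A(1,3)] by metis
      have "A \<noteq> Z" using A(4) card_pos[OF Z(1)] prime_gt_1_nat[OF p(1)] by auto
      then have "E \<noteq> Z" using A(2) E(2) by blast
      then have EX: "E = X" using trivial[OF E(1) _ E(3)] E(5) A(2) E(2) by blast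
      have "\<not> pi_number (- s) (card A)"
        using pi_number_prime[of "- s" "card A" p] p(1) s(2) A(4) by auto
      then have pA: "pi_number (- s) (card X div card A)" using E(4)[OF s(1)] EX by simp
      have "card A div card Z = p" using A(4) card_pos[OF Z(1)] by simp
      then have "?i = (card X div card A) * p" using card_tower[OF Z(1) A(1) X A(2,3)] by simp
      then have "?i div p = card X div card A" using prime_gt_0_nat[OF p(1)] by simp
      then have np: "\<not> p dvd ?i div p" using pi_number_prime[OF pA p(1)] s(2) by auto
      obtain K where K: "subgroup K G" "Z \<subseteq> K" "K \<subseteq> X" "normalizes X K" "K \<noteq> X"
        "K = Z \<Longrightarrow> ?i = p"
        using quotient_smallest_prime[OF X Z p np least] by blast
      then have "K = Z" using max by blast
      then have "?i = p" by (rule K(6))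
      then show False using nopi[OF s(1)] pi_number_prime_self[OF p(1), of s] s(2) by simp
    qed
  qed
qed

text \<open>For every conjugate H^z of a Hall t-subgroup, L = E H^z is a subgroup with |L:A| an
  s'-number, whereas N is an s-group; so L \<inter> N = A \<inter> N. A suitable H^z contains g,
  which gives the first claim. For the second, x g x^-1 lies in another conjugate of H and g in A,
  so that [x,g] lies in L \<inter> N for the L of this other conjugate.\<close>

lemma normal_pi_embedding:
  assumes W: "all_embedded \<sigma> (carrier G)"
    and N: "subgroup N G" "normalizes (carrier G) N" "pi_number s (card N)"
    and t: "t \<in> \<sigma>" "s \<inter> t = {}" and s: "s \<in> \<sigma>"
    and A: "subgroup A G" "\<not> pi_number (- s) (card A)"
    and q: "prime q" "q \<in> t" and g: "g \<in> carrier G" "g [^] (q ^ k :: nat) = \<one>"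
  shows "normalizes {g} (A \<inter> N)"
    and "g \<in> A \<Longrightarrow> x \<in> N \<Longrightarrow> x \<otimes> g \<otimes> inv x \<otimes> inv g \<in> A \<inter> N"
proof -
  obtain E where E: "subgroup E G" "A \<subseteq> E"
    "\<And>s. s \<in> \<sigma> \<Longrightarrow> \<not> pi_number (- s) (card A) \<Longrightarrow> pi_number (- s) (card E div card A)"
    "\<And>s. s \<in> \<sigma> \<Longrightarrow> \<exists>H. hall_in s (carrier G) H \<and> permutes_conjugates (carrier G) E H"
    using all_embeddedE[OF W A(1) subgroup.subset[OF A(1)]] by metis
  obtain H where H0: "hall_in t (carrier G) H" "permutes_conjugates (carrier G) E H" using E(4)[OF t(1)] by blast
  have H: "subgroup H G" "pi_number t (card H)" "pi_number (- t) (card (carrier G) div card H)"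
    using H0(1) by (auto simp: hall_in_def)
  let ?C = "generate G {g}"
  have "ord g dvd q ^ k" using g pow_eq_id by blast
  then obtain j where "ord g = q ^ j" using divides_primepow_nat[OF q(1)] by blast
  then have C: "subgroup ?C G" "card ?C = q ^ j"
    using generate_pow_card[OF g(1)] g(1) by (auto intro: generate_is_subgroup)
  have "\<not> q dvd card (carrier G) div card H" using pi_number_prime[OF H(3) q(1)] q(2) by blast
  from p_subgroup_conj_into[OF C q(1) H(1) this] obtain y where
    y: "y \<in> carrier G" "\<And>u. u \<in> ?C \<Longrightarrow> y \<otimes> u \<otimes> inv y \<in> H" by blast
  have gy: "y \<otimes> g \<otimes> inv y \<in> H" using y(2)[of g] by (simp add: generate.incl)
  have L: "subgroup (E <#> conjugate z H) G" "(E <#> conjugate z H) \<inter> N = A \<inter> N"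
    "E \<subseteq> E <#> conjugate z H" "conjugate z H \<subseteq> E <#> conjugate z H"
    if z: "z \<in> carrier G" for z
  proof -
    let ?H = "conjugate z H" and ?L = "E <#> conjugate z H"
    have Hz: "subgroup ?H G" by (rule conjugate_subgroup[OF H(1) z])
    have P: "E <#> ?H = ?H <#> E" using H0(2) z by (simp add: permutes_conjugates_def)
    then show L: "subgroup ?L G" by (intro subgroup_permI[OF E(1) Hz]) simp
    show LE: "E \<subseteq> ?L" "?H \<subseteq> ?L" using subset_set_mult[OF E(1) Hz] by auto
    have AL: "A \<subseteq> ?L" using E(2) LE(1) by blast
    let ?M = "?L \<inter> N"
    have M: "subgroup ?M G" by (rule subgroups_Inter_pair[OF L N(1)])
    have nLN: "normalizes ?L ?M"
      by (rule normalizes_Int[OF normalizes_self[OF L] normalizes_subset[OF N(2) subgroup.subset[OF L]]])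
    have "card ?M div card (A \<inter> ?M) dvd card ?L div card A"
      by (rule index_Int_dvd[OF L A(1) AL M _ normalizes_subset[OF nLN AL]]) simp
    moreover have "card ?L div card A = (card ?L div card E) * (card E div card A)"
      by (rule card_tower[OF A(1) E(1) L E(2) LE(1)])
    moreover have "card ?L div card E = card ?H div card (E \<inter> ?H)"
      by (rule card_set_mult_div[OF E(1) Hz L])
    moreover have "pi_number (- s) (card ?H div card (E \<inter> ?H))"
    proof -
      have "card (E \<inter> ?H) * (card ?H div card (E \<inter> ?H)) = card ?H"
        by (rule card_mult_div[OF subgroups_Inter_pair[OF E(1) Hz] Hz]) simp
      moreover have "card ?H = card H" by (rule conjugate_card[OF subgroup.subset[OF H(1)] z])
      ultimately have "pi_number t (card ?H div card (E \<inter> ?H))" using H(2) by (metis pi_number_mult)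
      then show ?thesis by (rule pi_number_mono) (use t(2) in auto)
    qed
    moreover have "pi_number (- s) (card E div card A)" by (rule E(3)[OF s A(2)])
    ultimately have "card ?M div card (A \<inter> ?M) dvd card ?L div card A" "pi_number (- s) (card ?L div card A)"
      by simp_all
    then have 1: "pi_number (- s) (card ?M div card (A \<inter> ?M))" using pi_number_dvd by blast
    have AM: "subgroup (A \<inter> ?M) G" by (rule subgroups_Inter_pair[OF A(1) M])
    have "card ?M div card (A \<inter> ?M) dvd card N"
    proof -
      have "card (A \<inter> ?M) * (card ?M div card (A \<inter> ?M)) = card ?M" by (rule card_mult_div[OF AM M Int_lower2])
      moreover have "card ?M dvd card N" by (rule card_dvd[OF M N(1) Int_lower2])
      ultimately show ?thesis by (metis dvd_mult_right)
    qed
    then have "card ?M div card (A \<inter> ?M) = 1" using pi_number_dvd_1[OF N(3) 1] by simp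
    then have "A \<inter> ?M = ?M" by (rule card_eqD[OF AM M Int_lower2])
    then show "?M = A \<inter> N" using AL by blast
  qed
  have conjH: "x \<otimes> g \<otimes> inv x \<in> conjugate (x \<otimes> inv y) H" if x: "x \<in> carrier G" for x
  proof -
    have "x \<otimes> g \<otimes> inv x = (x \<otimes> inv y) \<otimes> (y \<otimes> g \<otimes> inv y) \<otimes> inv (x \<otimes> inv y)"
      using x y(1) g(1) by (simp add: group_simps)
    then show ?thesis using conjugate_mem[OF gy] by simp
  qed
  have "g \<in> E <#> conjugate (\<one> \<otimes> inv y) H"
    using conjH[of \<one>] L(4)[of "\<one> \<otimes> inv y"] y(1) g(1) by auto
  moreover have iy: "\<one> \<otimes> inv y \<in> carrier G" using y by simp
  ultimately show "normalizes {g} (A \<inter> N)"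
    using normalizes_Int[OF normalizes_self[OF L(1)[OF iy]] normalizes_subset[OF N(2) subgroup.subset[OF L(1)[OF iy]]]]
    unfolding L(2)[OF iy] by (auto simp: normalizes_def)
  show "x \<otimes> g \<otimes> inv x \<otimes> inv g \<in> A \<inter> N" if gA: "g \<in> A" and x: "x \<in> N"
  proof -
    have xG: "x \<in> carrier G" by (rule subgroup_carrier[OF N(1) x])
    have z: "x \<otimes> inv y \<in> carrier G" using xG y by simp
    have "x \<otimes> g \<otimes> inv x \<in> E <#> conjugate (x \<otimes> inv y) H" using conjH[OF xG] L(4)[OF z] by blast
    moreover have "inv g \<in> E <#> conjugate (x \<otimes> inv y) H"
      using subgroup.m_inv_closed[OF A(1) gA] E(2) L(3)[OF z] by blast
    ultimately have "x \<otimes> g \<otimes> inv x \<otimes> inv g \<in> E <#> conjugate (x \<otimes> inv y) H"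
      by (rule subgroup.m_closed[OF L(1)[OF z]])
    moreover have "x \<otimes> g \<otimes> inv x \<otimes> inv g \<in> N"
    proof -
      have "x \<otimes> (g \<otimes> inv x \<otimes> inv g) \<in> N"
        using normalizesD[OF N(2) g(1) subgroup.m_inv_closed[OF N(1) x]] x by (rule subgroup.m_closed[OF N(1), rotated])
      then show ?thesis using xG g(1) by (simp add: m_assoc)
    qed
    ultimately show ?thesis using L(2)[OF z] by blast
  qed
qed

text \<open>With A = <z><g> for nontrivial z in N one gets [x,g] in A \<inter> N = <z> for all x in
  N. If g fixed some x \<noteq> 1, the choice z = x would make [y,g] commute with g; then [y,g] has
  both a q-power and an s-number as exponents and is trivial, even for the \<open>y\<close> supplied
  by \<open>nc\<close>. Hence x \<mapsto> [x,g] is injective on N with values in <z>, and every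
  nontrivial z generates N.\<close>

lemma noncentral_normal_pi_prime:
  assumes W: "all_embedded \<sigma> (carrier G)"
    and N: "subgroup N G" "normalizes (carrier G) N" "pi_number s (card N)"
    and t: "t \<in> \<sigma>" "s \<inter> t = {}" and s: "s \<in> \<sigma>"
    and q: "prime q" "q \<in> t" and g: "g \<in> carrier G" "g [^] (q ^ k :: nat) = \<one>"
    and nc: "\<exists>y\<in>N. y \<otimes> g \<noteq> g \<otimes> y"
  shows "prime (card N)" and "\<And>x. x \<in> N \<Longrightarrow> x \<otimes> g = g \<otimes> x \<Longrightarrow> x = \<one>"
proof -
  note emb = normal_pi_embedding[OF W N t s _ _ q g]
  note NG = subgroup_carrier[OF N(1)]
  note [simp] = NG g(1)
  have qs: "q \<notin> s" using q(2) t(2) by blast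
  have cop: "coprime (q ^ k) (card N)"
    using pi_number_coprime[OF pi_number_prime_power[OF q(1), of "- s" k] N(3)] qs by auto
  have comm: "x \<otimes> g \<otimes> inv x \<otimes> inv g \<in> generate G {z}" if z: "z \<in> N" "z \<noteq> \<one>" and x: "x \<in> N" for x z
  proof -
    let ?B = "generate G {z}" and ?C = "generate G {g}"
    have B: "subgroup ?B G" "?B \<subseteq> N"
      using z(1) generate_subgroup_incl[OF _ N(1)] by (auto intro: generate_is_subgroup)
    have C: "subgroup ?C G" by (auto intro: generate_is_subgroup)
    have cB: "\<not> pi_number (- s) (card ?B)"
    proof
      assume "pi_number (- s) (card ?B)"
      then have "card ?B = 1" using pi_number_dvd_1[OF N(3)] card_dvd[OF B(1) N(1) B(2)] dvd_refl by blast
      then have "ord z = 1" using generate_pow_card z(1) by simp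
      then show False using z ord_eq_1 by simp
    qed
    have BN: "?B \<inter> N = ?B" using B(2) by blast
    have "normalizes {g} ?B" using emb(1)[OF B(1) cB] BN by simp
    then have "{g} \<subseteq> {x \<in> carrier G. normalizes {x} ?B}" by simp
    then have "?C \<subseteq> {x \<in> carrier G. normalizes {x} ?B}"
      by (rule generate_subgroup_incl[OF _ normalizer_subgroup[OF B(1)]])
    then have CB: "normalizes ?C ?B" by (auto simp: normalizes_def)
    let ?A = "?B <#> ?C"
    have A: "subgroup ?A G" by (rule normalizes_subgroup_mult[OF C B(1) CB])
    have sub: "?B \<subseteq> ?A" "?C \<subseteq> ?A" using subset_set_mult[OF B(1) C] by auto
    have cA: "\<not> pi_number (- s) (card ?A)"
      using cB card_dvd[OF B(1) A sub(1)] pi_number_dvd by blast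
    have "g \<in> ?A" using sub(2) by (auto intro: generate.incl)
    then have "x \<otimes> g \<otimes> inv x \<otimes> inv g \<in> ?A \<inter> N" using emb(2)[OF A cA _ x] by simp
    \<comment> \<open>The <g>-factor of an element of A \<inter> N lies in N and has q-power order,
      so it is trivial.\<close>
    moreover have "?A \<inter> N \<subseteq> ?B"
    proof
      fix a assume a: "a \<in> ?A \<inter> N"
      then obtain b c where bc: "a = b \<otimes> c" "b \<in> ?B" "c \<in> ?C" by (auto elim: mult_set_memE)
      have G: "b \<in> carrier G" "c \<in> carrier G" using bc(2,3) subgroup_carrier[OF B(1)] subgroup_carrier[OF C] by auto
      have "c = inv b \<otimes> a" unfolding bc(1) using G by simp
      then have cN: "c \<in> N" using a bc(2) B(2) N(1) by (auto intro!: subgroup.m_closed subgroup.m_inv_closed)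
      have "c [^] card ?C = \<one>" by (rule pow_card[OF C bc(3)])
      then have "c [^] ord g = \<one>" using generate_pow_card by simp
      then have "c [^] (q ^ k) = \<one>" using g pow_eq_id dvd_trans G(2) by metis
      then have "c = \<one>"
        using pow_coprime_closed[OF triv_subgroup G(2) cop] pow_card[OF N(1) cN] prime_gt_0_nat[OF q(1)] by simp
      then show "a \<in> ?B" using bc G by simp
    qed
    ultimately show ?thesis by blast
  qed
  obtain y where y: "y \<in> N" "y \<otimes> g \<noteq> g \<otimes> y" using nc by blast
  let ?c = "y \<otimes> g \<otimes> inv y \<otimes> inv g"
  show fix1: "x = \<one>" if x: "x \<in> N" "x \<otimes> g = g \<otimes> x" for x
  proof (rule ccontr)
    assume "x \<noteq> \<one>"
    have "?c \<in> generate G {x}" by (rule comm[OF x(1) \<open>x \<noteq> \<one>\<close> y(1)])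
    then obtain i :: nat where i: "?c = x [^] i" using generate_pow_on_finite_carrier[OF fin NG[OF x(1)]] by auto
    have cG: "?c \<in> carrier G" using y(1) by simp
    have cg: "?c \<otimes> g = g \<otimes> ?c"
      unfolding i using group_commutes_pow[OF x(2) NG[OF x(1)] g(1)] .
    have "y \<otimes> g \<otimes> inv y = ?c \<otimes> g" using y(1) by (simp add: m_assoc)
    then have "(y \<otimes> g \<otimes> inv y) [^] (q ^ k) = ?c [^] (q ^ k) \<otimes> g [^] (q ^ k)"
      using pow_mult_distrib[OF cg cG g(1)] by simp
    moreover have "(y \<otimes> g \<otimes> inv y) [^] (q ^ k) = \<one>" using y(1) g by (simp add: conj_pow)
    ultimately have "?c [^] (q ^ k) = \<one>" using g(2) cG by simp
    moreover have "?c [^] card N = \<one>"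
      using pow_card[OF N(1) subgroup_pow_closed[OF N(1) x(1), of i]] i by simp
    ultimately have "?c = \<one>"
      using pow_coprime_closed[OF triv_subgroup cG cop] prime_gt_0_nat[OF q(1)] by simp
    then have "y \<otimes> g \<otimes> inv y \<otimes> inv g \<otimes> (g \<otimes> y) = g \<otimes> y" using y(1) by simp
    moreover have "y \<otimes> g \<otimes> inv y \<otimes> inv g \<otimes> (g \<otimes> y) = y \<otimes> g" using y(1) by (simp add: m_assoc)
    ultimately show False using y(2) by simp
  qed
  have gen: "generate G {z} = N" if z: "z \<in> N" "z \<noteq> \<one>" for z
  proof -
    have inj: "inj_on (\<lambda>x. x \<otimes> g \<otimes> inv x \<otimes> inv g) N"
    proof
      fix u v assume uv: "u \<in> N" "v \<in> N" "u \<otimes> g \<otimes> inv u \<otimes> inv g = v \<otimes> g \<otimes> inv v \<otimes> inv g"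
      then have "u \<otimes> g \<otimes> inv u = v \<otimes> g \<otimes> inv v" by simp
      then have "inv v \<otimes> (u \<otimes> g \<otimes> inv u) \<otimes> u = inv v \<otimes> (v \<otimes> g \<otimes> inv v) \<otimes> u" by simp
      then have "(inv v \<otimes> u) \<otimes> g = g \<otimes> (inv v \<otimes> u)" using uv(1,2) by (simp add: m_assoc)
      then have "inv v \<otimes> u = \<one>" using fix1[of "inv v \<otimes> u"] uv(1,2) N(1) by (simp add: subgroup.m_closed subgroup.m_inv_closed)
      then have "v \<otimes> (inv v \<otimes> u) = v" using uv by simp
      then show "u = v" using uv by simp
    qed
    have "(\<lambda>x. x \<otimes> g \<otimes> inv x \<otimes> inv g) ` N \<subseteq> generate G {z}" using comm[OF z] by blast
    moreover have sub: "generate G {z} \<subseteq> N" using generate_subgroup_incl[OF _ N(1)] z by simp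
    then have f: "finite (generate G {z})" using subgroup_finite[OF N(1)] finite_subset by blast
    ultimately have "card N \<le> card (generate G {z})" using card_inj_on_le[OF inj] by blast
    then show ?thesis using card_seteq[OF subgroup_finite[OF N(1)] sub] by blast
  qed
  have "card N \<noteq> 1"
  proof
    assume "card N = 1"
    then have "N = {\<one>}" using card_eqD[OF triv_subgroup N(1)] subgroup.one_closed[OF N(1)] by simp
    then show False using y by simp
  qed
  then obtain p where p: "prime p" "p dvd card N" using prime_factor_nat by blast
  obtain z where z: "z \<in> N" "ord z = p" using cauchy[OF N(1) p] .
  have "z \<noteq> \<one>" using z(2) p(1) by (auto simp: ord_id)
  then have "card N = p" using gen[OF z(1)] generate_pow_card[of z] z by simp
  then show "prime (card N)" using p(1) by simp
qed

end

section \<open>Elements of \<open>s\<close>-order modulo a subgroup\<close>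

text \<open>Complements are taken in all natural numbers, so \<open>s\<close> may contain composite
  numbers; only its primes are ever tested. Stating the condition block by block makes it symmetric
  in \<open>s\<close> and \<open>- s\<close>.\<close>

definition block_union :: "nat set set \<Rightarrow> nat set \<Rightarrow> bool" where
  "block_union \<sigma> s \<longleftrightarrow> (\<forall>t\<in>\<sigma>. t \<subseteq> s \<or> t \<inter> s = {})"

lemma block_union_compl: "block_union \<sigma> s \<Longrightarrow> block_union \<sigma> (- s)"
  by (auto simp: block_union_def)

context group begin

text \<open>For normal \<open>Y\<close> this says that the coset of x is an s-element of G/Y;
  \<open>pi_mod s {\<one>} x\<close> says that x is an s-element of G.\<close>

definition pi_mod :: "nat set \<Rightarrow> 'a set \<Rightarrow> 'a \<Rightarrow> bool" where
  "pi_mod s Y x \<longleftrightarrow> (\<exists>k. pi_number s k \<and> x [^] k \<in> Y)"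

text \<open>For normal \<open>Y\<close> this says that \<open>G/Y\<close> is \<open>\<sigma>\<close>-nilpotent.\<close>

definition sigma_closed :: "nat set set \<Rightarrow> 'a set \<Rightarrow> bool" where
  "sigma_closed \<sigma> Y \<longleftrightarrow> (\<forall>s. block_union \<sigma> s \<longrightarrow> (\<forall>x\<in>carrier G. \<forall>y\<in>carrier G.
     pi_mod s Y x \<longrightarrow> pi_mod s Y y \<longrightarrow> pi_mod s Y (x \<otimes> y)))"

definition centralizer :: "'a set \<Rightarrow> 'a set" where
  "centralizer A = {h \<in> carrier G. \<forall>a\<in>A. h \<otimes> a = a \<otimes> h}"

lemma pi_modI: "pi_number s k \<Longrightarrow> x [^] k \<in> Y \<Longrightarrow> pi_mod s Y x"
  by (auto simp: pi_mod_def)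

lemma pi_mod_mono: "pi_mod s Y x \<Longrightarrow> s \<subseteq> t \<Longrightarrow> Y \<subseteq> Z \<Longrightarrow> pi_mod t Z x"
  by (auto simp: pi_mod_def dest: pi_number_mono)

lemma pi_mod_mem: "x \<in> Y \<Longrightarrow> x \<in> carrier G \<Longrightarrow> pi_mod s Y x"
  by (rule pi_modI[of s 1]) simp_all

lemma pi_mod_prime_power:
  "prime p \<Longrightarrow> p \<in> s \<Longrightarrow> subgroup Y G \<Longrightarrow> x [^] (p ^ k :: nat) = \<one> \<Longrightarrow> pi_mod s Y x"
  using pi_modI[OF pi_number_prime_power, of p s x k Y] by (simp add: subgroup.one_closed)

lemma pi_mod_disjoint:
  assumes "subgroup Y G" "x \<in> carrier G" "pi_mod s Y x" "pi_mod t Y x" "s \<inter> t = {}"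
  shows "x \<in> Y"
proof -
  obtain a b where "pi_number s a" "x [^] a \<in> Y" "pi_number t b" "x [^] b \<in> Y"
    using assms(3,4) by (auto simp: pi_mod_def)
  then show ?thesis
    using pow_coprime_closed[OF assms(1,2), of a b] pi_number_coprime[of s a t b] assms(5) pi_number_pos
    by blast
qed

lemma pi_mod_pow:
  assumes Y: "subgroup Y G" and x: "x \<in> carrier G" and "pi_number s k" "pi_mod s Y (x [^] k)"
  shows "pi_mod s Y x"
proof -
  obtain l where "pi_number s l" "(x [^] k) [^] l \<in> Y" using assms(4) by (auto simp: pi_mod_def)
  then show ?thesis using pi_modI[of s "k * l" x Y] assms(3) x by (simp add: nat_pow_pow)
qed

lemma pi_mod_pow_closed:
  assumes Y: "subgroup Y G" and x: "x \<in> carrier G" and "pi_mod s Y x"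
  shows "pi_mod s Y (x [^] (k::nat))"
proof -
  obtain l where l: "pi_number s l" "x [^] l \<in> Y" using assms(3) by (auto simp: pi_mod_def)
  have "(x [^] k) [^] l = (x [^] l) [^] k" using x by (simp add: nat_pow_pow mult.commute)
  also have "\<dots> \<in> Y" by (rule subgroup_pow_closed[OF Y l(2)])
  finally show ?thesis using l(1) by (rule pi_modI[rotated])
qed

lemma pi_mod_inv:
  assumes Y: "subgroup Y G" and x: "x \<in> carrier G" and "pi_mod s Y x"
  shows "pi_mod s Y (inv x)"
proof -
  obtain l where l: "pi_number s l" "x [^] l \<in> Y" using assms(3) by (auto simp: pi_mod_def)
  have "inv x [^] l \<in> Y" using nat_pow_inv[OF x, of l] subgroup.m_inv_closed[OF Y l(2)] by simp
  then show ?thesis using l(1) by (rule pi_modI[rotated])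
qed

lemma pi_mod_conj:
  assumes Y: "normalizes (carrier G) Y" and x: "x \<in> carrier G" and y: "y \<in> carrier G" and "pi_mod s Y x"
  shows "pi_mod s Y (y \<otimes> x \<otimes> inv y)"
proof -
  obtain l where l: "pi_number s l" "x [^] l \<in> Y" using assms(4) by (auto simp: pi_mod_def)
  have "(y \<otimes> x \<otimes> inv y) [^] l \<in> Y" using conj_pow[OF y x, of l] normalizesD[OF Y y l(2)] by simp
  then show ?thesis using l(1) by (rule pi_modI[rotated])
qed

lemma sigma_closedD:
  "sigma_closed \<sigma> Y \<Longrightarrow> block_union \<sigma> s \<Longrightarrow> x \<in> carrier G \<Longrightarrow> y \<in> carrier G \<Longrightarrow>
    pi_mod s Y x \<Longrightarrow> pi_mod s Y y \<Longrightarrow> pi_mod s Y (x \<otimes> y)"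
  by (simp add: sigma_closed_def)

lemma normalizes_one: "normalizes X {\<one>}" if "X \<subseteq> carrier G"
  using that by (auto simp: normalizes_def)

lemma pi_elements_subgroup:
  assumes Y: "subgroup Y G" and cl: "\<And>x y. x \<in> A \<Longrightarrow> y \<in> A \<Longrightarrow> pi_mod s Y x \<Longrightarrow> pi_mod s Y y \<Longrightarrow> pi_mod s Y (x \<otimes> y)"
    and A: "subgroup A G"
  shows "subgroup {x \<in> A. pi_mod s Y x} G"
proof (rule subgroupI)
  show "{x \<in> A. pi_mod s Y x} \<subseteq> carrier G" using subgroup.subset[OF A] by blast
  have "\<one> \<in> {x \<in> A. pi_mod s Y x}"
    using pi_mod_mem[of \<one> Y s] subgroup.one_closed[OF Y] subgroup.one_closed[OF A] by simp
  then show "{x \<in> A. pi_mod s Y x} \<noteq> {}" by blast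
  fix x assume x: "x \<in> {x \<in> A. pi_mod s Y x}"
  then show "inv x \<in> {x \<in> A. pi_mod s Y x}"
    using pi_mod_inv[OF Y] subgroup.m_inv_closed[OF A] subgroup_carrier[OF A] by simp
  fix y assume "y \<in> {x \<in> A. pi_mod s Y x}"
  then show "x \<otimes> y \<in> {x \<in> A. pi_mod s Y x}" using x cl subgroup.m_closed[OF A] by simp
qed

lemma centralizer_normalizes:
  assumes A: "A \<subseteq> carrier G" and N: "normalizes (carrier G) A"
  shows "normalizes (carrier G) (centralizer A)"
  unfolding normalizes_def
proof (intro ballI)
  fix x h assume x: "x \<in> carrier G" and h: "h \<in> centralizer A"
  have hG: "h \<in> carrier G" using h by (simp add: centralizer_def)
  have "x \<otimes> h \<otimes> inv x \<otimes> a = a \<otimes> (x \<otimes> h \<otimes> inv x)" if a: "a \<in> A" for a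
  proof -
    have aG: "a \<in> carrier G" using a A by blast
    let ?b = "inv x \<otimes> a \<otimes> x"
    have "?b \<in> A" using normalizesD[OF N _ a, of "inv x"] x by simp
    then have c: "h \<otimes> ?b = ?b \<otimes> h" using h by (simp add: centralizer_def)
    have "x \<otimes> h \<otimes> inv x \<otimes> a = x \<otimes> (h \<otimes> ?b) \<otimes> inv x" using x hG aG by (simp add: m_assoc)
    also have "\<dots> = a \<otimes> (x \<otimes> h \<otimes> inv x)" unfolding c using x hG aG by (simp add: m_assoc)
    finally show ?thesis .
  qed
  then show "x \<otimes> h \<otimes> inv x \<in> centralizer A" using x hG by (simp add: centralizer_def)
qed

text \<open>Modulo C all elements commute, so powers distribute over products up to a factor in C;
  each step of the induction moves x past y^n at the cost of one conjugated commutator.\<close>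

lemma commutator_pow:
  assumes C: "subgroup C G" "normalizes (carrier G) C"
    and comm: "\<And>x y. x \<in> carrier G \<Longrightarrow> y \<in> carrier G \<Longrightarrow> x \<otimes> y \<otimes> inv x \<otimes> inv y \<in> C"
    and x: "x \<in> carrier G" and y: "y \<in> carrier G"
  shows "\<exists>c\<in>C. (x \<otimes> y) [^] (n::nat) = c \<otimes> (x [^] n \<otimes> y [^] n)"
proof (induction n)
  case 0
  show ?case using subgroup.one_closed[OF C(1)] by (intro bexI[of _ \<one>]) simp_all
next
  case (Suc n)
  then obtain c where c: "c \<in> C" "(x \<otimes> y) [^] n = c \<otimes> (x [^] n \<otimes> y [^] n)" by blast
  let ?d = "y [^] n \<otimes> x \<otimes> inv (y [^] n) \<otimes> inv x"
  have d: "?d \<in> C" using comm x y by simp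
  let ?e = "x [^] n \<otimes> ?d \<otimes> inv (x [^] n)"
  have e: "?e \<in> C" using normalizesD[OF C(2) _ d] x by simp
  have cG: "c \<in> carrier G" using c(1) subgroup_carrier[OF C(1)] by simp
  have "(x \<otimes> y) [^] Suc n = c \<otimes> (x [^] n \<otimes> y [^] n) \<otimes> (x \<otimes> y)" using c by simp
  also have "\<dots> = (c \<otimes> ?e) \<otimes> (x [^] Suc n \<otimes> y [^] Suc n)"
    using cG x y by (simp add: m_assoc)
  finally show ?case using subgroup.m_closed[OF C(1) c(1) e] by blast
qed

end

section \<open>Uniform exponents, cores and cyclic subgroups of square-free order\<close>

context finite_group begin

text \<open>The exponent can be chosen independently of x and Y: with a the s-part of |G|, the
  element x^a has the s'-number |G|/a as an exponent and, modulo Y, also an s-number. The test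
  thereby becomes membership of one fixed power, which commutes with intersections of subgroups
  Y.\<close>

lemma pi_mod_iff:
  assumes Y: "subgroup Y G" and x: "x \<in> carrier G"
  shows "pi_mod s Y x \<longleftrightarrow> x [^] pi_part s (card (carrier G)) \<in> Y"
proof
  let ?n = "card (carrier G)" and ?a = "pi_part s (card (carrier G))" and ?b = "pi_part (- s) (card (carrier G))"
  have n: "?n > 0" by (rule card_pos[OF subgroup_self])
  assume "pi_mod s Y x"
  then obtain k where k: "pi_number s k" "x [^] k \<in> Y" by (auto simp: pi_mod_def)
  have "(x [^] ?a) [^] ?b = x [^] ?n" using x pi_part_mult[OF n, of s] by (simp add: nat_pow_pow)
  also have "\<dots> = \<one>" using pow_card[OF subgroup_self x] .
  finally have "(x [^] ?a) [^] ?b \<in> Y" using subgroup.one_closed[OF Y] by simp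
  moreover have "(x [^] ?a) [^] k \<in> Y"
    using subgroup_pow_closed[OF Y k(2), of ?a] x by (simp add: nat_pow_pow mult.commute)
  ultimately show "x [^] ?a \<in> Y"
    using pow_coprime_closed[OF Y _ pi_number_coprime_compl[OF k(1) pi_number_pi_part[OF n]] pi_number_pos[OF k(1)], of "x [^] ?a"]
      x by simp
next
  assume "x [^] pi_part s (card (carrier G)) \<in> Y"
  then show "pi_mod s Y x" using pi_number_pi_part[OF card_pos[OF subgroup_self]] by (rule pi_modI[rotated])
qed

lemma pi_mod_of_card: "subgroup A G \<Longrightarrow> x \<in> A \<Longrightarrow> pi_number s (card A) \<Longrightarrow> pi_mod s {\<one>} x"
  using pi_modI[of s "card A" x "{\<one>}"] pow_card by simp

lemma pi_mod_of_index:
  assumes "subgroup Y G" "normalizes (carrier G) Y" "pi_number s (card (carrier G) div card Y)" "x \<in> carrier G"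
  shows "pi_mod s Y x"
  by (rule pi_modI[OF assms(3) pow_index_mem[OF subgroup_self assms(1) subgroup.subset[OF assms(1)] assms(2,4)]])

lemma centralizer_subgroup: "A \<subseteq> carrier G \<Longrightarrow> subgroup (centralizer A) G"
  unfolding centralizer_def by (rule subgroup_centralizer)

text \<open>This is O_s(G). That the union is itself a member of the family comes from
  \<open>normal_pi_core\<close> with Z = 1.\<close>

definition pi_core :: "nat set \<Rightarrow> 'a set" where
  "pi_core s = \<Union>{M. subgroup M G \<and> normalizes (carrier G) M \<and> pi_number s (card M)}"

lemma pi_core:
  shows pi_core_subgroup: "subgroup (pi_core s) G" and pi_core_normal: "normalizes (carrier G) (pi_core s)"
    and pi_core_card: "pi_number s (card (pi_core s))"
    and pi_core_greatest: "\<And>M. subgroup M G \<Longrightarrow> normalizes (carrier G) M \<Longrightarrow> pi_number s (card M) \<Longrightarrow> M \<subseteq> pi_core s"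
proof -
  obtain M where M: "subgroup M G" "{\<one>} \<subseteq> M" "M \<subseteq> carrier G" "normalizes (carrier G) M"
    "pi_number s (card M div card {\<one>})"
    "\<And>L. subgroup L G \<Longrightarrow> {\<one>} \<subseteq> L \<Longrightarrow> L \<subseteq> carrier G \<Longrightarrow> normalizes (carrier G) L \<Longrightarrow>
      pi_number s (card L div card {\<one>}) \<Longrightarrow> L \<subseteq> M"
    using normal_pi_core[OF subgroup_self subgroup_self subset_refl normalizes_self[OF subgroup_self]
        triv_subgroup _ normalizes_one[OF subset_refl], of s] by (metis empty_subsetI insert_subset one_closed)
  have "pi_core s = M"
    unfolding pi_core_def
  proof
    show "\<Union>{M. subgroup M G \<and> normalizes (carrier G) M \<and> pi_number s (card M)} \<subseteq> M"
      using M(6) subgroup.subset subgroup.one_closed by (intro Union_least) fastforce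
    show "M \<subseteq> \<Union>{M. subgroup M G \<and> normalizes (carrier G) M \<and> pi_number s (card M)}"
      using M(1,4,5) by auto
  qed
  then show "subgroup (pi_core s) G" "normalizes (carrier G) (pi_core s)" "pi_number s (card (pi_core s))"
    using M(1,4,5) by auto
  show "M' \<subseteq> pi_core s" if "subgroup M' G" "normalizes (carrier G) M'" "pi_number s (card M')" for M'
    using that by (auto simp: pi_core_def)
qed

text \<open>The generator is a product of elements of order p, one for each prime divisor p of |D|;
  orders of commuting elements multiply when they are coprime.\<close>

lemma squarefree_abelian_cyclic:
  assumes D: "subgroup D G" and comm: "\<And>x y. x \<in> D \<Longrightarrow> y \<in> D \<Longrightarrow> x \<otimes> y = y \<otimes> x"
    and sq: "\<And>p. prime p \<Longrightarrow> p dvd card D \<Longrightarrow> \<not> p dvd card D div p"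
  obtains z where "z \<in> D" "ord z = card D"
proof -
  have "\<exists>z\<in>D. ord z = \<Prod>A" if "finite A" "A \<subseteq> prime_factors (card D)" for A
    using that
  proof (induction A rule: finite_induct)
    case empty
    show ?case using subgroup.one_closed[OF D] by (intro bexI[of _ \<one>]) (simp_all add: ord_id)
  next
    case (insert p A)
    then obtain z where z: "z \<in> D" "ord z = \<Prod>A" by auto
    have p: "prime p" "p dvd card D" using insert by (auto simp: in_prime_factors_iff)
    obtain w where w: "w \<in> D" "ord w = p" using cauchy[OF D p] .
    have G: "z \<in> carrier G" "w \<in> carrier G" using z w subgroup_carrier[OF D] by auto
    have c: "z \<otimes> w = w \<otimes> z" using comm z w by simp
    have cop: "coprime (ord z) (ord w)"
      unfolding z(2) w(2) using insert p(1)
      by (intro prod_coprime_left) (auto simp: in_prime_factors_iff intro!: primes_coprime)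
    let ?n = "ord (z \<otimes> w)"
    \<comment> \<open>Choosing k as the order of w or of z isolates one factor, so each of the two
      orders divides \<open>?n\<close> times the other.\<close>
    have zw: "z [^] (?n * k) \<otimes> w [^] (?n * k) = \<one>" for k
    proof -
      have "(z \<otimes> w) [^] (?n * k) = \<one>" using G pow_eq_id by simp
      then show ?thesis using pow_mult_distrib[OF c G] by simp
    qed
    have "w [^] (?n * ord w) = \<one>" "z [^] (?n * ord z) = \<one>" using G pow_eq_id by simp_all
    then have "z [^] (?n * ord w) = \<one>" "w [^] (?n * ord z) = \<one>"
      using zw[of "ord w"] zw[of "ord z"] G by simp_all
    then have "ord z dvd ?n * ord w" "ord w dvd ?n * ord z" using G pow_eq_id by simp_all
    then have "ord z dvd ?n" "ord w dvd ?n"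
      using cop coprime_dvd_mult_left_iff[of "ord w" "ord z" ?n]
      by (simp_all add: coprime_dvd_mult_left_iff coprime_commute)
    then have "ord z * ord w dvd ?n" using cop by (rule divides_mult)
    then have "?n = ord z * ord w" using ord_mul_divides[OF c G] dvd_antisym by blast
    moreover have "\<Prod>(insert p A) = ord z * ord w" using insert z w by (simp add: mult.commute)
    ultimately show ?case using subgroup.m_closed[OF D z(1) w(1)] by metis
  qed
  from this[of "prime_factors (card D)"] obtain z where z: "z \<in> D" "ord z = \<Prod>(prime_factors (card D))" by auto
  have "multiplicity p (card D) = 1" if "p \<in> prime_factors (card D)" for p
  proof -
    have p: "prime p" "p dvd card D" using that by (auto simp: in_prime_factors_iff)
    then obtain m where m: "card D = p * m" by auto
    then have "\<not> p dvd m" using sq[OF p] prime_gt_0_nat[OF p(1)] by simp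
    then show ?thesis using m p(1) card_pos[OF D]
      by (simp add: prime_elem_multiplicity_mult_distrib not_dvd_imp_multiplicity_0)
  qed
  then have "(\<Prod>p\<in>prime_factors (card D). p ^ multiplicity p (card D)) = \<Prod>(prime_factors (card D))"
    by (intro prod.cong) simp_all
  then have "card D = \<Prod>(prime_factors (card D))"
    using prime_factorization_nat[of "card D"] card_pos[OF D] by simp
  then show ?thesis using that z by simp
qed

end

lemma (in finite_group) central_pi_complement:
  assumes "subgroup X G" "subgroup N G" "N \<subseteq> X"
    and "\<And>x z. x \<in> X \<Longrightarrow> z \<in> N \<Longrightarrow> x \<otimes> z = z \<otimes> x"
    and "pi_number s (card N)" "pi_number (- s) (card X div card N)"
  shows "\<exists>K. subgroup K G \<and> K \<subseteq> X \<and> pi_number (- s) (card K) \<and> N <#> K = X \<and>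
    (\<forall>x\<in>X. pi_mod (- s) {\<one>} x \<longrightarrow> x \<in> K)"
proof (rule central_hall_split[OF assms])
  fix K assume K: "subgroup K G" "K \<subseteq> X" "pi_number (- s) (card K)" "N <#> K = X"
    and t: "\<And>x k. x \<in> X \<Longrightarrow> pi_number (- s) k \<Longrightarrow> x [^] k = \<one> \<Longrightarrow> x \<in> K"
  have "\<forall>x\<in>X. pi_mod (- s) {\<one>} x \<longrightarrow> x \<in> K" using t by (auto simp: pi_mod_def)
  then show ?thesis by (intro exI[of _ K] conjI K)
qed

section \<open>The structure forced by embeddability\<close>

locale embedded_group = finite_group +
  fixes \<sigma> :: "nat set set"
  assumes cover: "\<And>p. prime p \<Longrightarrow> \<exists>s\<in>\<sigma>. p \<in> s"
    and disj: "\<And>s t. s \<in> \<sigma> \<Longrightarrow> t \<in> \<sigma> \<Longrightarrow> s \<noteq> t \<Longrightarrow> s \<inter> t = {}"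
    and embedded: "all_embedded \<sigma> (carrier G)"
begin

text \<open>The witnesses have prime power order because such elements can be conjugated into a Hall
  subgroup by counting fixed cosets, and because they suffice: if all of them centralize the core,
  its centralizer has index an s-number.\<close>

definition noncentral :: "nat set \<Rightarrow> bool" where
  "noncentral s \<longleftrightarrow> (\<exists>q k g. prime q \<and> q \<notin> s \<and> g \<in> carrier G \<and> g [^] (q ^ k :: nat) = \<one> \<and>
     g \<notin> centralizer (pi_core s))"

text \<open>The centralizer of the product of all cores, that is, of the \<sigma>-Fitting
  subgroup.\<close>

definition C :: "'a set" where
  "C = {x \<in> carrier G. \<forall>s\<in>\<sigma>. x \<in> centralizer (pi_core s)}"

lemma core_sub: "pi_core s \<subseteq> carrier G"
  by (rule subgroup.subset[OF pi_core_subgroup])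

lemma Cs_subgroup: "subgroup (centralizer (pi_core s)) G"
  by (rule centralizer_subgroup[OF core_sub])

lemma Cs_normal: "normalizes (carrier G) (centralizer (pi_core s))"
  by (rule centralizer_normalizes[OF core_sub pi_core_normal])

lemma block_union_block: "s \<in> \<sigma> \<Longrightarrow> block_union \<sigma> s"
  using disj by (auto simp: block_union_def)

lemma central_index:
  assumes "\<not> noncentral s"
  shows "pi_number s (card (carrier G) div card (centralizer (pi_core s)))"
  using assms
  by (intro pi_number_indexI[OF subgroup_self Cs_subgroup subgroup.subset[OF Cs_subgroup]])
    (auto simp: noncentral_def)

lemma central_pi_mod: "\<not> noncentral s \<Longrightarrow> x \<in> carrier G \<Longrightarrow> pi_mod s (centralizer (pi_core s)) x"
  using pi_mod_of_index[OF Cs_subgroup Cs_normal central_index] .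

lemma noncentral_prime:
  assumes s: "s \<in> \<sigma>" and n: "noncentral s"
  obtains q k g where "prime q" "q \<notin> s" "g \<in> carrier G" "g [^] (q ^ k :: nat) = \<one>"
    "g \<notin> centralizer (pi_core s)" "prime (card (pi_core s))"
    "\<And>x. x \<in> pi_core s \<Longrightarrow> x \<otimes> g = g \<otimes> x \<Longrightarrow> x = \<one>"
proof -
  obtain q k g where g: "prime q" "q \<notin> s" "g \<in> carrier G" "g [^] (q ^ k :: nat) = \<one>"
    "g \<notin> centralizer (pi_core s)" using n by (auto simp: noncentral_def)
  obtain t where t: "t \<in> \<sigma>" "q \<in> t" using cover[OF g(1)] by blast
  have st: "s \<inter> t = {}" using disj[OF s t(1)] t(2) g(2) by blast
  have "\<exists>y\<in>pi_core s. g \<otimes> y \<noteq> y \<otimes> g" using g(3,5) by (simp add: centralizer_def)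
  then have nc: "\<exists>y\<in>pi_core s. y \<otimes> g \<noteq> g \<otimes> y" by metis
  note * = noncentral_normal_pi_prime[OF embedded pi_core_subgroup pi_core_normal pi_core_card
      t(1) st s g(1) t(2) g(3,4) nc]
  show ?thesis using that[OF g *] .
qed

text \<open>The core has prime order and its automorphism group is abelian, so G modulo the
  centralizer of the core is abelian. Concretely, x and y raise a generator to powers i and j, and
  both xy and yx raise it to the power ij.\<close>

lemma noncentral_commutator:
  assumes s: "s \<in> \<sigma>" and n: "noncentral s" and x: "x \<in> carrier G" and y: "y \<in> carrier G"
  shows "x \<otimes> y \<otimes> inv x \<otimes> inv y \<in> centralizer (pi_core s)"
proof -
  let ?N = "pi_core s"
  have p: "prime (card ?N)" using noncentral_prime[OF s n] by metis
  obtain z where z: "z \<in> ?N" "ord z = card ?N" using cauchy[OF pi_core_subgroup p dvd_refl] .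
  have zG: "z \<in> carrier G" using z(1) core_sub by blast
  have gen: "generate G {z} = ?N" by (rule generate_eqI[OF pi_core_subgroup z])
  have pw: "\<exists>i::nat. a = z [^] i" if "a \<in> ?N" for a
    using that generate_pow_on_finite_carrier[OF fin zG] gen by auto
  obtain i :: nat where i: "x \<otimes> z \<otimes> inv x = z [^] i" using pw normalizesD[OF pi_core_normal x z(1)] by blast
  obtain j :: nat where j: "y \<otimes> z \<otimes> inv y = z [^] j" using pw normalizesD[OF pi_core_normal y z(1)] by blast
  have "(x \<otimes> y) \<otimes> z \<otimes> inv (x \<otimes> y) = x \<otimes> (y \<otimes> z \<otimes> inv y) \<otimes> inv x" using x y zG by (simp add: group_simps)
  also have "\<dots> = z [^] (i * j)" unfolding j using conj_pow[OF x zG, of j] i zG by (simp add: nat_pow_pow)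
  finally have 1: "(x \<otimes> y) \<otimes> z \<otimes> inv (x \<otimes> y) = z [^] (i * j)" .
  have "(y \<otimes> x) \<otimes> z \<otimes> inv (y \<otimes> x) = y \<otimes> (x \<otimes> z \<otimes> inv x) \<otimes> inv y" using x y zG by (simp add: group_simps)
  also have "\<dots> = z [^] (i * j)" unfolding i using conj_pow[OF y zG, of i] j zG by (simp add: nat_pow_pow mult.commute)
  finally have 2: "(y \<otimes> x) \<otimes> z \<otimes> inv (y \<otimes> x) = z [^] (i * j)" .
  let ?c = "x \<otimes> y \<otimes> inv x \<otimes> inv y"
  have cG: "?c \<in> carrier G" using x y by simp
  have "?c \<otimes> (y \<otimes> x) = x \<otimes> y" using x y by (simp add: m_assoc)
  then have "?c \<otimes> z [^] (i * j) \<otimes> inv ?c = z [^] (i * j)"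
  proof -
    have "?c \<otimes> ((y \<otimes> x) \<otimes> z \<otimes> inv (y \<otimes> x)) \<otimes> inv ?c = (?c \<otimes> (y \<otimes> x)) \<otimes> z \<otimes> inv (?c \<otimes> (y \<otimes> x))"
      using cG x y zG inv_mult_group[of ?c "y \<otimes> x"] by (simp only: m_assoc m_closed inv_closed)
    also have "\<dots> = z [^] (i * j)" unfolding \<open>?c \<otimes> (y \<otimes> x) = x \<otimes> y\<close> by (rule 1)
    finally show ?thesis unfolding 2 .
  qed
  then have cw: "?c \<otimes> z [^] (i * j) = z [^] (i * j) \<otimes> ?c"
  proof -
    assume e: "?c \<otimes> z [^] (i * j) \<otimes> inv ?c = z [^] (i * j)"
    have "?c \<otimes> z [^] (i * j) = (?c \<otimes> z [^] (i * j) \<otimes> inv ?c) \<otimes> ?c"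
      using cG zG by (simp only: m_assoc m_closed inv_closed nat_pow_closed l_inv r_one)
    then show ?thesis unfolding e .
  qed
  have cz: "?c \<otimes> z = z \<otimes> ?c"
  proof -
    let ?C = "centralizer {?c}"
    have S: "subgroup ?C G" using cG by (intro centralizer_subgroup) simp
    have "(x \<otimes> y) \<otimes> z \<otimes> inv (x \<otimes> y) \<in> ?C" unfolding 1 using cw zG by (simp add: centralizer_def)
    \<comment> \<open>The computation shows that the commutator centralizes z^(ij) rather than z;
      being nontrivial, this power generates the same group of prime order.\<close>
    let ?w = "z [^] (i * j)"
    have wN: "?w \<in> ?N" by (rule subgroup_pow_closed[OF pi_core_subgroup z(1)])
    have "?w \<noteq> \<one>"
    proof
      assume "?w = \<one>"
      then have "(x \<otimes> y) \<otimes> z \<otimes> inv (x \<otimes> y) = \<one>" using 1 by simp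
      then have "(x \<otimes> y) \<otimes> z \<otimes> inv (x \<otimes> y) \<otimes> (x \<otimes> y) = x \<otimes> y" using x y by simp
      moreover have "(x \<otimes> y) \<otimes> z \<otimes> inv (x \<otimes> y) \<otimes> (x \<otimes> y) = (x \<otimes> y) \<otimes> z"
        using m_assoc[of "(x \<otimes> y) \<otimes> z" "inv (x \<otimes> y)" "x \<otimes> y"] x y zG by (simp del: inv_mult_group)
      ultimately have "z = \<one>" using l_cancel_one[of "x \<otimes> y" z] x y zG by simp
      then have "card ?N = 1" using z(2) by (simp add: ord_id)
      then show False using p by simp
    qed
    then have "generate G {?w} = ?N" by (rule generate_prime_card[OF pi_core_subgroup p wN])
    moreover have "generate G {?w} \<subseteq> ?C"
      by (rule generate_subgroup_incl[OF _ S]) (use cw zG in \<open>simp add: centralizer_def\<close>)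
    ultimately have "z \<in> ?C" using z(1) by blast
    then show ?thesis by (simp add: centralizer_def)
  qed
  show ?thesis
    unfolding centralizer_def
  proof (simp only: mem_Collect_eq, intro conjI cG ballI)
    fix a assume "a \<in> ?N"
    then obtain l :: nat where l: "a = z [^] l" using pw by blast
    show "?c \<otimes> a = a \<otimes> ?c" unfolding l by (rule group_commutes_pow[OF cz[symmetric] zG cG, symmetric])
  qed
qed

lemma C_subgroup: "subgroup C G"
proof (rule subgroupI)
  show "C \<subseteq> carrier G" by (auto simp: C_def)
  have "\<one> \<in> C" using subgroup.one_closed[OF Cs_subgroup] by (simp add: C_def)
  then show "C \<noteq> {}" by blast
  fix x assume x: "x \<in> C"
  then show "inv x \<in> C" using subgroup.m_inv_closed[OF Cs_subgroup] by (simp add: C_def)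
  fix y assume "y \<in> C"
  then show "x \<otimes> y \<in> C" using x subgroup.m_closed[OF Cs_subgroup] by (simp add: C_def)
qed

lemma C_normal: "normalizes (carrier G) C"
  unfolding normalizes_def
proof (intro ballI)
  fix x y assume "x \<in> carrier G" "y \<in> C"
  then show "x \<otimes> y \<otimes> inv x \<in> C" using normalizesD[OF Cs_normal] by (simp add: C_def)
qed

lemma pi_mod_C_iff:
  assumes "x \<in> carrier G"
  shows "pi_mod r C x \<longleftrightarrow> (\<forall>s\<in>\<sigma>. pi_mod r (centralizer (pi_core s)) x)"
  unfolding pi_mod_iff[OF C_subgroup assms] pi_mod_iff[OF Cs_subgroup assms]
  using assms by (auto simp: C_def)

text \<open>Blockwise, G modulo the centralizer of a core is abelian if the block s is noncentral
  and an s-group otherwise; in both cases products of r-elements are r-elements. The uniform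
  exponent of \<open>pi_mod_iff\<close> assembles the blocks.\<close>

lemma C_sigma_closed: "sigma_closed \<sigma> C"
  unfolding sigma_closed_def
proof (intro allI ballI impI)
  fix r x y assume r: "block_union \<sigma> r" and x: "x \<in> carrier G" and y: "y \<in> carrier G"
    and px: "pi_mod r C x" and py: "pi_mod r C y"
  have "pi_mod r (centralizer (pi_core s)) (x \<otimes> y)" if s: "s \<in> \<sigma>" for s
  proof -
    let ?C = "centralizer (pi_core s)"
    have pxs: "pi_mod r ?C x" and pys: "pi_mod r ?C y" using px py pi_mod_C_iff x y s by auto
    show ?thesis
    proof (cases "noncentral s")
      case True
      obtain c where c: "c \<in> ?C" "(x \<otimes> y) [^] pi_part r (card (carrier G)) =
          c \<otimes> (x [^] pi_part r (card (carrier G)) \<otimes> y [^] pi_part r (card (carrier G)))"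
        using commutator_pow[OF Cs_subgroup Cs_normal noncentral_commutator[OF s True] x y] by blast
      have "x [^] pi_part r (card (carrier G)) \<in> ?C" "y [^] pi_part r (card (carrier G)) \<in> ?C"
        using pxs pys pi_mod_iff[OF Cs_subgroup] x y by auto
      then have "(x \<otimes> y) [^] pi_part r (card (carrier G)) \<in> ?C"
        unfolding c(2) using c(1) by (intro subgroup.m_closed[OF Cs_subgroup])
      then show ?thesis using pi_mod_iff[OF Cs_subgroup] x y by simp
    next
      case False
      have "s \<subseteq> r \<or> s \<inter> r = {}" using r s by (simp add: block_union_def)
      then show ?thesis
      proof
        assume "s \<subseteq> r"
        then show ?thesis using pi_mod_mono[OF central_pi_mod[OF False] _ subset_refl] x y by simp
      next
        assume d: "s \<inter> r = {}"
        have "x \<in> ?C" "y \<in> ?C"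
          using pi_mod_disjoint[OF Cs_subgroup _ central_pi_mod[OF False] _ d] x y pxs pys by auto
        then have "x \<otimes> y \<in> ?C" by (rule subgroup.m_closed[OF Cs_subgroup])
        then show ?thesis using pi_mod_mem x y by simp
      qed
    qed
  qed
  then show "pi_mod r C (x \<otimes> y)" using pi_mod_C_iff x y by simp
qed

text \<open>In the \<sigma>-nilpotent group G/C, s-elements commute with s'-elements. For a central
  block t the quotient by the centralizer of its core is a t-group, so y (if t = s) or x (if t
  \<noteq> s) acts trivially on that core.\<close>

lemma C_commutator:
  assumes s: "s \<in> \<sigma>" and x: "x \<in> carrier G" and y: "y \<in> carrier G"
    and px: "pi_mod s C x" and py: "pi_mod (- s) C y"
  shows "x \<otimes> y \<otimes> inv x \<otimes> inv y \<in> C"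
proof -
  have "x \<otimes> y \<otimes> inv x \<otimes> inv y \<in> centralizer (pi_core t)" if t: "t \<in> \<sigma>" for t
  proof (cases "noncentral t")
    case True then show ?thesis by (rule noncentral_commutator[OF t _ x y])
  next
    case False
    let ?C = "centralizer (pi_core t)"
    note pt = central_pi_mod[OF False]
    have pxs: "pi_mod s ?C x" and pys: "pi_mod (- s) ?C y" using px py pi_mod_C_iff x y t by auto
    have "x \<in> ?C \<or> y \<in> ?C"
    proof (cases "t = s")
      case True then show ?thesis using pi_mod_disjoint[OF Cs_subgroup y pt[OF y] pys] by blast
    next
      case False
      then have "t \<inter> s = {}" by (rule disj[OF t s])
      then show ?thesis using pi_mod_disjoint[OF Cs_subgroup x pt[OF x] pxs] by blast
    qed
    then show ?thesis
    proof
      assume xC: "x \<in> ?C"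
      have "x \<otimes> (y \<otimes> inv x \<otimes> inv y) \<in> ?C"
        by (rule subgroup.m_closed[OF Cs_subgroup xC normalizesD[OF Cs_normal y subgroup.m_inv_closed[OF Cs_subgroup xC]]])
      then show ?thesis using x y by (simp add: m_assoc)
    next
      assume "y \<in> ?C"
      then show ?thesis
        by (intro subgroup.m_closed[OF Cs_subgroup] normalizesD[OF Cs_normal x] subgroup.m_inv_closed[OF Cs_subgroup])
    qed
  qed
  then show ?thesis using x y by (simp add: C_def)
qed

text \<open>As for the Fitting subgroup of a soluble group: if Z(C) < C, there is a normal subgroup
  M of G with Z(C) < M \<le> C and |M:Z(C)| an s-number. The s'-part T of Z(C) is a central Hall
  subgroup of M and splits off, M = TK. The s-group K is normal in G, hence inside the core for s,
  which C centralizes; so K and M lie in Z(C).\<close>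

lemma C_abelian:
  assumes "x \<in> C" "y \<in> C" shows "x \<otimes> y = y \<otimes> x"
proof -
  let ?Z = "{z \<in> C. \<forall>c\<in>C. z \<otimes> c = c \<otimes> z}"
  have CG: "C \<subseteq> carrier G" by (rule subgroup.subset[OF C_subgroup])
  have Zeq: "?Z = C \<inter> centralizer C" using CG by (auto simp: centralizer_def)
  have Z: "subgroup ?Z G" unfolding Zeq by (rule subgroups_Inter_pair[OF C_subgroup centralizer_subgroup[OF CG]])
  have Zn: "normalizes (carrier G) ?Z"
    unfolding Zeq by (rule normalizes_Int[OF C_normal centralizer_normalizes[OF CG C_normal]])
  have ZC: "?Z \<subseteq> C" by blast
  have "?Z = C"
  proof (rule ccontr)
    assume ne: "?Z \<noteq> C"
    obtain s L where L: "s \<in> \<sigma>" "subgroup L G" "?Z \<subseteq> L" "L \<subseteq> C" "?Z \<noteq> L" "normalizes C L"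
      "pi_number s (card L div card ?Z)"
      using all_embedded_pi_factor[OF cover disj C_subgroup
          all_embedded_normal[OF subgroup_self embedded C_subgroup CG C_normal] Z ZC ne normalizes_subset[OF Zn CG]]
      by blast
    have "\<exists>M. subgroup M G \<and> ?Z \<subseteq> M \<and> M \<subseteq> C \<and> normalizes (carrier G) M \<and>
      pi_number s (card M div card ?Z) \<and> L \<subseteq> M"
    proof (rule normal_pi_core[OF subgroup_self C_subgroup CG C_normal Z ZC Zn, of s])
      fix M assume M: "subgroup M G" "?Z \<subseteq> M" "M \<subseteq> C" "normalizes (carrier G) M"
        "pi_number s (card M div card ?Z)"
        and c: "\<And>L. subgroup L G \<Longrightarrow> ?Z \<subseteq> L \<Longrightarrow> L \<subseteq> C \<Longrightarrow> normalizes C L \<Longrightarrow>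
          pi_number s (card L div card ?Z) \<Longrightarrow> L \<subseteq> M"
      have "L \<subseteq> M" by (rule c[OF L(2,3,4,6,7)])
      then show ?thesis by (intro exI[of _ M] conjI M)
    qed
    then obtain M where M: "subgroup M G" "?Z \<subseteq> M" "M \<subseteq> C" "normalizes (carrier G) M"
      "pi_number s (card M div card ?Z)" "L \<subseteq> M" by blast
    let ?T = "{z \<in> ?Z. pi_mod (- s) {\<one>} z}"
    have T: "subgroup ?T G"
    proof (rule pi_elements_subgroup[OF triv_subgroup _ Z])
      fix x y assume xy: "x \<in> ?Z" "y \<in> ?Z" "pi_mod (- s) {\<one>} x" "pi_mod (- s) {\<one>} y"
      have G: "x \<in> carrier G" "y \<in> carrier G" using xy(1,2) CG by blast+
      have c: "x \<otimes> y = y \<otimes> x" using xy(1,2) by blast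
      let ?a = "pi_part (- s) (card (carrier G))"
      have "x [^] ?a = \<one>" "y [^] ?a = \<one>" using xy(3,4) pi_mod_iff[OF triv_subgroup] G by auto
      then have "(x \<otimes> y) [^] ?a = \<one>" using pow_mult_distrib[OF c G, of ?a] by simp
      then show "pi_mod (- s) {\<one>} (x \<otimes> y)" using pi_mod_iff[OF triv_subgroup] G by simp
    qed
    have TZ: "?T \<subseteq> ?Z" by blast
    have TM: "?T \<subseteq> M" using M(2) by blast
    have cT: "pi_number (- s) (card ?T)"
    proof (rule pi_number_card_elementI[OF T])
      fix x p assume x: "x \<in> ?T" and p: "prime p" "ord x = p"
      show "p \<in> - s"
      proof
        assume ps: "p \<in> s"
        have xG: "x \<in> carrier G" using x CG by blast
        have "x [^] (p ^ 1) = \<one>" using p(2) xG pow_ord_eq_1 by force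
        then have "pi_mod s {\<one>} x" by (rule pi_mod_prime_power[OF p(1) ps triv_subgroup])
        then have "x \<in> {\<one>}" using pi_mod_disjoint[OF triv_subgroup xG, of s "- s"] x by simp
        then show False using p by (auto simp: ord_id)
      qed
    qed
    have "pi_number s (card ?Z div card ?T)"
      by (rule pi_number_indexI[OF Z T TZ]) (auto intro: pi_mod_prime_power triv_subgroup)
    then have iT: "pi_number (- (- s)) (card M div card ?T)"
      using card_tower[OF T Z M(1) TZ M(2)] M(5) by simp
    have cen: "x \<otimes> z = z \<otimes> x" if "x \<in> M" "z \<in> ?T" for x z
    proof -
      have "x \<in> C" using that(1) M(3) by blast
      then have "z \<otimes> x = x \<otimes> z" using that(2) by blast
      then show ?thesis by simp
    qed
    from central_pi_complement[OF M(1) T TM cen cT iT]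
    obtain K where K: "subgroup K G" "K \<subseteq> M" "pi_number (- (- s)) (card K)" "?T <#> K = M"
      "\<forall>x\<in>M. pi_mod (- (- s)) {\<one>} x \<longrightarrow> x \<in> K" by blast
    have "normalizes (carrier G) K"
      unfolding normalizes_def
    proof (intro ballI)
      fix x y assume x: "x \<in> carrier G" and y: "y \<in> K"
      have yG: "y \<in> carrier G" by (rule subgroup_carrier[OF K(1) y])
      have "pi_mod (- (- s)) {\<one>} (x \<otimes> y \<otimes> inv x)"
        by (rule pi_mod_conj[OF normalizes_one[OF subset_refl] yG x pi_mod_of_card[OF K(1) y K(3)]])
      moreover have "x \<otimes> y \<otimes> inv x \<in> M" using normalizesD[OF M(4) x] y K(2) by blast
      ultimately show "x \<otimes> y \<otimes> inv x \<in> K" using K(5) by blast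
    qed
    then have KO: "K \<subseteq> pi_core s" using pi_core_greatest[OF K(1)] K(3) by simp
    have "K \<subseteq> ?Z"
    proof
      fix k assume k: "k \<in> K"
      have "k \<otimes> c = c \<otimes> k" if "c \<in> C" for c
      proof -
        have "c \<in> centralizer (pi_core s)" using that L(1) by (simp add: C_def)
        then have "c \<otimes> k = k \<otimes> c" using k KO unfolding centralizer_def by blast
        then show ?thesis by simp
      qed
      then show "k \<in> ?Z" using k K(2) M(3) by blast
    qed
    then have "M \<subseteq> ?Z" using set_mult_subset[OF Z TZ, of K] K(4) by simp
    then show False using L(3,5) M(6) by blast
  qed
  then show ?thesis using assms by blast
qed

text \<open>C is abelian, so its s-elements form a subgroup; conjugation preserves C and orders, so
  this is a normal s-subgroup of G.\<close>

lemma C_pi_part: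
  assumes s: "s \<in> \<sigma>"
  shows "subgroup {z \<in> C. pi_mod s {\<one>} z} G" "{z \<in> C. pi_mod s {\<one>} z} \<subseteq> pi_core s"
proof -
  let ?T = "{z \<in> C. pi_mod s {\<one>} z}"
  have CG: "C \<subseteq> carrier G" by (rule subgroup.subset[OF C_subgroup])
  show T: "subgroup ?T G"
  proof (rule pi_elements_subgroup[OF triv_subgroup _ C_subgroup])
    fix x y assume xy: "x \<in> C" "y \<in> C" "pi_mod s {\<one>} x" "pi_mod s {\<one>} y"
    then have G: "x \<in> carrier G" "y \<in> carrier G" and c: "x \<otimes> y = y \<otimes> x" using CG C_abelian by auto
    let ?a = "pi_part s (card (carrier G))"
    have "x [^] ?a = \<one>" "y [^] ?a = \<one>" using xy(3,4) pi_mod_iff[OF triv_subgroup] G by auto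
    then have "(x \<otimes> y) [^] ?a = \<one>" using pow_mult_distrib[OF c G, of ?a] by simp
    then show "pi_mod s {\<one>} (x \<otimes> y)" using pi_mod_iff[OF triv_subgroup] G by simp
  qed
  have "normalizes (carrier G) ?T" unfolding normalizes_def
  proof (intro ballI)
    fix x y assume x: "x \<in> carrier G" and y: "y \<in> ?T"
    then have "pi_mod s {\<one>} (x \<otimes> y \<otimes> inv x)"
      using pi_mod_conj[OF normalizes_one[OF subset_refl], of y x s] CG by auto
    then show "x \<otimes> y \<otimes> inv x \<in> ?T" using normalizesD[OF C_normal x] y by simp
  qed
  moreover have "pi_number s (card ?T)"
  proof (rule pi_number_card_elementI[OF T])
    fix x p assume x: "x \<in> ?T" and p: "prime p" "ord x = p"
    show "p \<in> s"
    proof (rule ccontr)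
      assume ps: "p \<notin> s"
      have xG: "x \<in> carrier G" using x CG by blast
      have "x [^] (p ^ 1) = \<one>" using p(2) xG pow_ord_eq_1 by force
      then have "pi_mod (- s) {\<one>} x" using pi_mod_prime_power[OF p(1) _ triv_subgroup, of "- s" x 1] ps by simp
      then have "x \<in> {\<one>}" using pi_mod_disjoint[OF triv_subgroup xG, of s "- s"] x by simp
      then show False using p by (auto simp: ord_id)
    qed
  qed
  ultimately show "?T \<subseteq> pi_core s" by (rule pi_core_greatest[OF T])
qed

text \<open>Let Y be the preimage of the s'-elements of G/C and T the s-part of C, a Hall s-subgroup
  of Y. The centralizer of the core has index an s-number, so Y lies in it and centralizes T, which
  is inside the core. Splitting off T leaves a complement that contains every s'-element of
  G.\<close>

lemma central_complement:
  assumes s: "s \<in> \<sigma>" and nc: "\<not> noncentral s"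
    and x: "x \<in> carrier G" "pi_mod (- s) {\<one>} x" and y: "y \<in> carrier G" "pi_mod (- s) {\<one>} y"
  shows "pi_mod (- s) {\<one>} (x \<otimes> y)"
proof -
  let ?Y = "{x \<in> carrier G. pi_mod (- s) C x}" and ?T = "{z \<in> C. pi_mod s {\<one>} z}"
  have CG: "C \<subseteq> carrier G" by (rule subgroup.subset[OF C_subgroup])
  have bu: "block_union \<sigma> (- s)" by (rule block_union_compl[OF block_union_block[OF s]])
  have Y: "subgroup ?Y G"
    by (rule pi_elements_subgroup[OF C_subgroup sigma_closedD[OF C_sigma_closed bu] subgroup_self])
  note T = C_pi_part[OF s]
  have CY: "C \<subseteq> ?Y" using CG by (auto intro: pi_mod_mem)
  have TC: "?T \<subseteq> C" by blast
  have "pi_number (- s) (card ?Y div card C)"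
  proof (rule pi_number_indexI[OF Y C_subgroup CY])
    fix x p k assume p: "prime p" "p \<notin> - s" and x: "x \<in> ?Y" "x [^] (p ^ k :: nat) = \<one>"
    have "pi_mod s C x" using pi_mod_prime_power[OF p(1) _ C_subgroup x(2)] p(2) by simp
    then show "x \<in> C" using pi_mod_disjoint[OF C_subgroup _ _ _ Compl_disjoint[of s]] x(1) by simp
  qed
  moreover have "pi_number (- s) (card C div card ?T)"
    by (rule pi_number_indexI[OF C_subgroup T(1) TC]) (auto intro: pi_mod_prime_power triv_subgroup)
  ultimately have idx: "pi_number (- s) (card ?Y div card ?T)"
    using card_tower[OF T(1) C_subgroup Y TC CY] by simp
  have cT: "pi_number s (card ?T)"
    using pi_number_dvd[OF pi_core_card card_dvd[OF T(1) pi_core_subgroup T(2)]] .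
  have cen: "x \<otimes> z = z \<otimes> x" if xY: "x \<in> ?Y" and z: "z \<in> ?T" for x z
  proof -
    have "x \<in> carrier G" "pi_mod (- s) C x" using xY by auto
    then have "pi_mod (- s) (centralizer (pi_core s)) x" using pi_mod_C_iff[of x "- s"] s by blast
    then have "x \<in> centralizer (pi_core s)"
      using pi_mod_disjoint[OF Cs_subgroup _ central_pi_mod[OF nc] _ Compl_disjoint] xY by simp
    then show ?thesis using z T(2) by (auto simp: centralizer_def)
  qed
  have TY: "?T \<subseteq> ?Y" using TC CY by blast
  from central_pi_complement[OF Y T(1) TY cen cT idx]
  obtain K where K: "subgroup K G" "pi_number (- s) (card K)"
    "\<forall>x\<in>?Y. pi_mod (- s) {\<one>} x \<longrightarrow> x \<in> K" by blast
  have inK: "x \<in> K" if x: "x \<in> carrier G" "pi_mod (- s) {\<one>} x" for x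
  proof -
    have "pi_mod (- s) C x" using pi_mod_mono[OF x(2)] subgroup.one_closed[OF C_subgroup] by simp
    then show ?thesis using K(3) x by simp
  qed
  have "x \<otimes> y \<in> K" using inK[OF x] inK[OF y] by (rule subgroup.m_closed[OF K(1)])
  then show ?thesis using pi_mod_of_card[OF K(1) _ K(2)] by simp
qed

text \<open>Let Q be a Sylow q-subgroup containing g and A its normalizer. Elements of A in the core
  commute with g and are trivial; if a prime of s divided |A|, embedding A would put every [x,g]
  with x in the core into this trivial intersection, so A is an s'-group. An s-element x of G
  conjugates Q into CQ, since it commutes with Q modulo C, and by Frattini's argument x lies in CA.
  Its A-part is both an s-element and an s'-element modulo C, so x lies in C and hence in the
  core.\<close>

lemma noncentral_hall:
  assumes s: "s \<in> \<sigma>" and nc: "noncentral s"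
  shows "pi_number (- s) (card (carrier G) div card (pi_core s))"
proof -
  let ?N = "pi_core s"
  obtain q k g where g: "prime q" "q \<notin> s" "g \<in> carrier G" "g [^] (q ^ k :: nat) = \<one>"
    "g \<notin> centralizer ?N" "prime (card ?N)"
    and fix1: "\<And>x. x \<in> ?N \<Longrightarrow> x \<otimes> g = g \<otimes> x \<Longrightarrow> x = \<one>"
    using noncentral_prime[OF s nc] by metis
  obtain t where t: "t \<in> \<sigma>" "q \<in> t" using cover[OF g(1)] by blast
  have st: "s \<inter> t = {}" using disj[OF s t(1)] t(2) g(2) by blast
  obtain P j where P: "subgroup P G" "P \<subseteq> carrier G" "card P = q ^ j" "\<not> q dvd card (carrier G) div card P"
    using sylow_exists[OF subgroup_self g(1)] .
  let ?R = "generate G {g}"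
  have "ord g dvd q ^ k" using g(3,4) pow_eq_id by blast
  then obtain i where "ord g = q ^ i" using divides_primepow_nat[OF g(1)] by blast
  then have R: "subgroup ?R G" "card ?R = q ^ i"
    using generate_pow_card[OF g(3)] g(3) by (auto intro: generate_is_subgroup)
  obtain y where y: "y \<in> carrier G" "\<And>u. u \<in> ?R \<Longrightarrow> y \<otimes> u \<otimes> inv y \<in> P"
    using p_subgroup_conj_into[OF R g(1) P(1,4)] by blast
  \<comment> \<open>P contains the conjugate of g by y; conjugating P back gives a Sylow subgroup
    through g itself.\<close>
  let ?Q = "conjugate (inv y) P"
  have iy: "inv y \<in> carrier G" using y(1) by simp
  have Q: "subgroup ?Q G" "card ?Q = q ^ j"
    using conjugate_subgroup[OF P(1) iy] conjugate_card[OF P(2) iy] P(3) by auto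
  have QG: "?Q \<subseteq> carrier G" by (rule subgroup.subset[OF Q(1)])
  have "inv y \<otimes> (y \<otimes> g \<otimes> inv y) \<otimes> inv (inv y) \<in> ?Q"
    using y(2)[of g] by (intro conjugate_mem) (simp add: generate.incl)
  then have gQ: "g \<in> ?Q" using y(1) g(3) by (simp add: m_assoc)
  have qQ: "\<not> q dvd card (carrier G) div card ?Q" using P(3,4) Q(2) by simp
  let ?A = "{x \<in> carrier G. normalizes {x} ?Q}"
  have A: "subgroup ?A G" by (rule normalizer_subgroup[OF Q(1)])
  have QA: "?Q \<subseteq> ?A" using QG normalizes_self[OF Q(1)] by (auto simp: normalizes_def)
  have copQ: "coprime (q ^ j) (card ?N)"
    using pi_number_coprime[OF pi_number_prime_power[OF g(1), of "- s" j] pi_core_card] g(2) by auto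
  have AN: "x = \<one>" if x: "x \<in> ?A" "x \<in> ?N" for x
  proof -
    have xG: "x \<in> carrier G" using x(1) by simp
    let ?c = "x \<otimes> g \<otimes> inv x \<otimes> inv g"
    have cG: "?c \<in> carrier G" using xG g(3) by simp
    have "x \<otimes> g \<otimes> inv x \<in> ?Q" using x(1) gQ by (simp add: normalizes_def)
    then have cQ: "?c \<in> ?Q" using subgroup.m_inv_closed[OF Q(1) gQ] by (rule subgroup.m_closed[OF Q(1)])
    have "x \<otimes> (g \<otimes> inv x \<otimes> inv g) \<in> ?N"
      using x(2) normalizesD[OF pi_core_normal g(3) subgroup.m_inv_closed[OF pi_core_subgroup x(2)]]
      by (rule subgroup.m_closed[OF pi_core_subgroup])
    then have cN: "?c \<in> ?N" using xG g(3) by (simp add: m_assoc)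
    have "?c [^] (q ^ j) = \<one>" "?c [^] card ?N = \<one>"
      using pow_card[OF Q(1) cQ] Q(2) pow_card[OF pi_core_subgroup cN] by auto
    then have "?c \<in> {\<one>}"
      using pow_coprime_closed[OF triv_subgroup cG copQ] prime_gt_0_nat[OF g(1)] by simp
    then have "?c \<otimes> (g \<otimes> x) = g \<otimes> x" using xG g(3) by simp
    moreover have "?c \<otimes> (g \<otimes> x) = x \<otimes> g" using xG g(3) by (simp add: m_assoc)
    ultimately have "x \<otimes> g = g \<otimes> x" by simp
    then show "x = \<one>" by (rule fix1[OF x(2)])
  qed
  have cA: "pi_number (- s) (card ?A)"
  proof (rule ccontr)
    assume cA: "\<not> pi_number (- s) (card ?A)"
    have "g \<in> centralizer ?N"
      unfolding centralizer_def
    proof (simp only: mem_Collect_eq, intro conjI g(3) ballI)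
      fix x assume x: "x \<in> ?N"
      have xG: "x \<in> carrier G" using x core_sub by blast
      let ?c = "x \<otimes> g \<otimes> inv x \<otimes> inv g"
      have "?c \<in> ?A \<inter> ?N"
        by (rule normal_pi_embedding(2)[OF embedded pi_core_subgroup pi_core_normal pi_core_card t(1) st s A cA
              g(1) t(2) g(3,4) _ x]) (use gQ QA in blast)
      then have "?c = \<one>" using AN by blast
      then have "?c \<otimes> (g \<otimes> x) = g \<otimes> x" using xG g(3) by simp
      moreover have "?c \<otimes> (g \<otimes> x) = x \<otimes> g" using xG g(3) by (simp add: m_assoc)
      ultimately show "g \<otimes> x = x \<otimes> g" by simp
    qed
    then show False using g(5) by simp
  qed
  have CG: "C \<subseteq> carrier G" by (rule subgroup.subset[OF C_subgroup])
  have nQC: "normalizes ?Q C" by (rule normalizes_subset[OF C_normal QG])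
  let ?X = "C <#> ?Q"
  have X: "subgroup ?X G" by (rule normalizes_subgroup_mult[OF Q(1) C_subgroup nQC])
  have sub: "C \<subseteq> ?X" "?Q \<subseteq> ?X" using subset_set_mult[OF C_subgroup Q(1)] by auto
  show ?thesis
  proof (rule pi_number_indexI[OF subgroup_self pi_core_subgroup core_sub])
    fix x r i assume r: "prime r" "r \<notin> - s" and x: "x \<in> carrier G" "x [^] (r ^ i :: nat) = \<one>"
    have rs: "r \<in> s" using r(2) by simp
    have px: "pi_mod s C x" "pi_mod s {\<one>} x"
      using pi_mod_prime_power[OF r(1) rs _ x(2)] C_subgroup triv_subgroup by auto
    have conjX: "conjugate x ?Q \<subseteq> ?X"
    proof
      fix w assume "w \<in> conjugate x ?Q"
      then obtain u where u: "u \<in> ?Q" "w = x \<otimes> u \<otimes> inv x" by (rule conjugateE)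
      have uG: "u \<in> carrier G" using u(1) QG by blast
      have "u [^] (q ^ j) = \<one>" using pow_card[OF Q(1) u(1)] Q(2) by simp
      then have "pi_mod (- s) C u" using pi_mod_prime_power[OF g(1) _ C_subgroup] g(2) by simp
      then have "x \<otimes> u \<otimes> inv x \<otimes> inv u \<in> C" by (rule C_commutator[OF s x(1) uG px(1)])
      then have "(x \<otimes> u \<otimes> inv x \<otimes> inv u) \<otimes> u \<in> ?X" using u(1) by (rule mult_set_memI)
      then show "w \<in> ?X" using u(2) x(1) uG by (simp add: m_assoc)
    qed
    interpret X: finite_group "G\<lparr>carrier := ?X\<rparr>" by (rule finite_subgroup_group[OF X])
    have cQx: "subgroup (conjugate x ?Q) G" "card (conjugate x ?Q) = q ^ j"
      using conjugate_subgroup[OF Q(1) x(1)] conjugate_card[OF QG x(1)] Q(2) by auto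
    have "card (carrier G) div card ?Q = (card (carrier G) div card ?X) * (card ?X div card ?Q)"
      by (rule card_tower[OF Q(1) X subgroup_self sub(2) subgroup.subset[OF X]])
    then have "\<not> q dvd card ?X div card ?Q" using qQ by auto
    then have nd: "\<not> q dvd card (carrier (G\<lparr>carrier := ?X\<rparr>)) div card ?Q" by simp
    have "\<exists>v\<in>?X. \<forall>u\<in>conjugate x ?Q. v \<otimes> u \<otimes> inv v \<in> ?Q"
    proof (rule X.p_subgroup_conj_into[OF subgroup_incl[OF cQx(1) X conjX] cQx(2) g(1) subgroup_incl[OF Q(1) X sub(2)] nd])
      fix v assume v: "v \<in> carrier (G\<lparr>carrier := ?X\<rparr>)"
        and c: "\<And>u. u \<in> conjugate x ?Q \<Longrightarrow> v \<otimes>\<^bsub>G\<lparr>carrier := ?X\<rparr>\<^esub> u \<otimes>\<^bsub>G\<lparr>carrier := ?X\<rparr>\<^esub> inv\<^bsub>G\<lparr>carrier := ?X\<rparr>\<^esub> v \<in> ?Q"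
      have vX: "v \<in> ?X" using v by simp
      have "v \<otimes> u \<otimes> inv v \<in> ?Q" if "u \<in> conjugate x ?Q" for u
        using c[OF that] m_inv_consistent[OF X vX] by simp
      then show ?thesis using vX by blast
    qed
    then obtain v where v: "v \<in> ?X" "\<And>u. u \<in> conjugate x ?Q \<Longrightarrow> v \<otimes> u \<otimes> inv v \<in> ?Q" by blast
    have vG: "v \<in> carrier G" by (rule subgroup_carrier[OF X v(1)])
    have vx: "v \<otimes> x \<in> ?A"
    proof -
      have "(v \<otimes> x) \<otimes> u \<otimes> inv (v \<otimes> x) \<in> ?Q" if u: "u \<in> ?Q" for u
      proof -
        have "u \<in> carrier G" using u QG by blast
        then have "(v \<otimes> x) \<otimes> u \<otimes> inv (v \<otimes> x) = v \<otimes> (x \<otimes> u \<otimes> inv x) \<otimes> inv v"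
          using vG x(1) by (simp add: group_simps)
        then show ?thesis using v(2)[OF conjugate_mem[OF u]] by simp
      qed
      then show ?thesis using vG x(1) by (simp add: normalizes_def)
    qed
    obtain c u where cu: "v = c \<otimes> u" "c \<in> C" "u \<in> ?Q" using v(1) by (rule mult_set_memE)
    have G: "c \<in> carrier G" "u \<in> carrier G" using cu(2,3) CG QG by auto
    \<comment> \<open>v = cu with u in Q \<le> A, so removing u leaves the factor u^-1 c u, which is
      in C, in front of x.\<close>
    let ?a = "inv u \<otimes> (v \<otimes> x)"
    have a: "?a \<in> ?A"
      using subgroup.m_closed[OF A subgroup.m_inv_closed[OF A] vx] cu(3) QA by blast
    let ?c = "inv u \<otimes> c \<otimes> inv (inv u)"
    have c': "?c \<in> C" using normalizesD[OF C_normal _ cu(2), of "inv u"] G by simp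
    have ae: "?a = ?c \<otimes> x" unfolding cu(1) using G x(1) by (simp add: m_assoc)
    have aG: "?a \<in> carrier G" using G vG x(1) by simp
    have "pi_mod s C (?c \<otimes> x)"
      using sigma_closedD[OF C_sigma_closed block_union_block[OF s]] pi_mod_mem[OF c'] px(1) x(1) G by simp
    then have 1: "pi_mod s C ?a" unfolding ae .
    have "pi_mod (- s) {\<one>} ?a" by (rule pi_mod_of_card[OF A a cA])
    then have "pi_mod (- s) C ?a" using pi_mod_mono subgroup.one_closed[OF C_subgroup] by blast
    then have "?a \<in> C" using pi_mod_disjoint[OF C_subgroup aG 1] by simp
    then have "inv ?c \<otimes> ?a \<in> C" by (rule subgroup.m_closed[OF C_subgroup subgroup.m_inv_closed[OF C_subgroup c']])
    moreover have "inv ?c \<otimes> ?a = x" unfolding ae using G x(1) by (simp only: cancel_left m_closed inv_closed)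
    ultimately have "x \<in> C" by simp
    then show "x \<in> ?N" using C_pi_part(2)[OF s] px(2) by blast
  qed
qed

end

section \<open>The intersection of the normal complements\<close>

context embedded_group begin

definition D :: "'a set" where
  "D = {x \<in> carrier G. \<forall>s\<in>\<sigma>. \<not> noncentral s \<longrightarrow> pi_mod (- s) {\<one>} x}"

lemma D_subgroup: "subgroup D G"
proof (rule subgroupI)
  show "D \<subseteq> carrier G" by (auto simp: D_def)
  have "\<one> \<in> D" by (simp add: D_def pi_mod_mem)
  then show "D \<noteq> {}" by blast
  fix x assume x: "x \<in> D"
  then show "inv x \<in> D" using pi_mod_inv[OF triv_subgroup] by (simp add: D_def)
  fix y assume "y \<in> D"
  then show "x \<otimes> y \<in> D" using x central_complement by (simp add: D_def)
qed

lemma D_sub: "D \<subseteq> carrier G"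
  by (rule subgroup.subset[OF D_subgroup])

lemma D_normal: "normalizes (carrier G) D"
  unfolding normalizes_def
proof (intro ballI)
  fix x y assume "x \<in> carrier G" "y \<in> D"
  then show "x \<otimes> y \<otimes> inv x \<in> D"
    using pi_mod_conj[OF normalizes_one[OF subset_refl]] by (simp add: D_def)
qed

lemma D_central_block:
  assumes s: "s \<in> \<sigma>" "\<not> noncentral s" shows "pi_number (- s) (card D)"
proof (rule pi_number_card_elementI[OF D_subgroup])
  fix x p assume x: "x \<in> D" and p: "prime p" "ord x = p"
  show "p \<in> - s"
  proof
    assume ps: "p \<in> s"
    have xG: "x \<in> carrier G" and m: "pi_mod (- s) {\<one>} x" using x s by (auto simp: D_def)
    have "x [^] (p ^ 1) = \<one>" using p(2) pow_ord_eq_1[OF xG] by simp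
    then have "pi_mod s {\<one>} x" by (rule pi_mod_prime_power[OF p(1) ps triv_subgroup])
    then have "x \<in> {\<one>}" using pi_mod_disjoint[OF triv_subgroup xG _ m] by simp
    then show False using p by (auto simp: ord_id)
  qed
qed

lemma core_in_D:
  assumes s: "s \<in> \<sigma>" "noncentral s" shows "pi_core s \<subseteq> D"
proof
  fix x assume x: "x \<in> pi_core s"
  have xG: "x \<in> carrier G" using x core_sub by blast
  have "pi_mod (- t) {\<one>} x" if t: "t \<in> \<sigma>" "\<not> noncentral t" for t
  proof -
    have "s \<inter> t = {}" using disj[OF s(1) t(1)] s(2) t(2) by blast
    then show ?thesis
      using pi_mod_mono[OF pi_mod_of_card[OF pi_core_subgroup x pi_core_card], of "- t"] by blast
  qed
  then show "x \<in> D" using xG by (simp add: D_def)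
qed

lemma D_noncentral_block:
  assumes s: "s \<in> \<sigma>" "noncentral s" shows "pi_number (- s) (card (carrier G) div card D)"
proof -
  have "card (carrier G) div card (pi_core s) =
      (card (carrier G) div card D) * (card D div card (pi_core s))"
    by (rule card_tower[OF pi_core_subgroup D_subgroup subgroup_self core_in_D[OF s] D_sub])
  then show ?thesis using noncentral_hall[OF s] by simp
qed

text \<open>A core of prime order is abelian, and cores of different blocks commute because they are
  normal and meet trivially.\<close>

lemma core_in_C:
  assumes s: "s \<in> \<sigma>" "noncentral s" shows "pi_core s \<subseteq> C"
proof
  fix x assume x: "x \<in> pi_core s"
  have xG: "x \<in> carrier G" using x core_sub by blast
  have "x \<otimes> a = a \<otimes> x" if t: "t \<in> \<sigma>" and a: "a \<in> pi_core t" for t a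
  proof (cases "t = s")
    case True
    have p: "prime (card (pi_core s))" using noncentral_prime[OF s] by metis
    show ?thesis
    proof (cases "x = \<one>")
      case True then show ?thesis using a core_sub[of t] by (simp add: subset_iff)
    next
      case False
      then have "generate G {x} = pi_core s" by (rule generate_prime_card[OF pi_core_subgroup p x])
      then obtain i :: nat where i: "a = x [^] i"
        using generate_pow_on_finite_carrier[OF fin xG] a True by auto
      show ?thesis unfolding i using group_commutes_pow[OF refl xG xG, of i] by simp
    qed
  next
    case False
    then have d: "s \<inter> t = {}" using disj[OF s(1) t] by blast
    have aG: "a \<in> carrier G" using a core_sub by blast
    let ?c = "x \<otimes> a \<otimes> inv x \<otimes> inv a"
    have cG: "?c \<in> carrier G" using xG aG by simp
    have "x \<otimes> (a \<otimes> inv x \<otimes> inv a) \<in> pi_core s"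
      by (rule subgroup.m_closed[OF pi_core_subgroup x
            normalizesD[OF pi_core_normal aG subgroup.m_inv_closed[OF pi_core_subgroup x]]])
    then have c1: "?c \<in> pi_core s" using xG aG by (simp add: m_assoc)
    have c2: "?c \<in> pi_core t"
      by (rule subgroup.m_closed[OF pi_core_subgroup normalizesD[OF pi_core_normal xG a]
            subgroup.m_inv_closed[OF pi_core_subgroup a]])
    have "?c \<in> {\<one>}"
      by (rule pi_mod_disjoint[OF triv_subgroup cG pi_mod_of_card[OF pi_core_subgroup c1 pi_core_card]
            pi_mod_of_card[OF pi_core_subgroup c2 pi_core_card] d])
    then have "?c \<otimes> (a \<otimes> x) = a \<otimes> x" using xG aG by simp
    moreover have "?c \<otimes> (a \<otimes> x) = x \<otimes> a" using xG aG by (simp add: m_assoc)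
    ultimately show ?thesis by simp
  qed
  then show "x \<in> C" using xG by (simp add: C_def centralizer_def)
qed

text \<open>An element of D of p-power order lies in the core if the block of p is noncentral, the
  core being a normal Hall subgroup, and is trivial if the block is central. This excludes every
  prime from |D : D \<inter> C|, which is what the empty set of primes in the proof
  expresses.\<close>

lemma D_in_C: "D \<subseteq> C"
proof -
  have DC: "subgroup (D \<inter> C) G" by (rule subgroups_Inter_pair[OF D_subgroup C_subgroup])
  have el: "x \<in> D \<inter> C" if p: "prime p" and x: "x \<in> D" "x [^] (p ^ k :: nat) = \<one>" for p x k
  proof -
    have xG: "x \<in> carrier G" using x(1) D_sub by blast
    obtain s where s: "s \<in> \<sigma>" "p \<in> s" using cover[OF p] by blast
    show ?thesis
    proof (cases "noncentral s")
      case True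
      have "pi_mod (- s) (pi_core s) x"
        by (rule pi_mod_of_index[OF pi_core_subgroup pi_core_normal noncentral_hall[OF s(1) True] xG])
      moreover have "pi_mod s (pi_core s) x" by (rule pi_mod_prime_power[OF p s(2) pi_core_subgroup x(2)])
      ultimately have "x \<in> pi_core s" using pi_mod_disjoint[OF pi_core_subgroup xG] by blast
      then show ?thesis using core_in_C[OF s(1) True] x(1) by blast
    next
      case False
      have "pi_mod (- s) {\<one>} x" using x(1) s(1) False by (simp add: D_def)
      moreover have "pi_mod s {\<one>} x" by (rule pi_mod_prime_power[OF p s(2) triv_subgroup x(2)])
      ultimately have "x \<in> {\<one>}" using pi_mod_disjoint[OF triv_subgroup xG] by blast
      then show ?thesis using subgroup.one_closed[OF DC] by simp
    qed
  qed
  have "pi_number {} (card D div card (D \<inter> C))"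
    by (rule pi_number_indexI[OF D_subgroup DC]) (use el in auto)
  then have "card D div card (D \<inter> C) = 1" using pi_number_prime prime_factor_nat by blast
  then have "D \<inter> C = D" by (rule card_eqD[OF DC D_subgroup Int_lower1])
  then show ?thesis by blast
qed

lemma D_prime:
  assumes s: "s \<in> \<sigma>" and p: "prime p" "p dvd card D" "p \<in> s"
  shows "p = card (pi_core s)" and "\<not> p dvd card D div p"
proof -
  have nc: "noncentral s"
    using pi_number_prime[OF D_central_block[OF s] p(1,2)] p(3) by blast
  have pr: "prime (card (pi_core s))" using noncentral_prime[OF s nc] by metis
  have e: "card D = card (pi_core s) * (card D div card (pi_core s))"
    using card_mult_div[OF pi_core_subgroup D_subgroup core_in_D[OF s nc]] by simp
  have "card (carrier G) div card (pi_core s) =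
      (card (carrier G) div card D) * (card D div card (pi_core s))"
    by (rule card_tower[OF pi_core_subgroup D_subgroup subgroup_self core_in_D[OF s nc] D_sub])
  then have i: "pi_number (- s) (card D div card (pi_core s))" using noncentral_hall[OF s nc] by simp
  have np: "\<not> p dvd card D div card (pi_core s)" using pi_number_prime[OF i p(1)] p(3) by blast
  have "p dvd card (pi_core s) * (card D div card (pi_core s))" using p(2) e by simp
  then have "p dvd card (pi_core s)" using np prime_dvd_mult_iff[OF p(1)] by blast
  then show pe: "p = card (pi_core s)" using primes_dvd_imp_eq[OF p(1) pr] by blast
  show "\<not> p dvd card D div p" using np unfolding pe[symmetric] .
qed

text \<open>D is cut out by one condition for each central block s. If s \<subseteq> r, raising to
  the r-part of |G| turns any element into an s'-element; if s is disjoint from r, then x and y are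
  s'-elements themselves, and \<open>central_complement\<close> applies.\<close>

lemma D_sigma_closed: "sigma_closed \<sigma> D"
  unfolding sigma_closed_def
proof (intro allI ballI impI)
  fix r x y assume r: "block_union \<sigma> r" and x: "x \<in> carrier G" and y: "y \<in> carrier G"
    and px: "pi_mod r D x" and py: "pi_mod r D y"
  let ?a = "pi_part r (card (carrier G))"
  have n: "card (carrier G) > 0" by (rule card_pos[OF subgroup_self])
  have ra: "pi_number r ?a" by (rule pi_number_pi_part[OF n])
  have xa: "x [^] ?a \<in> D" "y [^] ?a \<in> D" using px py pi_mod_iff[OF D_subgroup] x y by auto
  have "pi_mod (- s) {\<one>} ((x \<otimes> y) [^] ?a)" if s: "s \<in> \<sigma>" "\<not> noncentral s" for s
  proof -
    have "s \<subseteq> r \<or> s \<inter> r = {}" using r s(1) by (simp add: block_union_def)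
    then show ?thesis
    proof
      assume sr: "s \<subseteq> r"
      have "((x \<otimes> y) [^] ?a) [^] pi_part (- r) (card (carrier G)) = (x \<otimes> y) [^] card (carrier G)"
        using x y pi_part_mult[OF n, of r] by (simp add: nat_pow_pow)
      also have "\<dots> = \<one>" using pow_card[OF subgroup_self] x y by simp
      finally show ?thesis
        using pi_number_mono[OF pi_number_pi_part[OF n, of "- r"], of "- s"] sr
        by (intro pi_modI[of "- s" "pi_part (- r) (card (carrier G))"]) auto
    next
      assume "s \<inter> r = {}"
      then have k: "pi_number (- s) ?a" using pi_number_mono[OF ra, of "- s"] by blast
      have "pi_mod (- s) {\<one>} (x [^] ?a)" "pi_mod (- s) {\<one>} (y [^] ?a)"
        using xa s by (auto simp: D_def)
      then have "pi_mod (- s) {\<one>} x" "pi_mod (- s) {\<one>} y"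
        using pi_mod_pow[OF triv_subgroup _ k] x y by auto
      then have "pi_mod (- s) {\<one>} (x \<otimes> y)" using central_complement[OF s x _ y] by blast
      then show ?thesis using pi_mod_pow_closed[OF triv_subgroup] x y by simp
    qed
  qed
  then have "(x \<otimes> y) [^] ?a \<in> D" using x y by (simp add: D_def)
  then show "pi_mod r D (x \<otimes> y)" using pi_mod_iff[OF D_subgroup] x y by simp
qed

end

text \<open>The clauses on the blocks meeting |D| are stated for single blocks and primes, the form
  in which they are applied; \<open>cyclic_hall_kernel_iff\<close> gives the translation.\<close>

definition (in group) cyclic_hall_kernel :: "nat set set \<Rightarrow> 'a set \<Rightarrow> bool" where
  "cyclic_hall_kernel \<sigma> D \<longleftrightarrow> D \<lhd> G \<and> (\<exists>z\<in>D. generate G {z} = D) \<and>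
     (\<forall>s\<in>\<sigma>. pi_number (- s) (card D) \<or> pi_number (- s) (card (carrier G) div card D)) \<and>
     squarefree (card D) \<and>
     (\<forall>s\<in>\<sigma>. \<forall>p q. prime p \<longrightarrow> prime q \<longrightarrow> p dvd card D \<longrightarrow> q dvd card D \<longrightarrow> p \<in> s \<longrightarrow> q \<in> s \<longrightarrow> p = q)"

lemma (in embedded_group) embedded_structure:
  "cyclic_hall_kernel \<sigma> D" "sigma_closed \<sigma> D"
proof -
  have sq: "\<not> p dvd card D div p" if p: "prime p" "p dvd card D" for p
    using cover[OF p(1)] D_prime(2)[OF _ p] by blast
  have comm: "x \<otimes> y = y \<otimes> x" if "x \<in> D" "y \<in> D" for x y
    using C_abelian D_in_C that by blast
  obtain z where z: "z \<in> D" "ord z = card D"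
    using squarefree_abelian_cyclic[OF D_subgroup comm sq] .
  have "generate G {z} = D" by (rule generate_eqI[OF D_subgroup z])
  moreover have "D \<lhd> G" using D_subgroup D_normal normal_iff_normalizes_carrier by blast
  moreover have "pi_number (- s) (card D) \<or> pi_number (- s) (card (carrier G) div card D)" if "s \<in> \<sigma>" for s
    using D_central_block[OF that] D_noncentral_block[OF that] by blast
  moreover have "squarefree (card D)"
  proof (rule squarefreeI)
    fix d :: nat assume d: "d ^ 2 dvd card D"
    show "is_unit d"
    proof (rule ccontr)
      assume "\<not> is_unit d"
      then have "d \<noteq> 1" by simp
      then obtain p where p: "prime p" "p dvd d" using prime_factor_nat by blast
      have pd: "p * p dvd card D" using mult_dvd_mono[OF p(2) p(2)] d dvd_trans by (simp add: power2_eq_square) blast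
      then obtain m where "card D = p * p * m" by (rule dvdE)
      then have m: "card D = p * (p * m)" by (simp add: mult.assoc)
      then have "card D div p = p * m" using prime_gt_0_nat[OF p(1)] by simp
      then show False using sq[OF p(1)] m by simp
    qed
  qed
  moreover have "p = q" if "s \<in> \<sigma>" "prime p" "prime q" "p dvd card D" "q dvd card D" "p \<in> s" "q \<in> s" for s p q
    using D_prime(1)[OF that(1,2,4,6)] D_prime(1)[OF that(1,3,5,7)] by simp
  ultimately show "cyclic_hall_kernel \<sigma> D" using z(1) unfolding cyclic_hall_kernel_def by blast
  show "sigma_closed \<sigma> D" by (rule D_sigma_closed)
qed

section \<open>Nilpotency\<close>

text \<open>Coordinates can be checked separately. As r is a union of blocks, a primary factor is
  either an r-group, where the r-part of |G| annihilates everything, or an r'-group, where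
  r-elements are trivial.\<close>

lemma (in finite_group) sigma_nilpotent_imp_closed:
  assumes nil: "sigma_nilpotent \<sigma> G"
  shows "sigma_closed \<sigma> {\<one>}"
proof -
  obtain n :: nat and K :: "nat \<Rightarrow> 'a monoid" where
    K: "\<And>i. i < n \<Longrightarrow> group (K i) \<and> sigma_primary \<sigma> (K i)" and iso: "G \<cong> product_group {..<n} K"
    using nil unfolding sigma_nilpotent_def by blast
  obtain \<phi> where \<phi>: "\<phi> \<in> iso G (product_group {..<n} K)" using iso by (auto simp: is_iso_def)
  have "\<forall>i. \<exists>s. i < n \<longrightarrow> s \<in> \<sigma> \<and> pi_group s (K i)" using K by (auto simp: sigma_primary_def)
  then obtain b where b: "\<And>i. i < n \<Longrightarrow> b i \<in> \<sigma> \<and> pi_group (b i) (K i)" by metis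
  have \<phi>bij: "bij_betw \<phi> (carrier G) (\<Pi>\<^sub>E i\<in>{..<n}. carrier (K i))" using \<phi> by (simp add: iso_def)
  have fK: "finite (carrier (K i))" if "i < n" for i using b[OF that] by (simp add: pi_group_def)
  have hom: "group_hom G (K i) (\<lambda>x. \<phi> x i)" if i: "i < n" for i
  proof -
    have "(\<lambda>x. \<phi> x i) \<in> hom G (K i)"
    proof (rule homI)
      fix x assume "x \<in> carrier G"
      then have "\<phi> x \<in> (\<Pi>\<^sub>E i\<in>{..<n}. carrier (K i))" using \<phi>bij by (auto simp: bij_betw_def)
      then show "\<phi> x i \<in> carrier (K i)" using i by auto
    next
      fix x y assume "x \<in> carrier G" "y \<in> carrier G"
      then have "\<phi> (x \<otimes> y) = \<phi> x \<otimes>\<^bsub>product_group {..<n} K\<^esub> \<phi> y" using \<phi> by (simp add: iso_def hom_def)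
      then show "\<phi> (x \<otimes> y) i = \<phi> x i \<otimes>\<^bsub>K i\<^esub> \<phi> y i" using i by simp
    qed
    then show ?thesis using K[OF i] by (simp add: group_hom_def group_hom_axioms_def)
  qed
  have fgK: "finite_group (K i)" if "i < n" for i
    using K[OF that] fK[OF that] by (simp add: finite_group_def finite_group_axioms_def)
  have bK: "pi_number (b i) (card (carrier (K i)))" if i: "i < n" for i
    using b[OF i] finite_group.card_pos[OF fgK[OF i] group.subgroup_self] K[OF i]
    by (simp add: pi_number_def pi_group_def order_def)
  have cK: "card (carrier (K i)) dvd card (carrier G)" if i: "i < n" for i
  proof -
    have "card (carrier G) = (\<Prod>i<n. card (carrier (K i)))"
      using bij_betw_same_card[OF \<phi>bij] by (simp add: card_PiE)
    then show ?thesis using i by (auto intro: dvd_prodI)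
  qed
  have inj: "x = \<one>" if x: "x \<in> carrier G" and c: "\<And>i. i < n \<Longrightarrow> \<phi> x i = \<one>\<^bsub>K i\<^esub>" for x
  proof -
    have "\<phi> x \<in> (\<Pi>\<^sub>E i\<in>{..<n}. carrier (K i))" "\<phi> \<one> \<in> (\<Pi>\<^sub>E i\<in>{..<n}. carrier (K i))"
      using \<phi>bij x by (auto simp: bij_betw_def)
    moreover have "\<phi> x i = \<phi> \<one> i" if "i \<in> {..<n}" for i
      using c[of i] group_hom.hom_one[OF hom[of i]] that by simp
    ultimately have "\<phi> x = \<phi> \<one>" by (rule PiE_ext)
    then show ?thesis using \<phi>bij x by (auto simp: bij_betw_def dest: inj_onD)
  qed
  show ?thesis
    unfolding sigma_closed_def
  proof (intro allI ballI impI)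
    fix r x y assume r: "block_union \<sigma> r" and x: "x \<in> carrier G" and y: "y \<in> carrier G"
      and px: "pi_mod r {\<one>} x" and py: "pi_mod r {\<one>} y"
    let ?a = "pi_part r (card (carrier G))"
    have n: "card (carrier G) > 0" by (rule card_pos[OF subgroup_self])
    have xa: "x [^] ?a = \<one>" "y [^] ?a = \<one>" using px py pi_mod_iff[OF triv_subgroup] x y by auto
    have "\<phi> ((x \<otimes> y) [^] ?a) i = \<one>\<^bsub>K i\<^esub>" if i: "i < n" for i
    proof -
      interpret Ki: finite_group "K i" by (rule fgK[OF i])
      interpret h: group_hom G "K i" "\<lambda>x. \<phi> x i" by (rule hom[OF i])
      have "b i \<subseteq> r \<or> b i \<inter> r = {}" using r b[OF i] by (simp add: block_union_def)
      then show ?thesis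
      proof
        assume "b i \<subseteq> r"
        then have "card (carrier (K i)) dvd ?a"
          using dvd_pi_part[OF n cK[OF i] pi_number_mono[OF bK[OF i]]] by simp
        then obtain m where m: "?a = card (carrier (K i)) * m" by (rule dvdE)
        have c: "\<phi> (x \<otimes> y) i \<in> carrier (K i)" using h.hom_closed x y by simp
        have "\<phi> (x \<otimes> y) i [^]\<^bsub>K i\<^esub> card (carrier (K i)) = \<one>\<^bsub>K i\<^esub>"
          by (rule Ki.pow_card[OF Ki.subgroup_self c])
        then have "\<phi> (x \<otimes> y) i [^]\<^bsub>K i\<^esub> ?a = \<one>\<^bsub>K i\<^esub>"
          unfolding m using c by (simp add: Ki.nat_pow_pow[symmetric])
        then show ?thesis using h.hom_nat_pow[of "x \<otimes> y" ?a] x y by simp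
      next
        assume d: "b i \<inter> r = {}"
        have t: "\<phi> w i = \<one>\<^bsub>K i\<^esub>" if w: "w \<in> carrier G" "w [^] ?a = \<one>" for w
        proof -
          have c: "\<phi> w i \<in> carrier (K i)" by (rule h.hom_closed[OF w(1)])
          have "\<phi> w i [^]\<^bsub>K i\<^esub> ?a = \<one>\<^bsub>K i\<^esub>" using h.hom_nat_pow[OF w(1), of ?a] w(2) h.hom_one by simp
          then have "Ki.pi_mod r {\<one>\<^bsub>K i\<^esub>} (\<phi> w i)" using pi_number_pi_part[OF n] by (intro Ki.pi_modI) simp_all
          moreover have "Ki.pi_mod (b i) {\<one>\<^bsub>K i\<^esub>} (\<phi> w i)"
            by (rule Ki.pi_mod_of_card[OF Ki.subgroup_self c bK[OF i]])
          ultimately show ?thesis using Ki.pi_mod_disjoint[OF Ki.triv_subgroup c _ _ d] by simp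
        qed
        have "\<phi> (x \<otimes> y) i = \<one>\<^bsub>K i\<^esub>" using t[OF x xa(1)] t[OF y xa(2)] h.hom_mult[OF x y] by simp
        then show ?thesis using h.hom_nat_pow[of "x \<otimes> y" ?a] x y by simp
      qed
    qed
    then have "(x \<otimes> y) [^] ?a = \<one>" using inj[of "(x \<otimes> y) [^] ?a"] x y by simp
    then show "pi_mod r {\<one>} (x \<otimes> y)" using pi_mod_iff[OF triv_subgroup] x y by simp
  qed
qed

text \<open>
  With \<open>e \<equiv> 1\<close> modulo the \<open>s\<close>-part and \<open>e \<equiv> 0\<close> modulo the \<open>s'\<close>-part of \<open>|G|\<close>, the power map
  \<open>x \<mapsto> x\<^sup>e\<close> is the projection onto the normal Hall \<open>s\<close>-subgroup.
\<close>

lemma (in finite_group) pi_projection: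
  assumes cl: "sigma_closed \<sigma> {\<one>}" and s: "block_union \<sigma> s"
  obtains e where "\<And>x y. x \<in> carrier G \<Longrightarrow> y \<in> carrier G \<Longrightarrow> (x \<otimes> y) [^] (e::nat) = x [^] e \<otimes> y [^] e"
    "\<And>x. x \<in> carrier G \<Longrightarrow> pi_mod s {\<one>} (x [^] e)"
    "\<And>p. prime p \<Longrightarrow> p \<in> s \<Longrightarrow> p dvd card (carrier G) \<Longrightarrow> \<not> p dvd e"
proof -
  let ?n = "card (carrier G)"
  let ?a = "pi_part s ?n" and ?b = "pi_part (- s) ?n"
  have n: "?n > 0" by (rule card_pos[OF subgroup_self])
  have ab: "?a * ?b = ?n" by (rule pi_part_mult[OF n])
  have cop: "coprime ?a ?b" by (rule pi_number_coprime_compl[OF pi_number_pi_part[OF n] pi_number_pi_part[OF n]])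
  have pos: "?a > 0" "?b > 0" using pi_part_pos[OF n] by auto
  obtain u v where e: "?b * u = ?a * v + 1"
    using bezout_nat[of ?b ?a] cop pos by (auto simp: coprime_iff_gcd_eq_1 gcd.commute)
  \<comment> \<open>\<open>?f\<close> is the complementary exponent: \<open>?e + ?f\<close> is
    congruent to 1 modulo |G|, so every x is the product of its powers with exponents
    \<open>?e\<close> and \<open>?f\<close>, which lie in \<open>?S\<close> and
    \<open>?T\<close>.\<close>
  obtain w t where f: "?a * w = ?b * t + 1"
    using bezout_nat[of ?a ?b] cop pos by (auto simp: coprime_iff_gcd_eq_1)
  let ?e = "?b * u" and ?f = "?a * w"
  let ?S = "{x \<in> carrier G. pi_mod s {\<one>} x}" and ?T = "{x \<in> carrier G. pi_mod (- s) {\<one>} x}"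
  have S: "subgroup ?S G"
    by (rule pi_elements_subgroup[OF triv_subgroup sigma_closedD[OF cl s] subgroup_self])
  have T: "subgroup ?T G"
    by (rule pi_elements_subgroup[OF triv_subgroup sigma_closedD[OF cl block_union_compl[OF s]] subgroup_self])
  have nS: "normalizes (carrier G) ?S" "normalizes (carrier G) ?T"
    unfolding normalizes_def using pi_mod_conj[OF normalizes_one[OF subset_refl]] by auto
  have xe: "x [^] ?e \<in> ?S" if "x \<in> carrier G" for x
  proof -
    have "(x [^] ?e) [^] ?a = (x [^] ?n) [^] u"
      using that ab by (simp add: nat_pow_pow mult.commute mult.left_commute)
    also have "\<dots> = \<one>" using pow_card[OF subgroup_self that] by simp
    finally show ?thesis using that pi_number_pi_part[OF n] by (auto intro!: pi_modI)
  qed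
  have xf: "x [^] ?f \<in> ?T" if "x \<in> carrier G" for x
  proof -
    have "(x [^] ?f) [^] ?b = (x [^] ?n) [^] w"
      using that ab by (simp add: nat_pow_pow mult.commute mult.left_commute)
    also have "\<dots> = \<one>" using pow_card[OF subgroup_self that] by simp
    finally show ?thesis using that pi_number_pi_part[OF n] by (auto intro!: pi_modI)
  qed
  have ST: "z = \<one>" if "z \<in> ?S" "z \<in> ?T" for z
    using pi_mod_disjoint[OF triv_subgroup, of z s "- s"] that by simp
  have comm: "x \<otimes> y = y \<otimes> x" if x: "x \<in> ?S" and y: "y \<in> ?T" for x y
  proof -
    have G: "x \<in> carrier G" "y \<in> carrier G" using x y by auto
    let ?c = "x \<otimes> y \<otimes> inv x \<otimes> inv y"
    have "x \<otimes> (y \<otimes> inv x \<otimes> inv y) \<in> ?S"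
      by (rule subgroup.m_closed[OF S x normalizesD[OF nS(1) G(2) subgroup.m_inv_closed[OF S x]]])
    then have "?c \<in> ?S" using G by (simp add: m_assoc)
    moreover have "?c \<in> ?T"
      by (rule subgroup.m_closed[OF T normalizesD[OF nS(2) G(1) y] subgroup.m_inv_closed[OF T y]])
    ultimately have "?c = \<one>" by (rule ST)
    then have "?c \<otimes> (y \<otimes> x) = y \<otimes> x" using G by simp
    moreover have "?c \<otimes> (y \<otimes> x) = x \<otimes> y" using G by (simp add: m_assoc)
    ultimately show ?thesis by simp
  qed
  have Se: "p [^] ?e = p" if "p \<in> ?S" for p
  proof -
    have pG: "p \<in> carrier G" using that by simp
    have "p [^] ?a = \<one>" using that pi_mod_iff[OF triv_subgroup pG] by simp
    then show ?thesis unfolding e using pG by (simp add: nat_pow_mult[symmetric] nat_pow_pow[symmetric])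
  qed
  have Te: "q [^] ?e = \<one>" if "q \<in> ?T" for q
  proof -
    have qG: "q \<in> carrier G" using that by simp
    have "q [^] ?b = \<one>" using that pi_mod_iff[OF triv_subgroup qG] by simp
    then show ?thesis using qG by (simp add: nat_pow_pow[symmetric])
  qed
  have split: "x = x [^] ?e \<otimes> x [^] ?f" if x: "x \<in> carrier G" for x
  proof -
    have "?a * (v + w) = ?b * (u + t)" using e f by (simp add: algebra_simps)
    then have "?b dvd ?a * (v + w)" by simp
    then have "?b dvd v + w" using cop by (simp add: coprime_commute coprime_dvd_mult_right_iff)
    then obtain m where "v + w = ?b * m" by (rule dvdE)
    then have "?a * (v + w) = ?n * m" using ab by (metis mult.assoc)
    then have "?e + ?f = ?n * m + 1" using e by (simp add: algebra_simps)
    then have "x [^] ?e \<otimes> x [^] ?f = x [^] (?n * m + 1)" using x by (simp add: nat_pow_mult)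
    also have "\<dots> = x" using x pow_card[OF subgroup_self x]
      by (simp add: nat_pow_mult[symmetric] nat_pow_pow[symmetric])
    finally show ?thesis by simp
  qed
  have hom: "(x \<otimes> y) [^] ?e = x [^] ?e \<otimes> y [^] ?e" if x: "x \<in> carrier G" and y: "y \<in> carrier G" for x y
  proof -
    let ?p = "x [^] ?e \<otimes> y [^] ?e" and ?q = "x [^] ?f \<otimes> y [^] ?f"
    have p: "?p \<in> ?S" by (rule subgroup.m_closed[OF S xe[OF x] xe[OF y]])
    have q: "?q \<in> ?T" by (rule subgroup.m_closed[OF T xf[OF x] xf[OF y]])
    have G: "x [^] ?e \<in> carrier G" "x [^] ?f \<in> carrier G" "y [^] ?e \<in> carrier G" "y [^] ?f \<in> carrier G"
      using x y by auto
    have "x \<otimes> y = (x [^] ?e \<otimes> x [^] ?f) \<otimes> (y [^] ?e \<otimes> y [^] ?f)" using split[OF x] split[OF y] by simp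
    also have "\<dots> = x [^] ?e \<otimes> (x [^] ?f \<otimes> y [^] ?e) \<otimes> y [^] ?f" using G by (simp add: m_assoc)
    also have "x [^] ?f \<otimes> y [^] ?e = y [^] ?e \<otimes> x [^] ?f" using comm[OF xe[OF y] xf[OF x]] by simp
    also have "x [^] ?e \<otimes> (y [^] ?e \<otimes> x [^] ?f) \<otimes> y [^] ?f = ?p \<otimes> ?q" using G by (simp add: m_assoc)
    finally have "(x \<otimes> y) [^] ?e = ?p [^] ?e \<otimes> ?q [^] ?e"
      using pow_mult_distrib[OF comm[OF p q], of ?e] p q by simp
    then show ?thesis using Se[OF p] Te[OF q] G by simp
  qed
  have np: "\<not> p dvd ?e" if p: "prime p" "p \<in> s" "p dvd ?n" for p
  proof
    assume "p dvd ?e"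
    moreover have "p dvd ?a" using dvd_pi_part[OF n p(3)] pi_number_prime_self[OF p(1)] p(2) by blast
    then have "p dvd ?a * v" by simp
    ultimately have "p dvd 1" unfolding e using dvd_add_right_iff by blast
    then show False using p(1) by simp
  qed
  show ?thesis by (rule that[of ?e]) (use hom xe np in auto)
qed

text \<open>The factors in \<open>sigma_nilpotent\<close> have type \<open>'a monoid\<close>,
  whereas \<open>G\<close> may be a record with further fields; the subgroup is repackaged as a
  plain record.\<close>

lemma (in group) subgroup_monoid_group:
  assumes H: "subgroup H G" shows "group \<lparr>carrier = H, monoid.mult = (\<otimes>), one = \<one>\<rparr>"
proof (rule groupI)
  fix x assume "x \<in> carrier \<lparr>carrier = H, monoid.mult = (\<otimes>), one = \<one>\<rparr>"
  then have "x \<in> H" by simp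
  then show "\<exists>y\<in>carrier \<lparr>carrier = H, monoid.mult = (\<otimes>), one = \<one>\<rparr>.
      y \<otimes>\<^bsub>\<lparr>carrier = H, monoid.mult = (\<otimes>), one = \<one>\<rparr>\<^esub> x = \<one>\<^bsub>\<lparr>carrier = H, monoid.mult = (\<otimes>), one = \<one>\<rparr>\<^esub>"
    using subgroup.m_inv_closed[OF H, of x] subgroup_carrier[OF H, of x] by (intro bexI[of _ "inv x"]) simp_all
qed (simp_all add: subgroup.m_closed[OF H] subgroup.one_closed[OF H] subgroup_carrier[OF H] m_assoc)

lemma pairwise_coprime_prod_dvd:
  fixes f :: "'i \<Rightarrow> nat"
  assumes "finite A" "\<And>i. i \<in> A \<Longrightarrow> f i dvd n" "\<And>i j. i \<in> A \<Longrightarrow> j \<in> A \<Longrightarrow> i \<noteq> j \<Longrightarrow> coprime (f i) (f j)"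
  shows "(\<Prod>i\<in>A. f i) dvd n"
  using assms
proof (induction A rule: finite_induct)
  case (insert a A)
  have "coprime (f a) (\<Prod>i\<in>A. f i)" using insert by (intro prod_coprime_right) auto
  then have "f a * (\<Prod>i\<in>A. f i) dvd n" using insert by (intro divides_mult) auto
  then show ?case using insert by simp
qed simp

lemma finite_sigma_of:
  assumes disj: "\<And>s t. s \<in> \<sigma> \<Longrightarrow> t \<in> \<sigma> \<Longrightarrow> s \<noteq> t \<Longrightarrow> s \<inter> t = {}"
  shows "finite (sigma_of \<sigma> n)"
proof -
  define g where "g s = (SOME p. p \<in> s \<inter> prime_factors n)" for s
  have g: "g s \<in> s \<inter> prime_factors n" if "s \<in> sigma_of \<sigma> n" for s
  proof -
    have "\<exists>p. p \<in> s \<inter> prime_factors n" using that by (auto simp: sigma_of_def)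
    then show ?thesis unfolding g_def by (rule someI_ex)
  qed
  have "inj_on g (sigma_of \<sigma> n)"
  proof
    fix s t assume st: "s \<in> sigma_of \<sigma> n" "t \<in> sigma_of \<sigma> n" "g s = g t"
    have "g s \<in> s" "g s \<in> t" using g[OF st(1)] g[OF st(2)] st(3) by auto
    then have "g s \<in> s \<inter> t" by blast
    moreover have "s \<in> \<sigma>" "t \<in> \<sigma>" using st(1,2) by (auto simp: sigma_of_def)
    ultimately show "s = t" using disj[of s t] by blast
  qed
  moreover have "g ` sigma_of \<sigma> n \<subseteq> prime_factors n" using g by blast
  ultimately show ?thesis by (rule inj_on_finite) simp
qed

text \<open>The isomorphism sends x to the family of its projections x^(e i). It is injective since
  a prime dividing the order of x belongs to some block and does not divide the exponent for that
  block; it is onto by counting, because the pairwise coprime orders of the factors have a product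
  dividing |G|.\<close>

lemma (in finite_group) closed_imp_sigma_nilpotent:
  assumes cover: "\<And>p. prime p \<Longrightarrow> \<exists>s\<in>\<sigma>. p \<in> s" and disj: "\<And>s t. s \<in> \<sigma> \<Longrightarrow> t \<in> \<sigma> \<Longrightarrow> s \<noteq> t \<Longrightarrow> s \<inter> t = {}"
    and cl: "sigma_closed \<sigma> {\<one>}"
  shows "sigma_nilpotent \<sigma> G"
proof -
  let ?B = "sigma_of \<sigma> (card (carrier G))"
  obtain b where b: "bij_betw b {0..<card ?B} ?B"
    using ex_bij_betw_nat_finite[OF finite_sigma_of[OF disj]] by blast
  define n where "n = card ?B"
  have n0: "card (carrier G) > 0" by (rule card_pos[OF subgroup_self])
  have bB: "b i \<in> ?B" "b i \<in> \<sigma>" if "i < n" for i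
  proof -
    show "b i \<in> ?B" using bij_betw_apply[OF b, of i] that by (simp add: n_def)
    then show "b i \<in> \<sigma>" by (simp add: sigma_of_def)
  qed
  have bu: "block_union \<sigma> (b i)" if "i < n" for i
    using disj bB(2)[OF that] by (auto simp: block_union_def)
  let ?S = "\<lambda>i. {x \<in> carrier G. pi_mod (b i) {\<one>} x}"
  have S: "subgroup (?S i) G" if "i < n" for i
    by (rule pi_elements_subgroup[OF triv_subgroup sigma_closedD[OF cl bu[OF that]] subgroup_self])
  define K :: "nat \<Rightarrow> 'a monoid" where "K i = \<lparr>carrier = ?S i, monoid.mult = (\<otimes>), one = \<one>\<rparr>" for i
  have KG: "group (K i)" if "i < n" for i
    unfolding K_def by (rule subgroup_monoid_group[OF S[OF that]])
  have cS: "pi_number (b i) (card (?S i))" if i: "i < n" for i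
  proof (rule pi_number_card_elementI[OF S[OF i]])
    fix x p assume x: "x \<in> ?S i" and p: "prime p" "ord x = p"
    show "p \<in> b i"
    proof (rule ccontr)
      assume ps: "p \<notin> b i"
      have xG: "x \<in> carrier G" using x by simp
      have "x [^] (p ^ 1) = \<one>" using p(2) pow_ord_eq_1[OF xG] by simp
      then have "pi_mod (- b i) {\<one>} x"
        using pi_mod_prime_power[OF p(1) _ triv_subgroup, of "- b i" x 1] ps by simp
      then have "x \<in> {\<one>}" using pi_mod_disjoint[OF triv_subgroup xG, of "b i" "- b i"] x by simp
      then have "ord x = 1" by (simp add: ord_id)
      then show False using p by simp
    qed
  qed
  have prim: "sigma_primary \<sigma> (K i)" if i: "i < n" for i
    unfolding sigma_primary_def
    using bB(2)[OF i] cS[OF i] subgroup_finite[OF S[OF i]]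
    by (intro bexI[of _ "b i"]) (auto simp: pi_group_def K_def order_def pi_number_def)
  have "\<forall>i. \<exists>e. i < n \<longrightarrow> (\<forall>x\<in>carrier G. \<forall>y\<in>carrier G. (x \<otimes> y) [^] (e::nat) = x [^] e \<otimes> y [^] e) \<and>
      (\<forall>x\<in>carrier G. pi_mod (b i) {\<one>} (x [^] e)) \<and>
      (\<forall>p. prime p \<longrightarrow> p \<in> b i \<longrightarrow> p dvd card (carrier G) \<longrightarrow> \<not> p dvd e)"
  proof
    fix i
    show "\<exists>e. i < n \<longrightarrow> (\<forall>x\<in>carrier G. \<forall>y\<in>carrier G. (x \<otimes> y) [^] (e::nat) = x [^] e \<otimes> y [^] e) \<and>
      (\<forall>x\<in>carrier G. pi_mod (b i) {\<one>} (x [^] e)) \<and>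
      (\<forall>p. prime p \<longrightarrow> p \<in> b i \<longrightarrow> p dvd card (carrier G) \<longrightarrow> \<not> p dvd e)"
    proof (cases "i < n")
      case True
      show ?thesis
      proof (rule pi_projection[OF cl bu[OF True]])
        fix e :: nat
        assume "\<And>x y. x \<in> carrier G \<Longrightarrow> y \<in> carrier G \<Longrightarrow> (x \<otimes> y) [^] e = x [^] e \<otimes> y [^] e"
          "\<And>x. x \<in> carrier G \<Longrightarrow> pi_mod (b i) {\<one>} (x [^] e)"
          "\<And>p. prime p \<Longrightarrow> p \<in> b i \<Longrightarrow> p dvd card (carrier G) \<Longrightarrow> \<not> p dvd e"
        then show ?thesis by blast
      qed
    qed simp
  qed
  from choice[OF this] obtain e where e0: "\<forall>i. i < n \<longrightarrow>
      (\<forall>x\<in>carrier G. \<forall>y\<in>carrier G. (x \<otimes> y) [^] (e i::nat) = x [^] e i \<otimes> y [^] e i) \<and>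
      (\<forall>x\<in>carrier G. pi_mod (b i) {\<one>} (x [^] e i)) \<and>
      (\<forall>p. prime p \<longrightarrow> p \<in> b i \<longrightarrow> p dvd card (carrier G) \<longrightarrow> \<not> p dvd e i)" ..
  have e: "\<And>i. i < n \<Longrightarrow> \<forall>x\<in>carrier G. \<forall>y\<in>carrier G. (x \<otimes> y) [^] (e i::nat) = x [^] e i \<otimes> y [^] e i"
    "\<And>i. i < n \<Longrightarrow> \<forall>x\<in>carrier G. pi_mod (b i) {\<one>} (x [^] e i)"
    "\<And>i. i < n \<Longrightarrow> \<forall>p. prime p \<longrightarrow> p \<in> b i \<longrightarrow> p dvd card (carrier G) \<longrightarrow> \<not> p dvd e i"
    using e0 by simp_all
  let ?P = "product_group {..<n} K"
  define \<Phi> where "\<Phi> x = (\<lambda>i\<in>{..<n}. x [^] e i)" for x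
  have \<Phi>c: "\<Phi> x \<in> carrier ?P" if "x \<in> carrier G" for x
    using that e(2) by (auto simp: \<Phi>_def K_def)
  have "\<Phi> \<in> hom G ?P"
  proof (rule homI)
    show "\<Phi> (x \<otimes> y) = \<Phi> x \<otimes>\<^bsub>?P\<^esub> \<Phi> y" if "x \<in> carrier G" "y \<in> carrier G" for x y
      using that e(1) by (auto simp: \<Phi>_def K_def fun_eq_iff)
  qed (rule \<Phi>c)
  moreover have inj: "inj_on \<Phi> (carrier G)"
  proof -
    have triv: "x = \<one>" if x: "x \<in> carrier G" and k: "\<And>i. i < n \<Longrightarrow> x [^] e i = \<one>" for x
    proof (rule ccontr)
      assume "x \<noteq> \<one>"
      then have "ord x \<noteq> 1" using ord_eq_1[OF x] by simp
      then obtain p where p: "prime p" "p dvd ord x" using prime_factor_nat by blast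
      have pn: "p dvd card (carrier G)" using p(2) ord_dvd_card[OF subgroup_self x] dvd_trans by blast
      obtain s where s: "s \<in> \<sigma>" "p \<in> s" using cover[OF p(1)] by blast
      have "p \<in> prime_factors (card (carrier G))" using p(1) pn n0 by (simp add: in_prime_factors_iff)
      then have "s \<in> ?B" using s by (auto simp: sigma_of_def)
      then have "s \<in> b ` {0..<n}" using b by (simp add: bij_betw_def n_def)
      then obtain i where i: "i < n" "s = b i" by auto
      have "p dvd e i" using k[OF i(1)] pow_eq_id[OF x] p(2) dvd_trans by blast
      then show False using e(3)[OF i(1)] p(1) s(2) i(2) pn by blast
    qed
    show ?thesis
    proof
      fix x y assume xy: "x \<in> carrier G" "y \<in> carrier G" "\<Phi> x = \<Phi> y"
      have "(x \<otimes> inv y) [^] e i = \<one>" if i: "i < n" for i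
      proof -
        have "x [^] e i = y [^] e i" using fun_cong[OF xy(3), of i] i by (simp add: \<Phi>_def)
        moreover have "(y \<otimes> inv y) [^] e i = y [^] e i \<otimes> inv y [^] e i" using e(1)[OF i] xy(2) by blast
        moreover have "(x \<otimes> inv y) [^] e i = x [^] e i \<otimes> inv y [^] e i" using e(1)[OF i] xy(1,2) by blast
        ultimately show ?thesis using xy(2) by simp
      qed
      then have "x \<otimes> inv y = \<one>" using triv[of "x \<otimes> inv y"] xy(1,2) by simp
      then have "x \<otimes> inv y \<otimes> y = y" using xy(2) by simp
      then show "x = y" using xy(1,2) by (simp add: m_assoc)
    qed
  qed
  moreover have "\<Phi> ` carrier G = carrier ?P"
  proof (rule card_seteq)
    have fS: "finite (carrier (K i))" if "i < n" for i using subgroup_finite[OF S[OF that]] by (simp add: K_def)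
    then show "finite (carrier ?P)" by (auto intro: finite_PiE)
    show "\<Phi> ` carrier G \<subseteq> carrier ?P" using \<Phi>c by blast
    have "card (carrier ?P) = (\<Prod>i<n. card (?S i))" by (simp add: card_PiE K_def)
    also have "\<dots> dvd card (carrier G)"
    proof (rule pairwise_coprime_prod_dvd)
      fix i j assume ij: "i \<in> {..<n}" "j \<in> {..<n}" "i \<noteq> j"
      then have lt: "i < n" "j < n" by auto
      have "inj_on b {0..<n}" using b by (simp add: bij_betw_def n_def)
      then have "b i \<noteq> b j" using ij lt by (simp add: inj_on_eq_iff)
      then have "b i \<inter> b j = {}" by (rule disj[OF bB(2)[OF lt(1)] bB(2)[OF lt(2)]])
      then show "coprime (card (?S i)) (card (?S j))"
        using pi_number_coprime[OF cS cS] ij(1,2) by simp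
    next
      fix i assume "i \<in> {..<n}"
      then have "i < n" by simp
      then show "card (?S i) dvd card (carrier G)"
        by (intro card_dvd[OF S subgroup_self]) auto
    qed simp
    finally have "card (carrier ?P) \<le> card (carrier G)" using n0 by (rule dvd_imp_le)
    then show "card (carrier ?P) \<le> card (\<Phi> ` carrier G)" using card_image[OF inj] by simp
  qed
  ultimately have "\<Phi> \<in> iso G ?P" by (simp add: iso_def bij_betw_def)
  then have "G \<cong> ?P" by (rule is_isoI)
  then show ?thesis unfolding sigma_nilpotent_def using KG prim by blast
qed

section \<open>Residual, quotients and complements\<close>

lemma (in group) sigma_closedI:
  assumes "\<And>s x y. block_union \<sigma> s \<Longrightarrow> x \<in> carrier G \<Longrightarrow> y \<in> carrier G \<Longrightarrow>
    pi_mod s Y x \<Longrightarrow> pi_mod s Y y \<Longrightarrow> pi_mod s Y (x \<otimes> y)"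
  shows "sigma_closed \<sigma> Y"
  unfolding sigma_closed_def using assms by blast

context finite_group begin

lemma quotient_sigma_closed_iff:
  assumes Y: "Y \<lhd> G"
  shows "group.sigma_closed (G Mod Y) \<sigma> {\<one>\<^bsub>G Mod Y\<^esub>} \<longleftrightarrow> sigma_closed \<sigma> Y"
proof -
  interpret N: normal Y G by (rule Y)
  interpret Q: group "G Mod Y" by (rule N.factorgroup_is_group)
  have YG: "subgroup Y G" by (rule N.is_subgroup)
  have pm: "Q.pi_mod s {\<one>\<^bsub>G Mod Y\<^esub>} (Y #> x) \<longleftrightarrow> pi_mod s Y x" if x: "x \<in> carrier G" for x s
  proof -
    have "(Y #> x) [^]\<^bsub>G Mod Y\<^esub> k = Y \<longleftrightarrow> x [^] k \<in> Y" for k :: nat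
    proof -
      have "(Y #> x) [^]\<^bsub>G Mod Y\<^esub> k = Y #> x [^] k" by (rule N.FactGroup_pow[OF x])
      moreover have "Y #> x [^] k = Y \<longleftrightarrow> x [^] k \<in> Y"
        using coset_join1[of Y "x [^] k"] coset_join2[of "x [^] k" Y] x YG N.subset by auto
      ultimately show ?thesis by simp
    qed
    then show ?thesis by (simp add: Q.pi_mod_def pi_mod_def)
  qed
  have m: "(Y #> x) \<otimes>\<^bsub>G Mod Y\<^esub> (Y #> y) = Y #> (x \<otimes> y)" if "x \<in> carrier G" "y \<in> carrier G" for x y
    using N.rcos_sum[OF that] by simp
  show ?thesis
  proof
    assume cl: "Q.sigma_closed \<sigma> {\<one>\<^bsub>G Mod Y\<^esub>}"
    show "sigma_closed \<sigma> Y" unfolding sigma_closed_def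
    proof (intro allI ballI impI)
      fix s x y assume s: "block_union \<sigma> s" and x: "x \<in> carrier G" and y: "y \<in> carrier G"
        and p: "pi_mod s Y x" "pi_mod s Y y"
      have "Q.pi_mod s {\<one>\<^bsub>G Mod Y\<^esub>} ((Y #> x) \<otimes>\<^bsub>G Mod Y\<^esub> (Y #> y))"
        by (rule Q.sigma_closedD[OF cl s]) (use x y p pm in \<open>auto simp: carrier_FactGroup\<close>)
      then show "pi_mod s Y (x \<otimes> y)" using m[OF x y] pm[of "x \<otimes> y"] x y by simp
    qed
  next
    assume cl: "sigma_closed \<sigma> Y"
    show "Q.sigma_closed \<sigma> {\<one>\<^bsub>G Mod Y\<^esub>}" unfolding Q.sigma_closed_def
    proof (intro allI ballI impI)
      fix s X Z assume s: "block_union \<sigma> s" and X: "X \<in> carrier (G Mod Y)" and Z: "Z \<in> carrier (G Mod Y)"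
        and p: "Q.pi_mod s {\<one>\<^bsub>G Mod Y\<^esub>} X" "Q.pi_mod s {\<one>\<^bsub>G Mod Y\<^esub>} Z"
      obtain x z where x: "x \<in> carrier G" "X = Y #> x" and z: "z \<in> carrier G" "Z = Y #> z"
        using X Z by (auto simp: carrier_FactGroup)
      have "pi_mod s Y (x \<otimes> z)"
        by (rule sigma_closedD[OF cl s x(1) z(1)]) (use p pm x z in auto)
      then show "Q.pi_mod s {\<one>\<^bsub>G Mod Y\<^esub>} (X \<otimes>\<^bsub>G Mod Y\<^esub> Z)"
        using m[OF x(1) z(1)] pm[of "x \<otimes> z"] x z by simp
    qed
  qed
qed

lemma subgroup_sigma_closed_iff:
  assumes M: "subgroup M G"
  shows "group.sigma_closed (G\<lparr>carrier := M\<rparr>) \<sigma> {\<one>} \<longleftrightarrow>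
    (\<forall>s. block_union \<sigma> s \<longrightarrow> (\<forall>x\<in>M. \<forall>y\<in>M. pi_mod s {\<one>} x \<longrightarrow> pi_mod s {\<one>} y \<longrightarrow> pi_mod s {\<one>} (x \<otimes> y)))"
proof -
  interpret M: group "G\<lparr>carrier := M\<rparr>" by (rule subgroup_imp_group[OF M])
  have "M.pi_mod s {\<one>} x = pi_mod s {\<one>} x" for s x
    by (simp add: M.pi_mod_def pi_mod_def nat_pow_consistent[symmetric])
  then show ?thesis by (simp add: M.sigma_closed_def)
qed

end

section \<open>Nilpotent quotients and complements, the residual, and Hall conditions in terms of
  blocks\<close>

locale sigma_group = finite_group +
  fixes \<sigma> :: "nat set set"
  assumes partition: "partition_on {p :: nat. Factorial_Ring.prime p} \<sigma>"
begin

lemma cover: "prime p \<Longrightarrow> \<exists>s\<in>\<sigma>. p \<in> s"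
  using partition by (auto simp: partition_on_def)

lemma disj: "s \<in> \<sigma> \<Longrightarrow> t \<in> \<sigma> \<Longrightarrow> s \<noteq> t \<Longrightarrow> s \<inter> t = {}"
  using partition by (simp add: partition_on_def disjoint_def)

lemma nilpotent_iff_closed: "sigma_nilpotent \<sigma> G \<longleftrightarrow> sigma_closed \<sigma> {\<one>}"
  using sigma_nilpotent_imp_closed closed_imp_sigma_nilpotent[OF cover disj] by blast

lemma quotient_nilpotent_iff:
  assumes Y: "Y \<lhd> G" shows "sigma_nilpotent \<sigma> (G Mod Y) \<longleftrightarrow> sigma_closed \<sigma> Y"
proof -
  interpret N: normal Y G by (rule Y)
  interpret Q: sigma_group "G Mod Y" \<sigma>
    using N.factorgroup_is_group fin partition
    by (simp add: sigma_group_def sigma_group_axioms_def finite_group_def finite_group_axioms_def carrier_FactGroup)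
  show ?thesis using Q.nilpotent_iff_closed quotient_sigma_closed_iff[OF Y] by simp
qed

lemma subgroup_nilpotent_iff:
  assumes M: "subgroup M G"
  shows "sigma_nilpotent \<sigma> (G\<lparr>carrier := M\<rparr>) \<longleftrightarrow>
    (\<forall>s. block_union \<sigma> s \<longrightarrow> (\<forall>x\<in>M. \<forall>y\<in>M. pi_mod s {\<one>} x \<longrightarrow> pi_mod s {\<one>} y \<longrightarrow> pi_mod s {\<one>} (x \<otimes> y)))"
proof -
  interpret M: sigma_group "G\<lparr>carrier := M\<rparr>" \<sigma>
    using finite_subgroup_group[OF M] partition by (simp add: sigma_group_def sigma_group_axioms_def)
  show ?thesis using M.nilpotent_iff_closed subgroup_sigma_closed_iff[OF M] by simp
qed

lemma complement_nilpotent: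
  assumes M: "subgroup M G" and D: "D \<lhd> G" "D \<inter> M = {\<one>}" and cl: "sigma_closed \<sigma> D"
  shows "sigma_nilpotent \<sigma> (G\<lparr>carrier := M\<rparr>)"
  unfolding subgroup_nilpotent_iff[OF M]
proof (intro allI impI ballI)
  have DG: "subgroup D G" using D(1) normal_imp_subgroup by blast
  fix s x y assume s: "block_union \<sigma> s" and x: "x \<in> M" and y: "y \<in> M"
    and p: "pi_mod s {\<one>} x" "pi_mod s {\<one>} y"
  have G: "x \<in> carrier G" "y \<in> carrier G" using x y subgroup_carrier[OF M] by auto
  have "pi_mod s D x" "pi_mod s D y"
    using p pi_mod_mono[of s "{\<one>}" _ s D] subgroup.one_closed[OF DG] by auto
  then have "pi_mod s D (x \<otimes> y)" by (rule sigma_closedD[OF cl s G])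
  then obtain k where k: "pi_number s k" "(x \<otimes> y) [^] k \<in> D" by (auto simp: pi_mod_def)
  moreover have "(x \<otimes> y) [^] k \<in> M"
    using subgroup_pow_closed[OF M subgroup.m_closed[OF M x y]] .
  ultimately have "(x \<otimes> y) [^] k \<in> {\<one>}" using D(2) by blast
  then show "pi_mod s {\<one>} (x \<otimes> y)" using k(1) by (rule pi_modI[rotated])
qed

lemma coset_pow:
  assumes D: "D \<lhd> G" and d: "d \<in> D" and m: "m \<in> carrier G"
  shows "\<exists>d'\<in>D. (d \<otimes> m) [^] (k::nat) = d' \<otimes> m [^] k"
proof (induction k)
  case 0
  show ?case using subgroup.one_closed[OF normal_imp_subgroup[OF D]] by (intro bexI[of _ \<one>]) simp_all
next
  case (Suc k)
  have DG: "subgroup D G" and nD: "normalizes (carrier G) D" using D normal_iff_normalizes_carrier by auto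
  obtain d' where d': "d' \<in> D" "(d \<otimes> m) [^] k = d' \<otimes> m [^] k" using Suc by blast
  have e: "m [^] k \<otimes> d \<otimes> inv (m [^] k) \<in> D" using normalizesD[OF nD _ d] m by simp
  have G: "d \<in> carrier G" "d' \<in> carrier G" using d d'(1) subgroup_carrier[OF DG] by auto
  have "(d \<otimes> m) [^] Suc k = (d' \<otimes> (m [^] k \<otimes> d \<otimes> inv (m [^] k))) \<otimes> m [^] Suc k"
    using d'(2) G m by (simp add: m_assoc)
  then show ?case using subgroup.m_closed[OF DG d'(1) e] by blast
qed

text \<open>M is isomorphic to G/D; on elements, \<open>coset_pow\<close> separates the D-factor
  from every power of dm, so s-elements modulo D project to s-elements of M.\<close>

lemma complement_nilpotent_closed:
  assumes M: "subgroup M G" and D: "D \<lhd> G" "D \<inter> M = {\<one>}" "D <#> M = carrier G"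
    and nil: "sigma_nilpotent \<sigma> (G\<lparr>carrier := M\<rparr>)"
  shows "sigma_closed \<sigma> D"
  unfolding sigma_closed_def
proof (intro allI ballI impI)
  have DG: "subgroup D G" and nD: "normalizes (carrier G) D" using D normal_iff_normalizes_carrier by auto
  fix s x y assume s: "block_union \<sigma> s" and x: "x \<in> carrier G" and y: "y \<in> carrier G"
    and p: "pi_mod s D x" "pi_mod s D y"
  have proj: "pi_mod s {\<one>} m" if dm: "d \<in> D" "m \<in> M" "pi_mod s D (d \<otimes> m)" for d m
  proof -
    have mG: "m \<in> carrier G" by (rule subgroup_carrier[OF M dm(2)])
    obtain k where k: "pi_number s k" "(d \<otimes> m) [^] k \<in> D" using dm(3) by (auto simp: pi_mod_def)
    obtain d' where d': "d' \<in> D" "(d \<otimes> m) [^] k = d' \<otimes> m [^] k" using coset_pow[OF D(1) dm(1) mG] by blast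
    have "inv d' \<otimes> (d' \<otimes> m [^] k) \<in> D"
      using k(2) unfolding d'(2) by (rule subgroup.m_closed[OF DG subgroup.m_inv_closed[OF DG d'(1)]])
    then have "m [^] k \<in> D" using mG subgroup_carrier[OF DG d'(1)] by simp
    moreover have "m [^] k \<in> M" by (rule subgroup_pow_closed[OF M dm(2)])
    ultimately have "m [^] k \<in> {\<one>}" using D(2) by blast
    then show ?thesis using k(1) by (rule pi_modI[rotated])
  qed
  have "x \<in> D <#> M" "y \<in> D <#> M" using x y D(3) by simp_all
  then obtain d m d2 m2 where dm: "x = d \<otimes> m" "d \<in> D" "m \<in> M"
    and dm2: "y = d2 \<otimes> m2" "d2 \<in> D" "m2 \<in> M" by (elim mult_set_memE)
  have G: "d \<in> carrier G" "m \<in> carrier G" "d2 \<in> carrier G" "m2 \<in> carrier G"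
    using dm dm2 subgroup_carrier[OF DG] subgroup_carrier[OF M] by auto
  have "pi_mod s {\<one>} m" "pi_mod s {\<one>} m2" using proj[OF dm(2,3)] proj[OF dm2(2,3)] p dm(1) dm2(1) by auto
  then have "pi_mod s {\<one>} (m \<otimes> m2)"
    using nil s dm(3) dm2(3) unfolding subgroup_nilpotent_iff[OF M] by blast
  then obtain k where k: "pi_number s k" "(m \<otimes> m2) [^] k = \<one>" by (auto simp: pi_mod_def)
  let ?d = "d \<otimes> (m \<otimes> d2 \<otimes> inv m)"
  have d: "?d \<in> D" by (rule subgroup.m_closed[OF DG dm(2) normalizesD[OF nD G(2) dm2(2)]])
  have "x \<otimes> y = ?d \<otimes> (m \<otimes> m2)" unfolding dm(1) dm2(1) using G by (simp add: m_assoc)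
  moreover obtain d' where d': "d' \<in> D" "(?d \<otimes> (m \<otimes> m2)) [^] k = d' \<otimes> (m \<otimes> m2) [^] k"
    using coset_pow[OF D(1) d, of "m \<otimes> m2" k] G by auto
  ultimately have "(x \<otimes> y) [^] k \<in> D" using k(2) subgroup_carrier[OF DG d'(1)] d'(1) by simp
  then show "pi_mod s D (x \<otimes> y)" using k(1) by (rule pi_modI[rotated])
qed

lemma residual_eq: "sigma_nilpotent_residual \<sigma> G = \<Inter>{N. N \<lhd> G \<and> sigma_closed \<sigma> N}"
proof -
  have "{N. N \<lhd> G \<and> sigma_nilpotent \<sigma> (G Mod N)} = {N. N \<lhd> G \<and> sigma_closed \<sigma> N}"
    using quotient_nilpotent_iff by blast
  then show ?thesis by (simp add: sigma_nilpotent_residual_def)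
qed

lemma sigma_closed_carrier: "sigma_closed \<sigma> (carrier G)"
  by (auto simp: sigma_closed_def intro: pi_mod_mem)

text \<open>The uniform exponent shows that closure passes to the intersection, in place of
  embedding G modulo an intersection into the product of the quotients. So the residual is itself
  the least normal subgroup with \<sigma>-nilpotent quotient.\<close>

lemma residual:
  shows residual_normal: "sigma_nilpotent_residual \<sigma> G \<lhd> G"
    and residual_closed: "sigma_closed \<sigma> (sigma_nilpotent_residual \<sigma> G)"
    and residual_least: "\<And>N. N \<lhd> G \<Longrightarrow> sigma_closed \<sigma> N \<Longrightarrow> sigma_nilpotent_residual \<sigma> G \<subseteq> N"
proof -
  let ?F = "{N. N \<lhd> G \<and> sigma_closed \<sigma> N}"
  let ?R = "\<Inter>?F"
  have FG: "carrier G \<in> ?F" using sigma_closed_carrier normal_self by simp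
  have sub: "subgroup N G" if "N \<in> ?F" for N using that normal_imp_subgroup by blast
  have R: "subgroup ?R G" by (rule subgroups_Inter) (use FG sub in auto)
  have "normalizes (carrier G) ?R"
    unfolding normalizes_def
  proof (intro ballI)
    fix x z assume x: "x \<in> carrier G" and z: "z \<in> ?R"
    have "x \<otimes> z \<otimes> inv x \<in> N" if "N \<in> ?F" for N
    proof -
      have "normalizes (carrier G) N" "z \<in> N" using that z normal_iff_normalizes_carrier by auto
      then show ?thesis using x by (intro normalizesD)
    qed
    then show "x \<otimes> z \<otimes> inv x \<in> ?R" by (rule InterI)
  qed
  then have n: "?R \<lhd> G" using R normal_iff_normalizes_carrier by blast
  have "sigma_closed \<sigma> ?R"
  proof (rule sigma_closedI)
    fix s x y assume s: "block_union \<sigma> s" and x: "x \<in> carrier G" and y: "y \<in> carrier G"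
      and p: "pi_mod s ?R x" "pi_mod s ?R y"
    have "(x \<otimes> y) [^] pi_part s (card (carrier G)) \<in> N" if N: "N \<in> ?F" for N
    proof -
      have RN: "?R \<subseteq> N" using N by blast
      have "pi_mod s N x" "pi_mod s N y" using p pi_mod_mono[OF _ subset_refl RN] by auto
      then have "pi_mod s N (x \<otimes> y)" using sigma_closedD[OF _ s x y] N by blast
      then show ?thesis using pi_mod_iff[OF sub[OF N]] x y by simp
    qed
    then have "(x \<otimes> y) [^] pi_part s (card (carrier G)) \<in> ?R" by blast
    then show "pi_mod s ?R (x \<otimes> y)" using pi_mod_iff[OF R] x y by simp
  qed
  then show "sigma_closed \<sigma> (sigma_nilpotent_residual \<sigma> G)" unfolding residual_eq .
  show "sigma_nilpotent_residual \<sigma> G \<lhd> G" unfolding residual_eq by (rule n)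
  show "sigma_nilpotent_residual \<sigma> G \<subseteq> N" if "N \<lhd> G" "sigma_closed \<sigma> N" for N
    unfolding residual_eq using that by blast
qed

lemma sigma_of_iff: "n > 0 \<Longrightarrow> s \<in> sigma_of \<sigma> n \<longleftrightarrow> s \<in> \<sigma> \<and> \<not> pi_number (- s) n"
  by (auto simp: sigma_of_def pi_number_def)

lemma sigma_hall_iff:
  assumes D: "subgroup D G"
  shows "sigma_hall_subgroup \<sigma> G D \<longleftrightarrow>
    (\<forall>s\<in>\<sigma>. pi_number (- s) (card D) \<or> pi_number (- s) (card (carrier G) div card D))"
proof -
  have "card (rcosets D) = card (carrier G) div card D" by (rule card_rcosets_carrier[OF D])
  moreover have "card D > 0" by (rule card_pos[OF D])
  moreover have "card (carrier G) div card D > 0"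
    by (rule card_div_pos[OF D subgroup_self subgroup.subset[OF D]])
  ultimately show ?thesis using D
    by (auto simp: sigma_hall_subgroup_def sigma_of_iff disjoint_iff)
qed

text \<open>Sending a prime to its block maps \<pi>(n) onto \<sigma>(n); the cardinalities agree
  precisely when this map is injective.\<close>

lemma card_sigma_of_iff:
  assumes n: "n > 0"
  shows "card (sigma_of \<sigma> n) = card (prime_factors n) \<longleftrightarrow>
    (\<forall>s\<in>\<sigma>. \<forall>p q. prime p \<longrightarrow> prime q \<longrightarrow> p dvd n \<longrightarrow> q dvd n \<longrightarrow> p \<in> s \<longrightarrow> q \<in> s \<longrightarrow> p = q)"
proof -
  define f where "f p = (SOME s. s \<in> \<sigma> \<and> p \<in> s)" for p
  have f: "f p \<in> \<sigma>" "p \<in> f p" if "prime p" for p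
  proof -
    have "\<exists>s. s \<in> \<sigma> \<and> p \<in> s" using cover[OF that] by blast
    then have "f p \<in> \<sigma> \<and> p \<in> f p" unfolding f_def by (rule someI_ex)
    then show "f p \<in> \<sigma>" "p \<in> f p" by auto
  qed
  have fu: "f p = s" if "prime p" "s \<in> \<sigma>" "p \<in> s" for p s
    using disj[OF f(1)[OF that(1)] that(2)] f(2)[OF that(1)] that(3) by blast
  have im: "f ` prime_factors n = sigma_of \<sigma> n"
  proof
    show "f ` prime_factors n \<subseteq> sigma_of \<sigma> n"
    proof
      fix s assume "s \<in> f ` prime_factors n"
      then obtain p where p: "p \<in> prime_factors n" "s = f p" by blast
      then have "prime p" by (simp add: in_prime_factors_iff)
      then show "s \<in> sigma_of \<sigma> n" using f[of p] p by (auto simp: sigma_of_def)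
    qed
    show "sigma_of \<sigma> n \<subseteq> f ` prime_factors n"
    proof
      fix s assume "s \<in> sigma_of \<sigma> n"
      then obtain p where p: "s \<in> \<sigma>" "p \<in> s" "p \<in> prime_factors n" by (auto simp: sigma_of_def)
      then have "prime p" by (simp add: in_prime_factors_iff)
      then have "f p = s" using fu p by blast
      then show "s \<in> f ` prime_factors n" using p(3) by blast
    qed
  qed
  have "card (sigma_of \<sigma> n) = card (prime_factors n) \<longleftrightarrow> inj_on f (prime_factors n)"
    unfolding im[symmetric] using card_image[of f] eq_card_imp_inj_on[of "prime_factors n" f] by auto
  also have "\<dots> \<longleftrightarrow> (\<forall>s\<in>\<sigma>. \<forall>p q. prime p \<longrightarrow> prime q \<longrightarrow> p dvd n \<longrightarrow> q dvd n \<longrightarrow> p \<in> s \<longrightarrow> q \<in> s \<longrightarrow> p = q)"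
  proof
    assume inj: "inj_on f (prime_factors n)"
    show "\<forall>s\<in>\<sigma>. \<forall>p q. prime p \<longrightarrow> prime q \<longrightarrow> p dvd n \<longrightarrow> q dvd n \<longrightarrow> p \<in> s \<longrightarrow> q \<in> s \<longrightarrow> p = q"
    proof (intro ballI allI impI)
      fix s p q assume *: "s \<in> \<sigma>" "prime p" "prime q" "p dvd n" "q dvd n" "p \<in> s" "q \<in> s"
      have "p \<in> prime_factors n" "q \<in> prime_factors n" using * n by (auto simp: in_prime_factors_iff)
      then show "p = q" using inj_onD[OF inj, of p q] fu[of p s] fu[of q s] * by simp
    qed
  next
    assume u: "\<forall>s\<in>\<sigma>. \<forall>p q. prime p \<longrightarrow> prime q \<longrightarrow> p dvd n \<longrightarrow> q dvd n \<longrightarrow> p \<in> s \<longrightarrow> q \<in> s \<longrightarrow> p = q"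
    show "inj_on f (prime_factors n)"
    proof
      fix p q assume pq: "p \<in> prime_factors n" "q \<in> prime_factors n" "f p = f q"
      then have *: "prime p" "prime q" "p dvd n" "q dvd n" by (auto simp: in_prime_factors_iff)
      then show "p = q" using u f[OF *(1)] f(2)[OF *(2)] pq(3) by (metis)
    qed
  qed
  finally show ?thesis .
qed

lemma cyclic_iff:
  assumes D: "subgroup D G"
  shows "cyclic_group (G\<lparr>carrier := D\<rparr>) \<longleftrightarrow> (\<exists>z\<in>D. generate G {z} = D)"
proof -
  interpret D: group "G\<lparr>carrier := D\<rparr>" by (rule subgroup_imp_group[OF D])
  have "D = range (\<lambda>n::int. z [^]\<^bsub>G\<lparr>carrier := D\<rparr>\<^esub> n) \<longleftrightarrow> generate G {z} = D" if z: "z \<in> D" for z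
  proof -
    have zG: "z \<in> carrier G" by (rule subgroup_carrier[OF D z])
    have "range (\<lambda>n::int. z [^]\<^bsub>G\<lparr>carrier := D\<rparr>\<^esub> n) = generate G {z}"
      using generate_pow[OF zG] int_pow_consistent[OF D z] by auto
    then show ?thesis by auto
  qed
  then show ?thesis using D.cyclic_group by auto
qed

lemma cyclic_hall_kernel_iff:
  "cyclic_hall_kernel \<sigma> D \<longleftrightarrow> D \<lhd> G \<and> cyclic_group (G\<lparr>carrier := D\<rparr>) \<and> sigma_hall_subgroup \<sigma> G D \<and>
    squarefree (card D) \<and> card (sigma_of \<sigma> (card D)) = card (prime_factors (card D))"
proof (cases "D \<lhd> G")
  case True
  then have D: "subgroup D G" by (rule normal_imp_subgroup)
  show ?thesis
    unfolding cyclic_hall_kernel_def sigma_hall_iff[OF D] card_sigma_of_iff[OF card_pos[OF D]] cyclic_iff[OF D]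
    by blast
qed (simp add: cyclic_hall_kernel_def)

lemma kernel_abelian:
  assumes "cyclic_hall_kernel \<sigma> D" "x \<in> D" "y \<in> D" shows "x \<otimes> y = y \<otimes> x"
proof -
  obtain z where z: "z \<in> D" "generate G {z} = D" and D: "D \<lhd> G"
    using assms(1) by (auto simp: cyclic_hall_kernel_def)
  have zG: "z \<in> carrier G" using subgroup_carrier[OF normal_imp_subgroup[OF D] z(1)] .
  show ?thesis by (rule cyclic_commute[OF zG]) (use assms(2,3) z(2) in auto)
qed

lemma kernel_coprime:
  assumes "cyclic_hall_kernel \<sigma> D" shows "coprime (card D) (card (carrier G) div card D)"
proof (rule ccontr)
  assume "\<not> ?thesis"
  then have "gcd (card D) (card (carrier G) div card D) \<noteq> 1" by (simp add: coprime_iff_gcd_eq_1)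
  then obtain p where p: "prime p" "p dvd gcd (card D) (card (carrier G) div card D)"
    using prime_factor_nat by blast
  then have p': "p dvd card D" "p dvd card (carrier G) div card D" by auto
  obtain s where s: "s \<in> \<sigma>" "p \<in> s" using cover[OF p(1)] by blast
  have "pi_number (- s) (card D) \<or> pi_number (- s) (card (carrier G) div card D)"
    using assms s(1) by (simp add: cyclic_hall_kernel_def)
  then show False using pi_number_prime[OF _ p(1)] p' s(2) by blast
qed

lemma kernel_complement:
  assumes "cyclic_hall_kernel \<sigma> D"
  obtains M where "internal_semidirect G D M"
proof -
  have D: "D \<lhd> G" using assms by (simp add: cyclic_hall_kernel_def)
  obtain M where M: "subgroup M G" "M \<inter> D = {\<one>}" "D <#> M = carrier G"
    using schur_zassenhaus_abelian[OF D kernel_abelian[OF assms] kernel_coprime[OF assms]] .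
  then have "internal_semidirect G D M" using D by (auto simp: internal_semidirect_def)
  then show ?thesis by (rule that)
qed

text \<open>Condition (iii) in terms of \<open>D\<close> alone.\<close>

definition kernel_condition :: "'a set \<Rightarrow> bool" where
  "kernel_condition D \<longleftrightarrow> cyclic_hall_kernel \<sigma> D \<and> sigma_closed \<sigma> D"

lemma kernel_condition_iff:
  "(\<exists>D M. internal_semidirect G D M \<and> cyclic_group (G\<lparr>carrier := D\<rparr>) \<and>
        sigma_hall_subgroup \<sigma> G D \<and> squarefree (card D) \<and>
        card (sigma_of \<sigma> (card D)) = card (prime_factors (card D)) \<and>
        sigma_nilpotent \<sigma> (G\<lparr>carrier := M\<rparr>)) \<longleftrightarrow> (\<exists>D. kernel_condition D)" (is "?L \<longleftrightarrow> ?R")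
proof
  assume ?L
  then obtain D M where DM: "internal_semidirect G D M" "cyclic_group (G\<lparr>carrier := D\<rparr>)"
        "sigma_hall_subgroup \<sigma> G D" "squarefree (card D)"
        "card (sigma_of \<sigma> (card D)) = card (prime_factors (card D))"
        "sigma_nilpotent \<sigma> (G\<lparr>carrier := M\<rparr>)" by blast
  have "cyclic_hall_kernel \<sigma> D"
    unfolding cyclic_hall_kernel_iff using DM by (simp add: internal_semidirect_def)
  moreover have "sigma_closed \<sigma> D"
    by (rule complement_nilpotent_closed[OF _ _ _ _ DM(6)]) (use DM(1) in \<open>auto simp: internal_semidirect_def\<close>)
  ultimately show ?R by (auto simp: kernel_condition_def)
next
  assume ?R
  then obtain D where D: "cyclic_hall_kernel \<sigma> D" "sigma_closed \<sigma> D" by (auto simp: kernel_condition_def)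
  obtain M where M: "internal_semidirect G D M" by (rule kernel_complement[OF D(1)])
  have "sigma_nilpotent \<sigma> (G\<lparr>carrier := M\<rparr>)"
    by (rule complement_nilpotent[OF _ _ _ D(2)]) (use M in \<open>auto simp: internal_semidirect_def\<close>)
  then show ?L using M D(1) unfolding cyclic_hall_kernel_iff by blast
qed

end

section \<open>The three conditions\<close>

context sigma_group begin

lemma conj_set_eq:
  assumes "H \<subseteq> carrier G" "x \<in> carrier G" shows "conj_set G H x = conjugate (inv x) H"
  using assms by (auto simp: conj_set_def conjugate_def l_coset_def r_coset_def)

lemma hall_subgroup_imp:
  assumes "hall_subgroup s G H"
  shows "subgroup H G" "pi_number s (card H)" "pi_number (- s) (card (carrier G) div card H)"
proof -
  show H: "subgroup H G" using assms by (simp add: hall_subgroup_def)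
  show "pi_number s (card H)"
    using assms card_pos[OF H] by (simp add: hall_subgroup_def pi_group_def order_def pi_number_def)
  show "pi_number (- s) (card (carrier G) div card H)"
    using assms card_div_pos[OF H subgroup_self subgroup.subset[OF H]] card_rcosets_carrier[OF H]
    by (auto simp: hall_subgroup_def pi_number_def)
qed

lemma embedded_all_embedded:
  assumes emb: "\<And>A. subgroup A G \<Longrightarrow> H_sigma_permutably_embedded \<sigma> G A"
  shows "all_embedded \<sigma> (carrier G)"
  unfolding all_embedded_def
proof (intro allI impI)
  fix A assume A: "subgroup A G" "A \<subseteq> carrier G"
  obtain E where E: "sigma_permutable \<sigma> G E" "sigma_hall_subgroup \<sigma> (G\<lparr>carrier := E\<rparr>) A"
    using emb[OF A(1)] by (auto simp: H_sigma_permutably_embedded_def)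
  obtain \<H> where EG: "subgroup E G" and \<H>: "complete_hall_sigma_set \<sigma> G \<H>"
    and perm: "\<And>H x. H \<in> \<H> \<Longrightarrow> x \<in> carrier G \<Longrightarrow> E <#> conj_set G H x = conj_set G H x <#> E"
    using E(1) by (auto simp: sigma_permutable_def)
  have AE: "subgroup A (G\<lparr>carrier := E\<rparr>)" using E(2) by (simp add: sigma_hall_subgroup_def)
  have AsE: "A \<subseteq> E" using subgroup.subset[OF AE] by simp
  interpret E: sigma_group "G\<lparr>carrier := E\<rparr>" \<sigma>
    using finite_subgroup_group[OF EG] partition by (simp add: sigma_group_def sigma_group_axioms_def)
  have 1: "\<forall>s\<in>\<sigma>. \<not> pi_number (- s) (card A) \<longrightarrow> pi_number (- s) (card E div card A)"
    using E(2) E.sigma_hall_iff[OF AE] by auto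
  have 2: "\<exists>H. hall_in s (carrier G) H \<and> permutes_conjugates (carrier G) E H" if s: "s \<in> \<sigma>" for s
  proof (cases "s \<in> sigma_of \<sigma> (order G)")
    case True
    then have "\<exists>!H. H \<in> \<H> \<and> hall_subgroup s G H" using \<H> by (simp add: complete_hall_sigma_set_def)
    then obtain H where H: "H \<in> \<H>" "hall_subgroup s G H" by blast
    note Hs = hall_subgroup_imp[OF H(2)]
    have HG: "H \<subseteq> carrier G" by (rule subgroup.subset[OF Hs(1)])
    have "E <#> conjugate x H = conjugate x H <#> E" if "x \<in> carrier G" for x
      using perm[OF H(1), of "inv x"] conj_set_eq[OF HG, of "inv x"] that by simp
    then show ?thesis using Hs HG by (auto simp: hall_in_def permutes_conjugates_def)
  next
    \<comment> \<open>A block prime to |G| need not be represented in \<open>\<H>\<close>; the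
      trivial subgroup serves as its Hall subgroup.\<close>
    case False
    have "card (carrier G) > 0" by (rule card_pos[OF subgroup_self])
    then have "pi_number (- s) (card (carrier G))" using False s sigma_of_iff by (simp add: order_def)
    then have "hall_in s (carrier G) {\<one>}" using triv_subgroup by (simp add: hall_in_def)
    moreover have "permutes_conjugates (carrier G) E {\<one>}"
      using subgroup_carrier[OF EG] by (auto simp: permutes_conjugates_def conjugate_def set_mult_def)
    ultimately show ?thesis by blast
  qed
  show "\<exists>E. subgroup E G \<and> A \<subseteq> E \<and> E \<subseteq> carrier G \<and>
        (\<forall>s\<in>\<sigma>. \<not> pi_number (- s) (card A) \<longrightarrow> pi_number (- s) (card E div card A)) \<and>
        (\<forall>s\<in>\<sigma>. \<exists>H. hall_in s (carrier G) H \<and> permutes_conjugates (carrier G) E H)"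
  proof (rule exI[of _ E], intro conjI)
    show "\<forall>s\<in>\<sigma>. \<exists>H. hall_in s (carrier G) H \<and> permutes_conjugates (carrier G) E H" using 2 by blast
  qed (use EG AsE subgroup.subset[OF EG] 1 in auto)
qed

lemma embedded_imp_kernel:
  assumes "\<And>A. subgroup A G \<Longrightarrow> H_sigma_permutably_embedded \<sigma> G A"
  shows "\<exists>D. kernel_condition D"
proof -
  interpret W: embedded_group G \<sigma>
    by unfold_locales (use cover disj embedded_all_embedded[OF assms] in blast)+
  show ?thesis using W.embedded_structure by (auto simp: kernel_condition_def)
qed

text \<open>Let T be the preimage of the set of s-elements of the \<sigma>-nilpotent group G/D, a
  normal subgroup. DH lies in T, and |T:DH| divides both the s-number |T:D| and the s'-number |G:H|,
  so DH = T.\<close>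

lemma kernel_hall_mult_normal:
  assumes D: "kernel_condition D" and s: "s \<in> \<sigma>" and H: "hall_subgroup s G H"
  shows "D <#> H = {x \<in> carrier G. pi_mod s D x}" "D <#> H \<lhd> G"
proof -
  have DN: "D \<lhd> G" and cl: "sigma_closed \<sigma> D"
    using D by (auto simp: kernel_condition_def cyclic_hall_kernel_def)
  have DG: "subgroup D G" and nD: "normalizes (carrier G) D" using DN normal_iff_normalizes_carrier by auto
  note Hs = hall_subgroup_imp[OF H]
  have HG: "H \<subseteq> carrier G" and DsG: "D \<subseteq> carrier G" using subgroup.subset Hs(1) DG by auto
  let ?T = "{x \<in> carrier G. pi_mod s D x}"
  have bu: "block_union \<sigma> s" using s disj by (auto simp: block_union_def)
  have T: "subgroup ?T G" by (rule pi_elements_subgroup[OF DG sigma_closedD[OF cl bu] subgroup_self])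
  have DT: "D \<subseteq> ?T" using DsG by (auto intro: pi_mod_mem)
  have HT: "H \<subseteq> ?T"
  proof
    fix x assume x: "x \<in> H"
    have "pi_mod s {\<one>} x" by (rule pi_mod_of_card[OF Hs(1) x Hs(2)])
    then have "pi_mod s D x" using pi_mod_mono subgroup.one_closed[OF DG] by blast
    then show "x \<in> ?T" using x HG by blast
  qed
  have DH: "subgroup (D <#> H) G" by (rule normalizes_subgroup_mult[OF Hs(1) DG normalizes_subset[OF nD HG]])
  have sub: "D \<subseteq> D <#> H" "H \<subseteq> D <#> H" using subset_set_mult[OF DG Hs(1)] by auto
  have DHT: "D <#> H \<subseteq> ?T" by (rule set_mult_subset[OF T DT HT])
  have "pi_number s (card ?T div card D)"
  proof (rule pi_number_indexI[OF T DG DT])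
    fix x p k assume p: "prime p" "p \<notin> s" and x: "x \<in> ?T" "x [^] (p ^ k :: nat) = \<one>"
    have "pi_mod (- s) D x" using pi_mod_prime_power[OF p(1) _ DG x(2)] p(2) by simp
    then show "x \<in> D" using pi_mod_disjoint[OF DG _ _ _ Compl_disjoint[of s]] x(1) by simp
  qed
  then have 1: "pi_number s (card ?T div card (D <#> H))"
    using card_tower[OF DG DH T sub(1) DHT] by simp
  have "card (carrier G) div card H =
      (card (carrier G) div card ?T) * (card ?T div card H)"
    by (rule card_tower[OF Hs(1) T subgroup_self HT subgroup.subset[OF T]])
  then have "pi_number (- s) (card ?T div card H)" using Hs(3) by simp
  then have 2: "pi_number (- s) (card ?T div card (D <#> H))"
    using card_tower[OF Hs(1) DH T sub(2) DHT] by simp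
  have "card ?T div card (D <#> H) = 1" by (rule pi_number_dvd_1[OF 1 2]) simp_all
  then show e: "D <#> H = ?T" by (rule card_eqD[OF DH T DHT])
  have "normalizes (carrier G) ?T"
    unfolding normalizes_def using pi_mod_conj[OF nD] by auto
  then show "D <#> H \<lhd> G" unfolding e using T normal_iff_normalizes_carrier by blast
qed

lemma kernel_imp_embedded:
  assumes full: "sigma_full \<sigma> G" and D: "kernel_condition D" and A: "subgroup A G"
  shows "H_sigma_permutably_embedded \<sigma> G A"
proof -
  have ker: "cyclic_hall_kernel \<sigma> D" using D by (simp add: kernel_condition_def)
  have DN: "D \<lhd> G" using ker by (simp add: cyclic_hall_kernel_def)
  have DG: "subgroup D G" and nD: "normalizes (carrier G) D" using DN normal_iff_normalizes_carrier by auto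
  have DsG: "D \<subseteq> carrier G" and AsG: "A \<subseteq> carrier G" using subgroup.subset DG A by auto
  obtain \<H> where \<H>: "complete_hall_sigma_set \<sigma> G \<H>" using full by (auto simp: sigma_full_def)
  let ?E = "A <#> D"
  have AD: "A <#> D = D <#> A" by (rule normalizes_permutes[OF A DG normalizes_subset[OF nD AsG]])
  have E: "subgroup ?E G"
    unfolding AD by (rule normalizes_subgroup_mult[OF A DG normalizes_subset[OF nD AsG]])
  have sub: "A \<subseteq> ?E" "D \<subseteq> ?E" using subset_set_mult[OF A DG] by auto
  have perm: "?E <#> conj_set G H x = conj_set G H x <#> ?E" if H: "H \<in> \<H>" and x: "x \<in> carrier G" for H x
  proof -
    have HG: "subgroup H G" using \<H> H by (simp add: complete_hall_sigma_set_def)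
    have HsG: "H \<subseteq> carrier G" by (rule subgroup.subset[OF HG])
    have "D <#> H \<lhd> G"
    \<comment> \<open>A complete Hall set may contain the trivial subgroup, to which its definition
      attaches no block.\<close>
    proof (cases "H = {\<one>}")
      case True
      have "D <#> H = D" unfolding True using DsG by (auto simp: set_mult_def subset_iff)
      then show ?thesis using DN by simp
    next
      case False
      then have "H \<in> \<H> - {{\<one>}}" using H by simp
      then obtain s where "s \<in> \<sigma>" "hall_subgroup s G H"
        using \<H> unfolding complete_hall_sigma_set_def by blast
      then show ?thesis by (rule kernel_hall_mult_normal(2)[OF D])
    qed
    then have T: "subgroup (D <#> H) G" "normalizes (carrier G) (D <#> H)"
      using normal_iff_normalizes_carrier by auto
    let ?K = "conjugate (inv x) H"
    have ix: "inv x \<in> carrier G" using x by simp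
    have K: "subgroup ?K G" by (rule conjugate_subgroup[OF HG ix])
    have KsG: "?K \<subseteq> carrier G" by (rule subgroup.subset[OF K])
    \<comment> \<open>A conjugate of H has the same product with D as H, because DH is normal; so
      both products of \<open>?E\<close> with \<open>?K\<close> are products of A with this normal
      subgroup.\<close>
    have DK: "D <#> ?K = D <#> H"
    proof -
      have "conjugate (inv x) (D <#> H) = conjugate (inv x) D <#> ?K"
        by (rule conjugate_set_mult[OF ix DsG HsG])
      moreover have "conjugate (inv x) (D <#> H) = D <#> H"
        by (rule normalizes_conjugate_eq[OF subgroup_self subgroup.subset[OF T(1)] T(2) ix])
      moreover have "conjugate (inv x) D = D"
        by (rule normalizes_conjugate_eq[OF subgroup_self DsG nD ix])
      ultimately show ?thesis by simp
    qed
    have KD: "?K <#> D = D <#> ?K" by (rule normalizes_permutes[OF K DG normalizes_subset[OF nD KsG]])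
    have "?E <#> ?K = A <#> (D <#> H)"
      using set_mult_assoc[OF AsG DsG KsG] DK by simp
    moreover have "?K <#> ?E = (D <#> H) <#> A"
      unfolding AD using set_mult_assoc[OF KsG DsG AsG] KD DK by simp
    moreover have "A <#> (D <#> H) = (D <#> H) <#> A"
      by (rule normalizes_permutes[OF A T(1) normalizes_subset[OF T(2) AsG]])
    ultimately show ?thesis using conj_set_eq[OF HsG x] by simp
  qed
  have "sigma_permutable \<sigma> G ?E" using E \<H> perm by (auto simp: sigma_permutable_def)
  moreover have "sigma_hall_subgroup \<sigma> (G\<lparr>carrier := ?E\<rparr>) A"
  proof -
    interpret E: sigma_group "G\<lparr>carrier := ?E\<rparr>" \<sigma>
      using finite_subgroup_group[OF E] partition by (simp add: sigma_group_def sigma_group_axioms_def)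
    have AI: "subgroup (A \<inter> D) G" by (rule subgroups_Inter_pair[OF A DG])
    have idx: "card ?E div card A = card D div card (A \<inter> D)" by (rule card_set_mult_div[OF A DG E])
    have cD: "card (A \<inter> D) * (card D div card (A \<inter> D)) = card D" by (rule card_mult_div[OF AI DG Int_lower2])
    have cA: "card (A \<inter> D) * (card A div card (A \<inter> D)) = card A" by (rule card_mult_div[OF AI A Int_lower1])
    \<comment> \<open>Otherwise primes p and q of s divide |A| and |AD:A| = |D : A \<inter> D|.
      Since q divides |D|, the index |G:D| is an s'-number, so p divides |A \<inter> D|, and p = q
      as |D| has only one prime in s; thus p^2 divides |D|.\<close>
    have "pi_number (- s) (card A) \<or> pi_number (- s) (card ?E div card A)" if s: "s \<in> \<sigma>" for s
    proof (rule ccontr)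
      assume no: "\<not> ?thesis"
      have pos: "card A > 0" "card D div card (A \<inter> D) > 0"
        using card_pos[OF A] card_div_pos[OF AI DG Int_lower2] by auto
      obtain p where p: "prime p" "p dvd card A" "p \<in> s"
        using no pi_numberI[OF pos(1), of "- s"] by blast
      obtain q where q: "prime q" "q dvd card D div card (A \<inter> D)" "q \<in> s"
        using no pi_numberI[OF pos(2), of "- s"] unfolding idx by blast
      have qD: "q dvd card D" using q(2) cD by (metis dvd_mult)
      have sG: "pi_number (- s) (card (carrier G) div card D)"
        using ker s pi_number_prime[of "- s" "card D" q] q(1,3) qD by (auto simp: cyclic_hall_kernel_def)
      have "p dvd card (A \<inter> D)"
      proof (rule ccontr)
        assume "\<not> p dvd card (A \<inter> D)"
        then have pA: "p dvd card A div card (A \<inter> D)" using p(1,2) cA prime_dvd_mult_iff by metis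
        have "card A div card (A \<inter> D) dvd card (carrier G) div card D"
        proof -
          have "card (D <#> A) div card D = card A div card (D \<inter> A)"
            by (rule card_set_mult_div[OF DG A]) (use E AD in simp)
          moreover have "card (carrier G) div card D = (card (carrier G) div card ?E) * (card ?E div card D)"
            by (rule card_tower[OF DG E subgroup_self sub(2) subgroup.subset[OF E]])
          ultimately show ?thesis using AD by (simp add: Int_commute)
        qed
        then have "p dvd card (carrier G) div card D" using pA dvd_trans by blast
        then show False using pi_number_prime[OF sG p(1)] p(3) by blast
      qed
      moreover have "p dvd card D" using \<open>p dvd card (A \<inter> D)\<close> cD by (metis dvd_mult2)
      then have "p = q" using ker s p q qD unfolding cyclic_hall_kernel_def by blast
      ultimately have "p * p dvd card D" using q(2) cD by (metis mult_dvd_mono)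
      then have "p ^ 2 dvd card D" by (simp add: power2_eq_square)
      moreover have "squarefree (card D)" using ker by (simp add: cyclic_hall_kernel_def)
      ultimately have "is_unit p" by (meson squarefreeD)
      then show False using p(1) by simp
    qed
    then show ?thesis using E.sigma_hall_iff[OF subgroup_incl[OF A E sub(1)]] by simp
  qed
  ultimately show ?thesis by (auto simp: H_sigma_permutably_embedded_def)
qed

end

section \<open>Sylow towers, irreducible action and centralizers of factors\<close>

context finite_group begin

text \<open>List the prime factors of n = |R| and let d i be the product of the first i of them. The
  subgroup S i generated by z^(n / d i) has order d i, and each step of the tower has prime order,
  which is the order of a Sylow subgroup because n is square-free.\<close>

lemma squarefree_cyclic_sylow_tower:
  assumes R: "subgroup R G" and z: "z \<in> R" "generate G {z} = R" and sq: "squarefree (card R)"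
  shows "has_sylow_tower (G\<lparr>carrier := R\<rparr>)"
proof -
  have zG: "z \<in> carrier G" by (rule subgroup_carrier[OF R z(1)])
  define n where "n = card R"
  have n: "n > 0" "ord z = n" using card_pos[OF R] generate_pow_card[OF zG] z(2) by (auto simp: n_def)
  obtain ps where "mset ps = prime_factorization n" using ex_mset by blast
  then have ps: "prod_list ps = n" "\<And>p. p \<in> set ps \<Longrightarrow> prime p \<and> p dvd n"
    using prod_mset_prime_factorization_nat[OF n(1)] prod_mset_prod_list[of ps]
    by (auto simp flip: set_mset_mset simp: in_prime_factors_iff)
  define d where "d i = prod_list (take i ps)" for i
  define S where "S i = generate G {z [^] (n div d i)}" for i
  have dn: "d i dvd n" for i
    using ps(1) prod_list.append[of "take i ps" "drop i ps"] by (auto simp: d_def)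
  have dpos: "d i > 0" "n div d i > 0" for i
    using dn[of i] n(1) by (auto intro: dvd_pos_nat simp: div_greater_zero_iff dvd_imp_le)
  have dS: "d (Suc i) = d i * ps ! i" if "i < length ps" for i
    using that by (simp add: d_def take_Suc_conv_app_nth)
  have SG: "subgroup (S i) G" for i unfolding S_def using zG by (intro generate_is_subgroup) simp
  have SR: "S i \<subseteq> R" for i
    unfolding S_def using subgroup_pow_closed[OF R z(1)] by (intro generate_subgroup_incl[OF _ R]) simp
  have cS: "card (S i) = d i" for i
  proof -
    have "n div d i dvd n" using dn by (metis dvd_div_mult_self dvd_triv_left)
    then have "ord (z [^] (n div d i)) = n div (n div d i)"
      using ord_pow[OF zG, of "n div d i"] n(2) dpos(2)[of i] by simp
    also have "\<dots> = d i" using dn n(1) by (metis div_div_eq_right div_self dvd_refl mult_1 not_gr0)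
    finally show ?thesis unfolding S_def using generate_pow_card zG by simp
  qed
  have comm: "x \<otimes> y = y \<otimes> x" if "x \<in> R" "y \<in> R" for x y
    by (rule cyclic_commute[OF zG]) (use that z(2) in auto)
  have nrm: "normalizes R (S i)" for i
    unfolding normalizes_def
  proof (intro ballI)
    fix x y assume x: "x \<in> R" and y: "y \<in> S i"
    have G: "x \<in> carrier G" "y \<in> carrier G" using x y subgroup_carrier R SG by blast+
    have "x \<otimes> y \<otimes> inv x = y" using comm[OF x subsetD[OF SR y]] G by (simp add: m_assoc)
    then show "x \<otimes> y \<otimes> inv x \<in> S i" using y by simp
  qed
  have step: "S i \<subset> S (Suc i)" "\<exists>p P. sylow_subgroup p (G\<lparr>carrier := R\<rparr>) P \<and>
        order (G\<lparr>carrier := S (Suc i)\<rparr> Mod S i) = card P" if i: "i < length ps" for i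
  proof -
    let ?p = "ps ! i"
    have p: "prime ?p" "?p dvd n" using ps(2) i by auto
    have "n div d i = (n div d (Suc i)) * ?p"
      using dn[of "Suc i"] dS[OF i] dpos[of i] by (auto elim!: dvdE)
    then have "z [^] (n div d i) = (z [^] (n div d (Suc i))) [^] ?p" using zG by (simp add: nat_pow_pow)
    also have "\<dots> \<in> S (Suc i)"
      by (rule subgroup_pow_closed[OF SG]) (simp add: S_def generate.incl)
    finally have sub: "S i \<subseteq> S (Suc i)" unfolding S_def[of i] by (intro generate_subgroup_incl[OF _ SG]) simp
    have "card (S i) < card (S (Suc i))" using dS[OF i] dpos(1)[of i] prime_gt_1_nat[OF p(1)] by (simp add: cS)
    then have "S i \<noteq> S (Suc i)" by (metis less_irrefl)
    with sub show "S i \<subset> S (Suc i)" by (rule psubsetI)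
    obtain x where x: "x \<in> R" "ord x = ?p" using cauchy[OF R p(1) p(2)[unfolded n_def]] .
    have xG: "x \<in> carrier G" by (rule subgroup_carrier[OF R x(1)])
    have P: "subgroup (generate G {x}) G" "generate G {x} \<subseteq> R"
      using xG x(1) generate_is_subgroup generate_subgroup_incl[OF _ R] by auto
    have m: "multiplicity ?p n = 1"
      using sq p n(1) squarefree_factorial_semiring'[of n] by (auto simp: n_def in_prime_factors_iff)
    have cP: "card (generate G {x}) = ?p" using generate_pow_card[OF xG] x(2) by simp
    have "sylow_subgroup ?p (G\<lparr>carrier := R\<rparr>) (generate G {x})"
      using p(1) subgroup_incl[OF P(1) R P(2)] m cP by (simp add: sylow_subgroup_def order_def n_def)
    moreover have "order (G\<lparr>carrier := S (Suc i)\<rparr> Mod S i) = ?p"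
      using card_rcosets[OF SG SG sub] dS[OF i] dpos(1)[of i] by (simp add: order_def FactGroup_def cS)
    ultimately show "\<exists>p P. sylow_subgroup p (G\<lparr>carrier := R\<rparr>) P \<and>
        order (G\<lparr>carrier := S (Suc i)\<rparr> Mod S i) = card P" using cP by metis
  qed
  have "S 0 = {\<one>}" using zG n(2) pow_ord_eq_1[OF zG] generate_one by (simp add: S_def d_def)
  moreover have "S (length ps) = R"
    using card_subset_eq[OF subgroup_finite[OF R] SR] cS by (simp add: d_def ps(1) n_def)
  moreover have "S i \<lhd> (G\<lparr>carrier := R\<rparr>)" for i
    using normal_iff_normalizes[OF R SG SR] nrm by simp
  ultimately show ?thesis
    unfolding has_sylow_tower_def using step by (intro exI[of _ "length ps"] exI[of _ S]) simp
qed

text \<open>The Sylow subgroup has prime order, so its only subgroups are the trivial one and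
  itself.\<close>

lemma squarefree_sylow_irreducible:
  assumes R: "subgroup R G" and sq: "squarefree (card R)" and p: "p \<in> prime_factors (card R)"
    and P: "sylow_subgroup p (G\<lparr>carrier := R\<rparr>) P"
  shows "acts_irreducibly G M P"
proof -
  have pp: "prime p" using p by (simp add: in_prime_factors_iff)
  have "multiplicity p (card R) = 1"
    using sq p card_pos[OF R] squarefree_factorial_semiring'[of "card R"] by auto
  then have cP: "card P = p" using P by (simp add: sylow_subgroup_def order_def)
  have PG: "subgroup P G" using P incl_subgroup[OF R] by (simp add: sylow_subgroup_def)
  have "Q = {\<one>} \<or> Q = P" if Q: "subgroup Q G" "Q \<subseteq> P" for Q
  proof -
    have "card Q = 1 \<or> card Q = card P"
      using card_dvd[OF Q(1) PG Q(2)] pp by (auto simp: cP prime_nat_iff)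
    then show ?thesis
    proof
      assume "card Q = 1"
      then show ?thesis using subgroup.one_closed[OF Q(1)] by (auto simp: card_1_singleton_iff)
    next
      assume "card Q = card P"
      then show ?thesis using card_subset_eq[OF subgroup_finite[OF PG] Q(2)] by simp
    qed
  qed
  moreover have "P \<noteq> {\<one>}" using cP prime_gt_1_nat[OF pp] by auto
  ultimately show ?thesis by (auto simp: acts_irreducibly_def)
qed

lemma factor_centralizer_iff:
  assumes K: "subgroup K G" and H: "subgroup H G"
  shows "g \<in> factor_centralizer G H K \<longleftrightarrow> g \<in> carrier G \<and> (\<forall>h\<in>H. g \<otimes> h \<otimes> inv g \<otimes> inv h \<in> K)"
proof -
  have "K #> a = K #> b \<longleftrightarrow> a \<otimes> inv b \<in> K" if ab: "a \<in> carrier G" "b \<in> carrier G" for a b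
  proof
    have KG: "K \<subseteq> carrier G" by (rule subgroup.subset[OF K])
    assume "K #> a = K #> b"
    then have "K #> (a \<otimes> inv b) = K" by (rule coset_mult_inv2[OF _ ab KG])
    then show "a \<otimes> inv b \<in> K" by (rule coset_join1) (use ab K in auto)
  next
    have KG: "K \<subseteq> carrier G" by (rule subgroup.subset[OF K])
    assume "a \<otimes> inv b \<in> K"
    then have "K #> (a \<otimes> inv b) = K" by (intro coset_join2) (use ab K in auto)
    then show "K #> a = K #> b" by (rule coset_mult_inv1[OF _ ab KG])
  qed
  then have "K #> (g \<otimes> h \<otimes> inv g) = K #> h \<longleftrightarrow> g \<otimes> h \<otimes> inv g \<otimes> inv h \<in> K"
    if "g \<in> carrier G" "h \<in> H" for h using subgroup_carrier[OF H] that by simp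
  then show ?thesis unfolding factor_centralizer_def by blast
qed

lemma factor_centralizer_subgroup:
  assumes K: "subgroup K G" and H: "subgroup H G" "normalizes (carrier G) H"
  shows "subgroup (factor_centralizer G H K) G"
proof (rule subgroupI)
  note iff = factor_centralizer_iff[OF K H(1)]
  note [simp] = subgroup_carrier[OF H(1)]
  show "factor_centralizer G H K \<subseteq> carrier G" by (auto simp: factor_centralizer_def)
  have "\<one> \<in> factor_centralizer G H K" using subgroup.one_closed[OF K] by (simp add: iff)
  then show "factor_centralizer G H K \<noteq> {}" by blast
  fix a assume a: "a \<in> factor_centralizer G H K"
  then have aG: "a \<in> carrier G" by (simp add: iff)
  have "inv a \<otimes> h \<otimes> a \<otimes> inv h \<in> K" if h: "h \<in> H" for h
  proof -
    let ?h = "inv a \<otimes> h \<otimes> a"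
    have h': "?h \<in> H" using normalizesD[OF H(2) _ h, of "inv a"] aG by simp
    have hG: "h \<in> carrier G" using h by simp
    have "a \<otimes> ?h \<otimes> inv a \<otimes> inv ?h \<in> K" using a h' by (simp add: iff)
    moreover have "a \<otimes> ?h \<otimes> inv a = h" using aG hG by (simp add: m_assoc)
    ultimately have "inv (h \<otimes> inv ?h) \<in> K" using subgroup.m_inv_closed[OF K] by simp
    moreover have "inv (h \<otimes> inv ?h) = ?h \<otimes> inv h" using aG hG by (simp add: inv_mult_group m_assoc)
    ultimately show ?thesis by simp
  qed
  then show "inv a \<in> factor_centralizer G H K" using aG by (simp add: iff)
  fix b assume b: "b \<in> factor_centralizer G H K"
  then have bG: "b \<in> carrier G" by (simp add: iff)
  have "a \<otimes> b \<otimes> h \<otimes> inv (a \<otimes> b) \<otimes> inv h \<in> K" if h: "h \<in> H" for h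
  proof -
    let ?h = "b \<otimes> h \<otimes> inv b"
    have h': "?h \<in> H" using normalizesD[OF H(2) bG h] .
    have hG: "h \<in> carrier G" using h by simp
    have "a \<otimes> ?h \<otimes> inv a \<otimes> inv ?h \<in> K" "?h \<otimes> inv h \<in> K" using a b h h' by (auto simp: iff)
    then have "(a \<otimes> ?h \<otimes> inv a \<otimes> inv ?h) \<otimes> (?h \<otimes> inv h) \<in> K" by (rule subgroup.m_closed[OF K])
    moreover have "(a \<otimes> ?h \<otimes> inv a \<otimes> inv ?h) \<otimes> (?h \<otimes> inv h) = a \<otimes> b \<otimes> h \<otimes> inv (a \<otimes> b) \<otimes> inv h"
      using aG bG hG by (simp add: inv_mult_group m_assoc)
    ultimately show ?thesis by simp
  qed
  then show "a \<otimes> b \<in> factor_centralizer G H K" using aG bG by (simp add: iff)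
qed

text \<open>Being primary is a condition on the order, which for the semidirect product is |H:K|
  times the index of the centralizer of H/K.\<close>

lemma sigma_central_iff:
  assumes K: "subgroup K G" and H: "subgroup H G" "normalizes (carrier G) H" and KH: "K \<subseteq> H"
  shows "sigma_central \<sigma> G H K \<longleftrightarrow> (\<exists>s\<in>\<sigma>. pi_number s (card H div card K) \<and>
    pi_number s (card (carrier G) div card (factor_centralizer G H K)))"
proof -
  let ?C = "factor_centralizer G H K"
  have C: "subgroup ?C G" by (rule factor_centralizer_subgroup[OF K H])
  let ?S = "semidirect_product (G\<lparr>carrier := H\<rparr> Mod K) (G Mod ?C) (factor_action G)"
  have "order ?S = (card H div card K) * (card (carrier G) div card ?C)"
    by (simp add: order_def semidirect_product_def FactGroup_def card_cartesian_product
        card_rcosets[OF K H(1) KH] card_rcosets_carrier[OF C])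
  moreover have pos: "card H div card K > 0" "card (carrier G) div card ?C > 0"
    using card_div_pos[OF K H(1) KH] card_div_pos[OF C subgroup_self subgroup.subset[OF C]] by auto
  moreover have "finite (carrier ?S)"
    using calculation by (intro card_ge_0_finite) (simp add: order_def)
  ultimately have "pi_group s ?S \<longleftrightarrow> pi_number s ((card H div card K) * (card (carrier G) div card ?C))" for s
    by (simp add: pi_group_def pi_number_def del: pi_number_mult)
  then show ?thesis by (simp add: sigma_central_def sigma_primary_def)
qed

end

section \<open>The residual inside a kernel and its chief factors\<close>

context sigma_group begin

abbreviation R :: "'a set" where "R \<equiv> sigma_nilpotent_residual \<sigma> G"

text \<open>The \<sigma>-Hall clause is the one that takes an argument: if p in s divides |R|, then
  |G:D| is an s'-number, and a prime q in s dividing |D:R| would equal p, so that p^2 would divide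
  |D|.\<close>

lemma residual_kernel:
  assumes D: "kernel_condition D" shows "cyclic_hall_kernel \<sigma> R"
proof -
  have ker: "cyclic_hall_kernel \<sigma> D" and cl: "sigma_closed \<sigma> D" using D by (auto simp: kernel_condition_def)
  have DN: "D \<lhd> G" and sqD: "squarefree (card D)" using ker by (auto simp: cyclic_hall_kernel_def)
  have DG: "subgroup D G" and RG: "subgroup R G" using DN residual_normal normal_imp_subgroup by auto
  have RD: "R \<subseteq> D" by (rule residual_least[OF DN cl])
  have dvd: "card R dvd card D" by (rule card_dvd[OF RG DG RD])
  have DsG: "D \<subseteq> carrier G" by (rule subgroup.subset[OF DG])
  have sq: "squarefree (card R)" by (rule squarefree_mono[OF dvd sqD])
  have comm: "x \<otimes> y = y \<otimes> x" if "x \<in> R" "y \<in> R" for x y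
    using kernel_abelian[OF ker subsetD[OF RD that(1)] subsetD[OF RD that(2)]] .
  obtain z where z: "z \<in> R" "ord z = card R"
    using squarefree_abelian_cyclic[OF RG comm squarefree_not_dvd_div[OF sq]] .
  have "generate G {z} = R" by (rule generate_eqI[OF RG z])
  moreover have "pi_number (- s) (card R) \<or> pi_number (- s) (card (carrier G) div card R)" if s: "s \<in> \<sigma>" for s
  proof (rule ccontr)
    assume no: "\<not> ?thesis"
    obtain p where p: "prime p" "p dvd card R" "p \<in> s"
      using no pi_numberI[OF card_pos[OF RG], of "- s"] by blast
    have "p dvd card D" using p(2) dvd by (rule dvd_trans)
    then have "pi_number (- s) (card (carrier G) div card D)"
      using ker s pi_number_prime[of "- s" "card D" p] p(1,3) by (auto simp: cyclic_hall_kernel_def)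
    moreover have "pi_number (- s) (card D div card R)"
    proof (rule pi_numberI[OF card_div_pos[OF RG DG RD]])
      fix q assume q: "prime q" "q dvd card D div card R"
      show "q \<in> - s"
      proof
        assume qs: "q \<in> s"
        have e: "card R * (card D div card R) = card D" by (rule card_mult_div[OF RG DG RD])
        then have "q dvd card D" using q(2) by (metis dvd_mult)
        then have "p = q" using ker s p q(1) qs \<open>p dvd card D\<close> unfolding cyclic_hall_kernel_def by blast
        then have "p * p dvd card D" using mult_dvd_mono[OF p(2) q(2)] e by simp
        then have "p ^ 2 dvd card D" by (simp add: power2_eq_square)
        then show False using squarefreeD[OF sqD] p(1) not_prime_unit by blast
      qed
    qed
    moreover have "card (carrier G) div card R = (card (carrier G) div card D) * (card D div card R)"
      by (rule card_tower[OF RG DG subgroup_self RD DsG])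
    ultimately show False using no by simp
  qed
  moreover have "p = q" if "s \<in> \<sigma>" "prime p" "prime q" "p dvd card R" "q dvd card R" "p \<in> s" "q \<in> s" for s p q
  proof -
    have "p dvd card D" "q dvd card D" using that(4,5) dvd dvd_trans by blast+
    then show ?thesis using ker that(1-3,6,7) unfolding cyclic_hall_kernel_def by blast
  qed
  ultimately show ?thesis using z(1) sq residual_normal unfolding cyclic_hall_kernel_def by blast
qed

text \<open>A central subgroup of order \<open>p\<close> would split off as a direct factor, and the residual of a direct
  product with a \<open>\<sigma>\<close>-primary group lies in the other factor.\<close>

lemma residual_no_central:
  assumes ker: "cyclic_hall_kernel \<sigma> R" and p: "prime p" and x: "x \<in> R" "ord x = p"
    and central: "\<And>g. g \<in> carrier G \<Longrightarrow> g \<otimes> x = x \<otimes> g"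
  shows False
proof -
  have RG: "subgroup R G" and nR: "normalizes (carrier G) R"
    using residual_normal normal_iff_normalizes_carrier by auto
  have RsG: "R \<subseteq> carrier G" by (rule subgroup.subset[OF RG])
  have xG: "x \<in> carrier G" using x(1) RsG by blast
  let ?P = "generate G {x}"
  have P: "subgroup ?P G" "?P \<subseteq> R" "card ?P = p"
    using xG x generate_is_subgroup generate_subgroup_incl[OF _ RG] generate_pow_card by auto
  have PsG: "?P \<subseteq> carrier G" using P(2) RsG by blast
  have cen: "g \<otimes> y = y \<otimes> g" if g: "g \<in> carrier G" and y: "y \<in> ?P" for g y
  proof -
    obtain i :: nat where i: "y = x [^] i" using y generate_pow_on_finite_carrier[OF fin xG] by auto
    show ?thesis unfolding i using group_commutes_pow[OF central[OF g, symmetric] xG g, of i] by simp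
  qed
  have pR: "p dvd card R" using ord_dvd_card[OF RG x(1)] x(2) by simp
  obtain s where s: "s \<in> \<sigma>" "p \<in> s" using cover[OF p] by blast
  have sG: "pi_number (- s) (card (carrier G) div card R)"
    using ker s pi_number_prime[of "- s" "card R" p] p pR by (auto simp: cyclic_hall_kernel_def)
  have "pi_number (- {p}) (card R div p)"
  proof (rule pi_numberI)
    show "card R div p > 0" using card_div_pos[OF P(1) RG P(2)] P(3) by simp
    fix q assume "prime q" "q dvd card R div p"
    then show "q \<in> - {p}" using squarefree_not_dvd_div[OF _ p pR] ker by (auto simp: cyclic_hall_kernel_def)
  qed
  moreover have "pi_number (- {p}) (card (carrier G) div card R)"
    by (rule pi_number_mono[OF sG]) (use s(2) in auto)
  moreover have "card (carrier G) div card ?P = (card (carrier G) div card R) * (card R div card ?P)"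
    by (rule card_tower[OF P(1) RG subgroup_self P(2) RsG])
  ultimately have iP: "pi_number (- {p}) (card (carrier G) div card ?P)" using P(3) by simp
  have pP: "pi_number {p} (card ?P)" using P(3) p by (simp add: pi_number_prime_self)
  from central_hall_split[OF subgroup_self P(1) PsG cen pP iP]
  obtain K where K: "subgroup K G" "K \<inter> ?P = {\<one>}" "?P <#> K = carrier G" "normalizes (carrier G) K" by metis
  \<comment> \<open>G is the direct product of the central subgroup <x> and K, so G/K is abelian and
    K contains all commutators.\<close>
  have cK: "a \<otimes> b \<otimes> inv a \<otimes> inv b \<in> K" if ab: "a \<in> carrier G" "b \<in> carrier G" for a b
  proof -
    have "a \<in> ?P <#> K" "b \<in> ?P <#> K" using ab K(3) by simp_all
    then obtain u k v l where *: "a = u \<otimes> k" "u \<in> ?P" "k \<in> K" "b = v \<otimes> l" "v \<in> ?P" "l \<in> K"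
      by (elim mult_set_memE)
    have G: "u \<in> carrier G" "k \<in> carrier G" "v \<in> carrier G" "l \<in> carrier G"
      using * PsG subgroup_carrier[OF K(1)] by auto
    have "a \<otimes> b \<otimes> inv a \<otimes> inv b = k \<otimes> l \<otimes> inv k \<otimes> inv l"
    proof -
      have "a \<otimes> b = u \<otimes> (k \<otimes> v) \<otimes> l" unfolding *(1,4) using G by (simp add: m_assoc)
      also have "k \<otimes> v = v \<otimes> k" by (rule cen[OF G(2) *(5)])
      also have "u \<otimes> (v \<otimes> k) \<otimes> l = u \<otimes> v \<otimes> (k \<otimes> l)" using G by (simp add: m_assoc)
      also have "\<dots> = (k \<otimes> l) \<otimes> (u \<otimes> v)"
        by (rule cen[symmetric]) (use G *(2,5) subgroup.m_closed[OF P(1)] in auto)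
      finally have 1: "a \<otimes> b = (k \<otimes> l) \<otimes> (u \<otimes> v)" .
      have "b \<otimes> a = v \<otimes> (l \<otimes> u) \<otimes> k" unfolding *(1,4) using G by (simp add: m_assoc)
      also have "l \<otimes> u = u \<otimes> l" by (rule cen[OF G(4) *(2)])
      also have "v \<otimes> (u \<otimes> l) \<otimes> k = v \<otimes> u \<otimes> (l \<otimes> k)" using G by (simp add: m_assoc)
      also have "\<dots> = (l \<otimes> k) \<otimes> (v \<otimes> u)"
        by (rule cen[symmetric]) (use G *(2,5) subgroup.m_closed[OF P(1)] in auto)
      also have "v \<otimes> u = u \<otimes> v" by (rule cen[OF G(3) *(2)])
      finally have 2: "b \<otimes> a = (l \<otimes> k) \<otimes> (u \<otimes> v)" .
      have "a \<otimes> b \<otimes> inv a \<otimes> inv b = (a \<otimes> b) \<otimes> inv (b \<otimes> a)" using ab by (simp add: inv_mult_group m_assoc)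
      also have "\<dots> = k \<otimes> l \<otimes> inv k \<otimes> inv l" unfolding 1 2 using G by (simp add: inv_mult_group m_assoc)
      finally show ?thesis .
    qed
    also have "\<dots> \<in> K" using *(3,6) K(1) by (intro subgroup.m_closed subgroup.m_inv_closed)
    finally show ?thesis .
  qed
  have RK: "subgroup (R \<inter> K) G" by (rule subgroups_Inter_pair[OF RG K(1)])
  \<comment> \<open>Both G/R and the abelian group G/K are \<sigma>-nilpotent, hence so is the
    quotient by the intersection; minimality of R puts x into K.\<close>
  have "sigma_closed \<sigma> (R \<inter> K)"
  proof (rule sigma_closedI)
    fix r a b assume r: "block_union \<sigma> r" and a: "a \<in> carrier G" and b: "b \<in> carrier G"
      and p: "pi_mod r (R \<inter> K) a" "pi_mod r (R \<inter> K) b"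
    let ?n = "pi_part r (card (carrier G))"
    have "a [^] ?n \<in> R \<inter> K" "b [^] ?n \<in> R \<inter> K" using p pi_mod_iff[OF RK] a b by auto
    then have "a [^] ?n \<otimes> b [^] ?n \<in> K" using subgroup.m_closed[OF K(1)] by blast
    moreover obtain c where "c \<in> K" "(a \<otimes> b) [^] ?n = c \<otimes> (a [^] ?n \<otimes> b [^] ?n)"
      using commutator_pow[OF K(1,4) cK a b] by blast
    ultimately have 1: "(a \<otimes> b) [^] ?n \<in> K" using subgroup.m_closed[OF K(1)] by simp
    have "pi_mod r R a" "pi_mod r R b" using p pi_mod_mono[OF _ subset_refl Int_lower1] by auto
    then have "pi_mod r R (a \<otimes> b)" by (rule sigma_closedD[OF residual_closed r a b])
    then have "(a \<otimes> b) [^] ?n \<in> R" using pi_mod_iff[OF RG] a b by simp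
    then show "pi_mod r (R \<inter> K) (a \<otimes> b)" using 1 pi_mod_iff[OF RK] a b by simp
  qed
  moreover have "R \<inter> K \<lhd> G" using RK normalizes_Int[OF nR K(4)] normal_iff_normalizes_carrier by blast
  ultimately have "R \<subseteq> R \<inter> K" by (intro residual_least)
  then have "x \<in> K" using x(1) by blast
  moreover have "x \<in> ?P" by (simp add: generate.incl)
  ultimately have "x \<in> {\<one>}" using K(2) by blast
  then have "p = 1" using x(2) by (simp add: ord_id)
  then show False using p by simp
qed

text \<open>A \<sigma>-central factor gives an s-number |G:C| for the centralizer C of H/K, where s
  contains a prime p dividing |H:K|. But C contains the abelian group R, and |G:R| is an s'-number;
  so C = G. An element x of order p in H satisfies [g,x] in K and, R being abelian, [g,x]^p = 1,
  while p does not divide |K|; thus x is central in G, which \<open>residual_no_central\<close>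
  excludes.\<close>

lemma kernel_eccentric:
  assumes ker: "cyclic_hall_kernel \<sigma> R" and HK: "chief_factor G H K" and HR: "H \<subseteq> R"
  shows "sigma_eccentric \<sigma> G H K"
proof (rule ccontr)
  have H: "subgroup H G" "normalizes (carrier G) H" and K: "subgroup K G" and KH: "K \<subset> H"
    using HK normal_iff_normalizes_carrier by (auto simp: chief_factor_def)
  have RG: "subgroup R G" and nR: "normalizes (carrier G) R"
    using residual_normal normal_iff_normalizes_carrier by auto
  have RsG: "R \<subseteq> carrier G" by (rule subgroup.subset[OF RG])
  have KsH: "K \<subseteq> H" using KH by blast
  let ?C = "factor_centralizer G H K"
  have C: "subgroup ?C G" by (rule factor_centralizer_subgroup[OF K H])
  have CG: "?C \<subseteq> carrier G" by (rule subgroup.subset[OF C])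
  assume "\<not> ?thesis"
  then obtain s where s: "s \<in> \<sigma>" "pi_number s (card H div card K)" "pi_number s (card (carrier G) div card ?C)"
    using sigma_central_iff[OF K H KsH] by (auto simp: sigma_eccentric_def)
  have "card H div card K \<noteq> 1" using card_eqD[OF K H(1) KsH] KH by blast
  then obtain p where p: "prime p" "p dvd card H div card K" using prime_factor_nat by blast
  have ps: "p \<in> s" by (rule pi_number_prime[OF s(2) p])
  have eH: "card K * (card H div card K) = card H" by (rule card_mult_div[OF K H(1) KsH])
  have pH: "p dvd card H" using p(2) eH by (metis dvd_mult)
  have HRd: "card H dvd card R" by (rule card_dvd[OF H(1) RG HR])
  have pR: "p dvd card R" using pH HRd by (rule dvd_trans)
  have pK: "\<not> p dvd card K"
  proof
    assume "p dvd card K"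
    then have "p * p dvd card H" using mult_dvd_mono[OF _ p(2)] eH by metis
    then have "p ^ 2 dvd card R" using HRd dvd_trans by (simp add: power2_eq_square) blast
    moreover have "squarefree (card R)" using ker by (simp add: cyclic_hall_kernel_def)
    ultimately show False using squarefreeD p(1) not_prime_unit by blast
  qed
  have sG: "pi_number (- s) (card (carrier G) div card R)"
    using ker s(1) pi_number_prime[of "- s" "card R" p] p(1) ps pR by (auto simp: cyclic_hall_kernel_def)
  have RC: "R \<subseteq> ?C"
  proof
    fix g assume g: "g \<in> R"
    have "g \<otimes> h \<otimes> inv g \<otimes> inv h = \<one>" if h: "h \<in> H" for h
    proof -
      have G: "g \<in> carrier G" "h \<in> carrier G" using g h RsG HR by auto
      have "g \<otimes> h = h \<otimes> g" by (rule kernel_abelian[OF ker g subsetD[OF HR h]])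
      then show ?thesis using G by (simp add: m_assoc)
    qed
    then show "g \<in> ?C" using g RsG subgroup.one_closed[OF K] by (auto simp: factor_centralizer_iff[OF K H(1)])
  qed
  have "card (carrier G) div card R = (card (carrier G) div card ?C) * (card ?C div card R)"
    by (rule card_tower[OF RG C subgroup_self RC CG])
  then have "pi_number (- s) (card (carrier G) div card ?C)" using sG by simp
  then have "card (carrier G) div card ?C = 1" by (rule pi_number_dvd_1[OF s(3)]) simp_all
  then have CeG: "?C = carrier G" by (rule card_eqD[OF C subgroup_self CG])
  obtain x where x: "x \<in> H" "ord x = p" using cauchy[OF H(1) p(1) pH] .
  have xG: "x \<in> carrier G" by (rule subgroup_carrier[OF H(1) x(1)])
  have "g \<otimes> x = x \<otimes> g" if g: "g \<in> carrier G" for g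
  proof -
    let ?y = "g \<otimes> x \<otimes> inv g"
    let ?c = "?y \<otimes> inv x"
    have cK: "?c \<in> K" using g CeG x(1) factor_centralizer_iff[OF K H(1)] by blast
    have yG: "?y \<in> carrier G" using g xG by simp
    have yR: "?y \<in> R" "inv x \<in> R"
      using normalizesD[OF H(2) g x(1)] subgroup.m_inv_closed[OF H(1) x(1)] HR by auto
    have xp: "x [^] p = \<one>" using pow_ord_eq_1[OF xG] x(2) by simp
    have "?c [^] p = ?y [^] p \<otimes> inv x [^] p"
      by (rule pow_mult_distrib[OF kernel_abelian[OF ker yR]]) (use g xG in auto)
    also have "\<dots> = \<one>" using xp conj_pow[OF g xG, of p] nat_pow_inv[OF xG, of p] g by simp
    finally have c1: "?c [^] p \<in> {\<one>}" by simp
    have c2: "?c [^] card K \<in> {\<one>}" using pow_card[OF K cK] by simp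
    have cop: "coprime p (card K)" using prime_imp_coprime[OF p(1) pK] .
    have "?c \<in> {\<one>}"
      by (rule pow_coprime_closed[OF triv_subgroup _ cop prime_gt_0_nat[OF p(1)] c1 c2]) (use g xG in auto)
    then have "?y = x" using inv_equality[of ?y "inv x"] yG xG by simp
    then have "?y \<otimes> g = x \<otimes> g" by simp
    then show ?thesis using g xG by (simp add: m_assoc)
  qed
  then show False by (rule residual_no_central[OF ker p(1) subsetD[OF HR x(1)] x(2)])
qed

text \<open>In the backward direction the given kernel is replaced by the residual: eccentricity of
  the chief factors rests on minimality, which an arbitrary kernel need not have.\<close>

lemma H_sigma_E_kernel_iff:
  "(\<exists>D M. H_sigma_E_group \<sigma> G D M \<and> D = sigma_nilpotent_residual \<sigma> G \<and>
        cyclic_group (G\<lparr>carrier := D\<rparr>) \<and> squarefree (card D)) \<longleftrightarrow> (\<exists>D. kernel_condition D)" (is "?L \<longleftrightarrow> ?R")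
proof
  assume ?L
  then have "cyclic_hall_kernel \<sigma> R"
    unfolding cyclic_hall_kernel_iff using residual_normal by (auto simp: H_sigma_E_group_def)
  then show ?R using residual_closed unfolding kernel_condition_def by blast
next
  assume ?R
  then have ker: "cyclic_hall_kernel \<sigma> R" using residual_kernel by blast
  obtain M where M: "internal_semidirect G R M" by (rule kernel_complement[OF ker])
  have RG: "subgroup R G" using residual_normal by (rule normal_imp_subgroup)
  have k: "cyclic_group (G\<lparr>carrier := R\<rparr>)" "sigma_hall_subgroup \<sigma> G R"
    "squarefree (card R)" "card (sigma_of \<sigma> (card R)) = card (prime_factors (card R))"
    using ker unfolding cyclic_hall_kernel_iff by auto
  obtain z where "z \<in> R" "generate G {z} = R" using ker by (auto simp: cyclic_hall_kernel_def)
  then have "has_sylow_tower (G\<lparr>carrier := R\<rparr>)" by (rule squarefree_cyclic_sylow_tower[OF RG _ _ k(3)])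
  then have "H_sigma_E_group \<sigma> G R M"
    unfolding H_sigma_E_group_def
    using M k kernel_eccentric[OF ker] squarefree_sylow_irreducible[OF RG k(3)] by blast
  then show ?L using k by blast
qed

end

theorem theorem1p9:
  fixes G :: "('a, 'b) monoid_scheme" and \<sigma> :: "nat set set"
  assumes "partition_on {p :: nat. Factorial_Ring.prime p} \<sigma>"
    and "group G" and "finite (carrier G)" and "sigma_full \<sigma> G"
  shows "let
      cond_i = (\<forall>A. subgroup A G \<longrightarrow> H_sigma_permutably_embedded \<sigma> G A);
      cond_ii = (\<exists>D M. H_sigma_E_group \<sigma> G D M \<and> D = sigma_nilpotent_residual \<sigma> G \<and>
        cyclic_group (G\<lparr>carrier := D\<rparr>) \<and> squarefree (card D));
      cond_iii = (\<exists>D M. internal_semidirect G D M \<and> cyclic_group (G\<lparr>carrier := D\<rparr>) \<and>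
        sigma_hall_subgroup \<sigma> G D \<and> squarefree (card D) \<and>
        card (sigma_of \<sigma> (card D)) = card (prime_factors (card D)) \<and>
        sigma_nilpotent \<sigma> (G\<lparr>carrier := M\<rparr>))
    in (cond_i \<longleftrightarrow> cond_ii) \<and> (cond_ii \<longleftrightarrow> cond_iii) \<and> (cond_i \<longleftrightarrow> cond_iii)"
proof -
  interpret sigma_group G \<sigma>
    using assms(1-3) by (simp add: sigma_group_def sigma_group_axioms_def finite_group_def finite_group_axioms_def)
  have "(\<forall>A. subgroup A G \<longrightarrow> H_sigma_permutably_embedded \<sigma> G A) \<longleftrightarrow> (\<exists>D. kernel_condition D)"
    using embedded_imp_kernel kernel_imp_embedded[OF assms(4)] by blast
  then show ?thesis unfolding Let_def H_sigma_E_kernel_iff kernel_condition_iff by blast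
qed

end
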